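(* For any $\alpha>\max\{\alpha_0,-\mu\}$ there exists a constant $K_1=K_1(\alpha,\mu)$, of the form $$K_1(\alpha,\mu)=C_1\Big(1+\frac{2\rho}{|\alpha+\mu|}\Big),$$ where $C_1=C_1(\alpha)$ is a positive constant such that $|X(t)|\le C_1e^{\alpha t}$ for all $t\ge0$, such that for every $\phi\in BC((-\infty,0],\mathbb{R})$ $$|E x(t;\phi)|\le K_1\|\phi\|e^{\alpha t},\qquad t\ge0 .$$ Therefore, if $\alpha_0<0$, the solution of the stochastic equation (S) is first moment exponentially stable.
   Context: Let $a,b,\sigma_0,\sigma_1,\sigma_2\in\mathbb{R}$ be constants. The delay kernel $K:[0,+\infty)\to[0,+\infty)$ is piecewise continuous with $\int_0^{+\infty}K(s)\,ds=1$, and there is $\mu>0$ with $\rho:=\int_0^{+\infty}e^{\mu s}K(s)\,ds<+\infty$. $BC((-\infty,0],\mathbb{R})$ is the space of bounded continuous functions $\phi:(-\infty,0]\to\mathbb{R}$ with norm $\|\phi\|=\sup_{\theta\le 0}|\phi(\theta)|$; it is the space of initial functions. The stochastic equation (S), in the Itô sense, with $W_t$ a one-dimensional Wiener process, is $$dx(t)=\Big(ax(t)+b\int_0^{+\infty}K(s)x(t-s)\,ds\Big)dt+\Big(\sigma_0+\sigma_1x(t)+\sigma_2\int_0^{+\infty}K(s)x(t-s)\,ds\Big)dW_t .$$ $x(t;\phi)$ denotes its solution with initial function $\phi\in BC((-\infty,0],\mathbb{R})$, and $E$ denotes expectation. The unperturbed equation is $x'(t)=ax(t)+b\int_0^{+\infty}K(s)x(t-s)\,ds$.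 Its fundamental solution $X(t)$ is the solution for $t\ge0$ with $X(0)=1$ and $X(t)=0$ for $t<0$. With $\mathcal{L}(K)(\lambda)=\int_0^{+\infty}e^{-\lambda t}K(t)\,dt$, the characteristic function is $h(\lambda)=\lambda-a-b\,\mathcal{L}(K)(\lambda)$ (well defined and analytic for $\mathrm{Re}(\lambda)\ge-\mu$), and $\alpha_0=\sup\{\mathrm{Re}(\lambda):h(\lambda)=0,\ \lambda\in\mathbb{C}\}$. The solution of (S) is said to be first moment exponentially stable if there exist positive constants $\gamma,R$ such that $|E(x(t;\phi))|\le R\|\phi\|e^{-\gamma t}$ for all $t\ge0$ and all $\phi\in BC((-\infty,0],\mathbb{R})$. *)

theory Defs
  imports "HOL-Probability.Probability"
begin

section \<open>Delay kernel and initial functions\<close>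

text \<open>
  Functions on $[0,\infty)$ and on $(-\infty,0]$ are total functions on the reals whose values
  outside the respective half line are never used.
\<close>

definition piecewise_continuous_half_line :: "(real \<Rightarrow> real) \<Rightarrow> bool" where
  "piecewise_continuous_half_line f \<longleftrightarrow>
     (\<forall>T>0. \<exists>S. finite S \<and> continuous_on ({0..T} - S) f) \<and>
     (\<forall>t\<ge>0. \<exists>l. (f \<longlongrightarrow> l) (at_right t)) \<and>
     (\<forall>t>0. \<exists>l. (f \<longlongrightarrow> l) (at_left t))"

definition delay_kernel :: "(real \<Rightarrow> real) \<Rightarrow> bool" where
  "delay_kernel K \<longleftrightarrow>
     piecewise_continuous_half_line K \<and> (\<forall>s\<ge>0. 0 \<le> K s) \<and>
     set_integrable lborel {0..} K \<and> (LINT s:{0..}|lborel. K s) = 1"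

definition finite_exp_moment :: "(real \<Rightarrow> real) \<Rightarrow> real \<Rightarrow> bool" where
  "finite_exp_moment K \<mu> \<longleftrightarrow> set_integrable lborel {0..} (\<lambda>s. exp (\<mu> * s) * K s)"

definition exp_moment :: "(real \<Rightarrow> real) \<Rightarrow> real \<Rightarrow> real" where
  "exp_moment K \<mu> = (LINT s:{0..}|lborel. exp (\<mu> * s) * K s)"

definition BC_neg :: "(real \<Rightarrow> real) set" where
  "BC_neg = {\<phi>. continuous_on {..0} \<phi> \<and> bounded (\<phi> ` {..0})}"

definition BC_norm :: "(real \<Rightarrow> real) \<Rightarrow> real" where
  "BC_norm \<phi> = (SUP \<theta>\<in>{..0}. \<bar>\<phi> \<theta>\<bar>)"

definition delay_term :: "(real \<Rightarrow> real) \<Rightarrow> (real \<Rightarrow> real) \<Rightarrow> real \<Rightarrow> real" where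
  "delay_term K x t = (LINT s:{0..}|lborel. K s * x (t - s))"


section \<open>The unperturbed equation\<close>

definition fundamental_solution :: "real \<Rightarrow> real \<Rightarrow> (real \<Rightarrow> real) \<Rightarrow> (real \<Rightarrow> real) \<Rightarrow> bool" where
  "fundamental_solution a b K X \<longleftrightarrow>
     X 0 = 1 \<and> (\<forall>t<0. X t = 0) \<and>
     (\<forall>t\<ge>0. (X has_real_derivative (a * X t + b * delay_term K X t)) (at t within {0..}))"

definition laplace_domain :: "(real \<Rightarrow> real) \<Rightarrow> complex set" where
  "laplace_domain K =
     {z. set_integrable lborel {0..} (\<lambda>t. exp (- z * of_real t) * of_real (K t))}"

definition laplace :: "(real \<Rightarrow> real) \<Rightarrow> complex \<Rightarrow> complex" where
  "laplace K z = (LINT t:{0..}|lborel. exp (- z * of_real t) * of_real (K t))"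

definition char_fun :: "real \<Rightarrow> real \<Rightarrow> (real \<Rightarrow> real) \<Rightarrow> complex \<Rightarrow> complex" where
  "char_fun a b K z = z - of_real a - of_real b * laplace K z"

text \<open>
  The membership in the domain is needed because the Bochner integral of a non-integrable
  function is 0, which would turn $a$ into a spurious zero.  The supremum is an extended real:
  it is $-\infty$ if there are no zeros.
\<close>

definition alpha0 :: "real \<Rightarrow> real \<Rightarrow> (real \<Rightarrow> real) \<Rightarrow> ereal" where
  "alpha0 a b K = (SUP z\<in>{z \<in> laplace_domain K. char_fun a b K z = 0}. ereal (Re z))"


section \<open>Wiener process and It\^{o} integral\<close>

text \<open>Times are nonnegative; the sigma algebras with negative index play no role.\<close>

definition wiener_process ::
    "'w measure \<Rightarrow> (real \<Rightarrow> 'w measure) \<Rightarrow> (real \<Rightarrow> 'w \<Rightarrow> real) \<Rightarrow> bool" where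
  "wiener_process M F W \<longleftrightarrow>
     prob_space M \<and> filtration (space M) F \<and> (\<forall>t. subalgebra M (F t)) \<and>
     (\<forall>t\<ge>0. W t \<in> borel_measurable (F t)) \<and>
     (AE \<omega> in M. W 0 \<omega> = 0) \<and>
     (AE \<omega> in M. continuous_on {0..} (\<lambda>t. W t \<omega>)) \<and>
     (\<forall>s\<ge>0. \<forall>t>s.
        distributed M lborel (\<lambda>\<omega>. W t \<omega> - W s \<omega>) (normal_density 0 (sqrt (t - s))) \<and>
        prob_space.indep_set M (sets (F s))
          {(\<lambda>\<omega>. W t \<omega> - W s \<omega>) -` B \<inter> space M |B. B \<in> sets borel})"

text \<open>
  An elementary integrand with $n$ steps takes the bounded, \<open>F (p i)\<close>-measurable value \<open>\<xi> i\<close>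
  on the interval \<open>{p i <.. p (Suc i)}\<close>.
\<close>

definition elementary_integrand ::
    "'w measure \<Rightarrow> (real \<Rightarrow> 'w measure) \<Rightarrow> nat \<Rightarrow> (nat \<Rightarrow> real) \<Rightarrow> (nat \<Rightarrow> 'w \<Rightarrow> real) \<Rightarrow> bool" where
  "elementary_integrand M F n p \<xi> \<longleftrightarrow>
     0 \<le> p 0 \<and> (\<forall>i<n. p i \<le> p (Suc i)) \<and>
     (\<forall>i<n. \<xi> i \<in> borel_measurable (F (p i)) \<and> (\<exists>B. \<forall>\<omega>\<in>space M. \<bar>\<xi> i \<omega>\<bar> \<le> B))"

definition elementary_process ::
    "nat \<Rightarrow> (nat \<Rightarrow> real) \<Rightarrow> (nat \<Rightarrow> 'w \<Rightarrow> real) \<Rightarrow> real \<Rightarrow> 'w \<Rightarrow> real" where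
  "elementary_process n p \<xi> s \<omega> = (\<Sum>i<n. \<xi> i \<omega> * indicator {p i<..p (Suc i)} s)"

definition elementary_integral ::
    "(real \<Rightarrow> 'w \<Rightarrow> real) \<Rightarrow> nat \<Rightarrow> (nat \<Rightarrow> real) \<Rightarrow> (nat \<Rightarrow> 'w \<Rightarrow> real) \<Rightarrow> real \<Rightarrow> 'w \<Rightarrow> real" where
  "elementary_integral W n p \<xi> t \<omega> =
     (\<Sum>i<n. \<xi> i \<omega> * (W (min (p (Suc i)) t) \<omega> - W (min (p i) t) \<omega>))"

text \<open>
  \<open>ito_integrand M F H t\<close>: \<open>H\<close> is jointly measurable and adapted on $[0,t]$ and almost every path
  is square integrable there.  No moment of \<open>H\<close> is assumed to be finite.
\<close>

definition ito_integrand ::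
    "'w measure \<Rightarrow> (real \<Rightarrow> 'w measure) \<Rightarrow> (real \<Rightarrow> 'w \<Rightarrow> real) \<Rightarrow> real \<Rightarrow> bool" where
  "ito_integrand M F H t \<longleftrightarrow>
     (\<lambda>(s, \<omega>). indicator {0..t} s * H s \<omega>) \<in> borel_measurable (lborel \<Otimes>\<^sub>M M) \<and>
     (\<forall>s\<in>{0..t}. H s \<in> borel_measurable (F s)) \<and>
     (AE \<omega> in M. (\<integral>\<^sup>+s\<in>{0..t}. ennreal ((H s \<omega>)\<^sup>2) \<partial>lborel) < \<infinity>)"

text \<open>
  \<open>J\<close> is (a version of) the It\^{o} integral of \<open>H\<close> over $[0,t]$: the limit in probability of the
  integrals of elementary integrands \<open>H\<^sub>k\<close> such that the integral of $(H_k - H)^2$ over $[0,t]$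
  tends to 0 in probability.  The limit does not depend on the approximating sequence.
\<close>

definition has_ito_integral ::
    "'w measure \<Rightarrow> (real \<Rightarrow> 'w measure) \<Rightarrow> (real \<Rightarrow> 'w \<Rightarrow> real) \<Rightarrow>
     (real \<Rightarrow> 'w \<Rightarrow> real) \<Rightarrow> real \<Rightarrow> ('w \<Rightarrow> real) \<Rightarrow> bool" where
  "has_ito_integral M F W H t J \<longleftrightarrow>
     ito_integrand M F H t \<and> J \<in> borel_measurable M \<and>
     (\<exists>n p \<xi>.
        (\<forall>k. elementary_integrand M F (n k) (p k) (\<xi> k)) \<and>
        (\<forall>\<epsilon>>0. (\<lambda>k. measure M {\<omega> \<in> space M.
            (\<integral>\<^sup>+s\<in>{0..t}. ennreal ((elementary_process (n k) (p k) (\<xi> k) s \<omega> - H s \<omega>)\<^sup>2) \<partial>lborel)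
              > ennreal \<epsilon>}) \<longlonglongrightarrow> 0) \<and>
        (\<forall>\<epsilon>>0. (\<lambda>k. measure M {\<omega> \<in> space M.
            \<bar>elementary_integral W (n k) (p k) (\<xi> k) t \<omega> - J \<omega>\<bar> > \<epsilon>}) \<longlonglongrightarrow> 0))"


section \<open>The stochastic equation\<close>

definition stochastic_solution ::
    "'w measure \<Rightarrow> (real \<Rightarrow> 'w measure) \<Rightarrow> (real \<Rightarrow> 'w \<Rightarrow> real) \<Rightarrow> real \<Rightarrow> real \<Rightarrow>
     real \<Rightarrow> real \<Rightarrow> real \<Rightarrow> (real \<Rightarrow> real) \<Rightarrow> (real \<Rightarrow> real) \<Rightarrow> (real \<Rightarrow> 'w \<Rightarrow> real) \<Rightarrow> bool" where
  "stochastic_solution M F W a b \<sigma>0 \<sigma>1 \<sigma>2 K \<phi> x \<longleftrightarrow>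
     (\<forall>\<omega>\<in>space M. \<forall>\<theta>\<le>0. x \<theta> \<omega> = \<phi> \<theta>) \<and>
     (\<forall>\<omega>\<in>space M. continuous_on {0..} (\<lambda>t. x t \<omega>)) \<and>
     (\<forall>t\<ge>0. x t \<in> borel_measurable (F t)) \<and>
     (\<forall>t\<ge>0. \<exists>J.
        has_ito_integral M F W
          (\<lambda>s \<omega>. \<sigma>0 + \<sigma>1 * x s \<omega> + \<sigma>2 * delay_term K (\<lambda>r. x r \<omega>) s) t J \<and>
        (AE \<omega> in M. x t \<omega> = \<phi> 0
           + (LINT s:{0..t}|lborel. a * x s \<omega> + b * delay_term K (\<lambda>r. x r \<omega>) s) + J \<omega>))"

text \<open>
  Integrability is stated explicitly: the expectation of a non-integrable random variable is 0 by
  convention, so that the bound alone would not say that the first moment exists.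
\<close>

definition first_moment_exponentially_stable ::
    "'w measure \<Rightarrow> (real \<Rightarrow> 'w measure) \<Rightarrow> (real \<Rightarrow> 'w \<Rightarrow> real) \<Rightarrow> real \<Rightarrow> real \<Rightarrow>
     real \<Rightarrow> real \<Rightarrow> real \<Rightarrow> (real \<Rightarrow> real) \<Rightarrow> bool" where
  "first_moment_exponentially_stable M F W a b \<sigma>0 \<sigma>1 \<sigma>2 K \<longleftrightarrow>
     (\<exists>\<gamma>>0. \<exists>R>0. \<forall>\<phi>\<in>BC_neg. \<forall>x. stochastic_solution M F W a b \<sigma>0 \<sigma>1 \<sigma>2 K \<phi> x \<longrightarrow>
        (\<forall>t\<ge>0. integrable M (x t) \<and>
           \<bar>prob_space.expectation M (x t)\<bar> \<le> R * BC_norm \<phi> * exp (- \<gamma> * t)))"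

end

theory Submission
  imports Defs "HOL-Complex_Analysis.Complex_Analysis" "HOL-Real_Asymp.Real_Asymp"
begin

text \<open>
  Localising on the events that the path has stayed in $[-N,N]$, the isometry for elementary
  integrals and a Gronwall argument bound the second moments of a solution, uniformly in $N$;
  hence the It\^{o} integral in the equation has mean zero and $E\,x(t)$ solves the deterministic
  equation.  For that equation the Laplace transform of the mean is
  $(\phi(0) + b\,\hat g)/h$, where $g(s) = \int_s^\infty K(u)\phi(s-u)\,du = O(e^{-\mu s})$.  The part
  $(\phi(0) + b\,\hat g)/(z-c)$ with $c < \alpha$ is inverted explicitly, while
  $1/h(z) - 1/(z-c) = O(|z|^{-2})$ is integrable on vertical lines, so that Fourier inversion and
  a shift of the line of integration to $\mathrm{Re}\,z = \alpha$ bound the rest.  The fundamental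
  solution is the case $\phi(0) = 1$, $g = 0$, so one constant serves for both.
\<close>

section \<open>Laplace transforms and Fourier inversion\<close>

text \<open>No moment of the solution is assumed finite, and the Ito integral is given only as a
  limit in probability, so expectations cannot simply be passed through it; nor do the elementary
  integrands of its definition come with moment bounds. They are traded for left-endpoint sums of
  the truncated coefficient, whose second moments the isometry controls by those of the solution
  itself. The truncation also supplies the finite a priori bound from which a Gronwall argument has
  to start. On the deterministic side the obstacle is the jump of the solution from 0 to its initial
  value at time 0: it makes 1/h of order 1/|z| only, which is not integrable on a vertical line.
  Subtracting an exponential with the same jump removes it, and its rate c < \<alpha> keeps the new
  pole to the left of the final line. The constant must depend on \<alpha> alone although \<mu>
  enters the bound. Hence the kernel has one fixed rate \<nu> and the forcing a separate rate
  \<mu>.\<close>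

lemma convolution_integral:
  fixes f g :: "real \<Rightarrow> complex"
  assumes f: "integrable lborel f" and g: "integrable lborel g"
  shows "integrable lborel (\<lambda>t. LINT s|lborel. f s * g (t - s))"
    and "(LINT t|lborel. LINT s|lborel. f s * g (t - s)) = (LINT s|lborel. f s) * (LINT s|lborel. g s)"
proof -
  have [measurable]: "f \<in> borel_measurable borel" "g \<in> borel_measurable borel"
    using f g by auto
  have shift: "integrable lborel (\<lambda>t. h (t - s))" "(LINT t|lborel. h (t - s)) = (LINT t|lborel. h t)"
    if "integrable lborel h" for h :: "real \<Rightarrow> 'b::{banach,second_countable_topology}" and s
    using lborel_integrable_real_affine[OF that, of 1 "-s"] lborel_integral_real_affine[of 1 h "-s"]
    by (simp_all add: algebra_simps)
  have ng: "integrable lborel (\<lambda>t. norm (g t))" using g by simp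
  have I: "integrable (lborel \<Otimes>\<^sub>M lborel) (\<lambda>(s,t). f s * g (t - s))"
  proof (rule lborel_pair.Fubini_integrable)
    show "(\<lambda>(s,t). f s * g (t - s)) \<in> borel_measurable (lborel \<Otimes>\<^sub>M lborel)" by measurable
    show "integrable lborel (\<lambda>x. \<integral>y. norm (case (x, y) of (s, t) \<Rightarrow> f s * g (t - s)) \<partial>lborel)"
      using f by (simp add: norm_mult shift(2)[OF ng])
    show "AE x in lborel. integrable lborel (\<lambda>y. case (x, y) of (s, t) \<Rightarrow> f s * g (t - s))"
      using shift(1)[OF g] by simp
  qed
  show "integrable lborel (\<lambda>t. LINT s|lborel. f s * g (t - s))"
    using lborel_pair.integrable_snd[OF I] by simp
  show "(LINT t|lborel. LINT s|lborel. f s * g (t - s)) = (LINT s|lborel. f s) * (LINT s|lborel. g s)"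
    using lborel_pair.Fubini_integral[OF I] by (simp add: shift(2)[OF g])
qed

text \<open>The characteristic function of the standard normal law, rescaled by \<sigma>. A wide
  Gaussian in \<open>w\<close> (small \<sigma>) becomes a narrow one in \<open>x\<close>, an
  approximate identity as \<sigma> tends to 0.\<close>

lemma gaussian_integral:
  fixes x \<sigma> :: real
  assumes "\<sigma> > 0"
  shows "integrable lborel (\<lambda>w. exp (- ((\<sigma> * w)\<^sup>2 / 2)))"
    and "(LINT w|lborel. iexp (w * x) * exp (- ((\<sigma> * w)\<^sup>2 / 2)))
           = complex_of_real (sqrt (2 * pi) / \<sigma> * exp (- ((x / \<sigma>)\<^sup>2 / 2)))"
proof -
  have "integrable lborel (\<lambda>w. sqrt (2*pi) * std_normal_density w)" by simp
  then have "integrable lborel (\<lambda>w. exp (- (w\<^sup>2 / 2)) :: real)"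
    by (simp add: std_normal_density_def)
  from lborel_integrable_real_affine[OF this, of \<sigma> 0] assms
  show "integrable lborel (\<lambda>w. exp (- ((\<sigma> * w)\<^sup>2 / 2)))" by simp
  define h where "h = (\<lambda>w. iexp (w * (x/\<sigma>)) * complex_of_real (exp (- (w\<^sup>2 / 2))))"
  have "char std_normal_distribution (x/\<sigma>) = (LINT w|lborel. std_normal_density w *\<^sub>R iexp (x/\<sigma> * w))"
    unfolding char_def by (subst integral_density) auto
  also have "\<dots> = (LINT w|lborel. complex_of_real (1 / sqrt (2*pi)) * h w)"
    by (intro Bochner_Integration.integral_cong refl) (simp add: h_def std_normal_density_def scaleR_conv_of_real mult_ac)
  also have "\<dots> = complex_of_real (1 / sqrt (2*pi)) * (LINT w|lborel. h w)" by simp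
  finally have "(LINT w|lborel. h w) = complex_of_real (sqrt (2*pi) * exp (- ((x / \<sigma>)\<^sup>2 / 2)))"
    by (simp add: char_std_normal_distribution field_simps flip: of_real_mult)
  moreover have "(LINT w|lborel. h w) = \<sigma> *\<^sub>R (LINT w|lborel. h (0 + \<sigma> * w))"
    using lborel_integral_real_affine[of \<sigma> h 0] assms by simp
  moreover have "h (0 + \<sigma> * w) = iexp (w * x) * complex_of_real (exp (- ((\<sigma> * w)\<^sup>2 / 2)))" for w
    using assms by (simp add: h_def)
  ultimately show "(LINT w|lborel. iexp (w * x) * exp (- ((\<sigma> * w)\<^sup>2 / 2)))
           = complex_of_real (sqrt (2 * pi) / \<sigma> * exp (- ((x / \<sigma>)\<^sup>2 / 2)))"
    using assms by (simp add: scaleR_conv_of_real field_simps)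
qed

text \<open>A Gaussian factor in frequency makes Fubini legitimate; exchanging the integrals turns
  the damped inverse transform into a normal average of \<open>f\<close> around \<open>t\<close>. As
  the width tends to 0, integrability of the transform handles one side, boundedness and continuity
  at \<open>t\<close> the other. Continuity is asked at the single point \<open>t\<close> because it
  is established later at positive times only.\<close>

lemma fourier_inversion:
  fixes f :: "real \<Rightarrow> complex"
  assumes f: "integrable lborel f" and B: "\<And>s. norm (f s) \<le> B" and cont: "isCont f t"
    and F: "integrable lborel (\<lambda>w. LINT s|lborel. iexp (- (w * s)) * f s)"
  shows "f t = (LINT w|lborel. iexp (w * t) * (LINT s|lborel. iexp (- (w * s)) * f s)) / (2 * pi)"
proof -
  have [measurable]: "f \<in> borel_measurable borel"
    using f by auto
  define F where "F = (\<lambda>w. LINT s|lborel. iexp (- (w * s)) * f s)"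
  have Fm[measurable]: "F \<in> borel_measurable borel" and FI: "integrable lborel F" using F by (auto simp: F_def)
  have smooth: "(LINT w|lborel. iexp (w * t) * F w * exp (- ((\<sigma> * w)\<^sup>2 / 2)))
      = (LINT z|lborel. f (t + \<sigma> * z) * (sqrt (2*pi) * exp (- (z\<^sup>2 / 2))))" if s: "\<sigma> > 0" for \<sigma> :: real
  proof -
    let ?e = "\<lambda>w. complex_of_real (exp (- ((\<sigma> * w)\<^sup>2 / 2)))"
    have I: "integrable (lborel \<Otimes>\<^sub>M lborel) (\<lambda>(w,s). f s * (iexp (w * (t - s)) * ?e w))"
    proof (rule lborel_pair.Fubini_integrable)
      show "(\<lambda>(w,s). f s * (iexp (w * (t - s)) * ?e w)) \<in> borel_measurable (lborel \<Otimes>\<^sub>M lborel)" by measurable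
      show "integrable lborel (\<lambda>x. \<integral>y. norm (case (x, y) of (w,s) \<Rightarrow> f s * (iexp (w * (t - s)) * ?e w)) \<partial>lborel)"
        using gaussian_integral(1)[OF s] by (simp add: norm_mult)
      show "AE x in lborel. integrable lborel (\<lambda>y. case (x, y) of (w,s) \<Rightarrow> f s * (iexp (w * (t - s)) * ?e w))"
      proof (rule AE_I2, unfold prod.case)
        fix w :: real
        show "integrable lborel (\<lambda>s. f s * (iexp (w * (t - s)) * ?e w))"
        proof (rule Bochner_Integration.integrable_bound[OF f])
          show "AE s in lborel. norm (f s * (iexp (w * (t - s)) * ?e w)) \<le> norm (f s)"
            by (rule AE_I2) (simp only: norm_mult norm_exp_i_times norm_of_real, simp add: mult_left_le)
        qed measurable
      qed
    qed
    have "(LINT w|lborel. iexp (w * t) * F w * ?e w) = (LINT w|lborel. LINT s|lborel. f s * (iexp (w * (t - s)) * ?e w))"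
    proof (intro Bochner_Integration.integral_cong refl)
      fix w :: real
      have "iexp (w * t) * F w * ?e w = (LINT s|lborel. (iexp (w * t) * ?e w) * (iexp (- (w * s)) * f s))"
        unfolding F_def by simp
      also have "\<dots> = (LINT s|lborel. f s * (iexp (w * (t - s)) * ?e w))"
        by (intro Bochner_Integration.integral_cong refl) (simp add: algebra_simps exp_diff exp_minus field_simps)
      finally show "iexp (w * t) * F w * ?e w = (LINT s|lborel. f s * (iexp (w * (t - s)) * ?e w))" .
    qed
    also have "\<dots> = (LINT s|lborel. LINT w|lborel. f s * (iexp (w * (t - s)) * ?e w))"
      using lborel_pair.Fubini_integral[OF I] by simp
    also have "\<dots> = (LINT s|lborel. f s * complex_of_real (sqrt (2 * pi) / \<sigma> * exp (- (((t - s) / \<sigma>)\<^sup>2 / 2))))"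
      by (simp only: gaussian_integral(2)[OF s] integral_mult_right_zero)
    \<comment> \<open>Substitution s = t + \<sigma> z; the Jacobian cancels the factor 1 / \<sigma>
      of the Gaussian.\<close>
    also have "\<dots> = \<bar>\<sigma>\<bar> *\<^sub>R (LINT z|lborel. f (t + \<sigma> * z) * complex_of_real (sqrt (2 * pi) / \<sigma> * exp (- (((t - (t + \<sigma> * z)) / \<sigma>)\<^sup>2 / 2))))"
      by (rule lborel_integral_real_affine) (use s in auto)
    also have "\<dots> = (LINT z|lborel. \<bar>\<sigma>\<bar> *\<^sub>R (f (t + \<sigma> * z) * complex_of_real (sqrt (2 * pi) / \<sigma> * exp (- (((t - (t + \<sigma> * z)) / \<sigma>)\<^sup>2 / 2)))))"
      by simp
    also have "\<dots> = (LINT z|lborel. f (t + \<sigma> * z) * (sqrt (2*pi) * exp (- (z\<^sup>2 / 2))))"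
      using s by (intro Bochner_Integration.integral_cong refl) (simp add: scaleR_conv_of_real)
    finally show ?thesis .
  qed
  define \<sigma> where "\<sigma> = (\<lambda>n. 1 / real (Suc n))"
  have \<sigma>: "\<sigma> n > 0" for n by (simp add: \<sigma>_def)
  have \<sigma>0: "\<sigma> \<longlonglongrightarrow> 0" unfolding \<sigma>_def by real_asymp
  have L: "(\<lambda>n. LINT w|lborel. iexp (w * t) * F w * exp (- ((\<sigma> n * w)\<^sup>2 / 2))) \<longlonglongrightarrow> (LINT w|lborel. iexp (w * t) * F w)"
  proof (rule integral_dominated_convergence[where w="\<lambda>w. norm (F w)"])
    show "AE w in lborel. (\<lambda>n. iexp (w * t) * F w * exp (- ((\<sigma> n * w)\<^sup>2 / 2))) \<longlonglongrightarrow> iexp (w * t) * F w"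
    proof (rule AE_I2)
      fix w
      have "(\<lambda>n. iexp (w * t) * F w * complex_of_real (exp (- ((\<sigma> n * w)\<^sup>2 / 2)))) \<longlonglongrightarrow> iexp (w * t) * F w * complex_of_real (exp (- ((0 * w)\<^sup>2 / 2)))"
        by (intro tendsto_intros \<sigma>0) auto
      then show "(\<lambda>n. iexp (w * t) * F w * exp (- ((\<sigma> n * w)\<^sup>2 / 2))) \<longlonglongrightarrow> iexp (w * t) * F w" by simp
    qed
  qed (use FI in \<open>auto simp: norm_mult mult_left_le\<close>)
  have R: "(\<lambda>n. LINT z|lborel. f (t + \<sigma> n * z) * (sqrt (2*pi) * exp (- (z\<^sup>2 / 2)))) \<longlonglongrightarrow>
    (LINT z|lborel. f t * (sqrt (2*pi) * exp (- (z\<^sup>2 / 2))))"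
  proof (rule integral_dominated_convergence[where w="\<lambda>z. B * (sqrt (2*pi) * exp (- (z\<^sup>2 / 2)))"])
    show "integrable lborel (\<lambda>z. B * (sqrt (2*pi) * exp (- (z\<^sup>2 / 2))))"
      using gaussian_integral(1)[of 1] by simp
    show "AE z in lborel. (\<lambda>n. f (t + \<sigma> n * z) * (sqrt (2*pi) * exp (- (z\<^sup>2 / 2)))) \<longlonglongrightarrow> f t * (sqrt (2*pi) * exp (- (z\<^sup>2 / 2)))"
    proof (rule AE_I2)
      fix z
      have "(\<lambda>n. t + \<sigma> n * z) \<longlonglongrightarrow> t + 0 * z" by (intro tendsto_intros \<sigma>0)
      then have "(\<lambda>n. f (t + \<sigma> n * z)) \<longlonglongrightarrow> f t"
        by (intro isCont_tendsto_compose[OF cont]) simp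
      then show "(\<lambda>n. f (t + \<sigma> n * z) * (sqrt (2*pi) * exp (- (z\<^sup>2 / 2)))) \<longlonglongrightarrow> f t * (sqrt (2*pi) * exp (- (z\<^sup>2 / 2)))"
        by (intro tendsto_intros)
    qed
  qed (use B in \<open>auto simp: norm_mult intro!: mult_right_mono\<close>)
  have "(LINT z|lborel. f t * (sqrt (2*pi) * exp (- (z\<^sup>2 / 2)))) = f t * (2 * pi)"
  proof -
    have "(LINT z|lborel. complex_of_real (exp (- (z\<^sup>2 / 2)))) = sqrt (2 * pi)"
      using gaussian_integral(2)[of 1 0] by simp
    then show ?thesis by (simp flip: of_real_mult)
  qed
  moreover have "(LINT w|lborel. iexp (w * t) * F w) = (LINT z|lborel. f t * (sqrt (2*pi) * exp (- (z\<^sup>2 / 2))))"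
    using LIMSEQ_unique[OF L] R smooth[OF \<sigma>] by simp
  ultimately have "(LINT w|lborel. iexp (w * t) * F w) = f t * (2 * pi)" by (simp only:)
  then show ?thesis by (simp add: F_def)
qed

section \<open>One-sided Laplace transforms, written as integrals over the whole line\<close>

definition bilaplace :: "(real \<Rightarrow> complex) \<Rightarrow> complex \<Rightarrow> complex" where
  "bilaplace f z = (LINT t|lborel. exp (- z * of_real t) * f t)"

lemma norm_exp_minus_1_le: "norm (exp z - 1) \<le> norm z * exp (norm z)" for z :: complex
proof -
  have "norm (exp z - exp 0) \<le> exp (norm z) * norm (z - 0)"
  proof (rule field_differentiable_bound)
    show "convex (cball (0::complex) (norm z))" by simp
    show "(exp has_field_derivative exp w) (at w within cball 0 (cmod z))" for w :: complex
      by (auto intro!: derivative_eq_intros)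
    show "cmod (exp w) \<le> exp (cmod z)" if "w \<in> cball 0 (cmod z)" for w
      using that complex_Re_le_cmod[of w] by (auto simp: norm_exp_eq_Re)
  qed auto
  then show ?thesis by (simp add: mult.commute)
qed

text \<open>Since \<open>f\<close> vanishes before 0, exp (- c t) dominates exp (- z t) in norm on
  the support as soon as Re z is at least \<open>c\<close>. The resulting bound does not depend on
  \<open>z\<close>, which gives uniform estimates on half planes.\<close>

lemma bilaplace_integrable:
  assumes f: "integrable lborel (\<lambda>t. exp (- c * t) *\<^sub>R f t)" and 0: "\<And>t. t < 0 \<Longrightarrow> f t = 0" and z: "c \<le> Re z"
  shows "integrable lborel (\<lambda>t. exp (- z * of_real t) * f t)"
    and "norm (bilaplace f z) \<le> (LINT t|lborel. exp (- c * t) * norm (f t))"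
proof -
  have [measurable]: "(\<lambda>t. exp (- c * t) *\<^sub>R f t) \<in> borel_measurable borel"
    using borel_measurable_integrable[OF f] by simp
  have "(\<lambda>t. exp (c * t) *\<^sub>R (exp (- c * t) *\<^sub>R f t)) \<in> borel_measurable borel"
    by measurable
  then have [measurable]: "f \<in> borel_measurable borel" by (simp flip: exp_add)
  have le: "norm (exp (- z * of_real t) * f t) \<le> exp (- c * t) * norm (f t)" for t
    using 0[of t] z by (cases "t < 0") (auto simp: norm_mult norm_exp_eq_Re intro!: mult_right_mono)
  show I: "integrable lborel (\<lambda>t. exp (- z * of_real t) * f t)"
    by (rule Bochner_Integration.integrable_bound[OF f]) (use le in auto)
  have "norm (bilaplace f z) \<le> (LINT t|lborel. norm (exp (- z * of_real t) * f t))"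
    unfolding bilaplace_def by simp
  also have "\<dots> \<le> (LINT t|lborel. exp (- c * t) * norm (f t))"
  proof (rule integral_mono)
    show "integrable lborel (\<lambda>t. exp (- c * t) * norm (f t))"
      using integrable_norm[OF f] by simp
  qed (use I le in auto)
  finally show "norm (bilaplace f z) \<le> (LINT t|lborel. exp (- c * t) * norm (f t))" .
qed

text \<open>Difference quotients are taken along arbitrary null sequences so that dominated
  convergence applies; complex differentiability at each point of an open set is holomorphy.\<close>

lemma bilaplace_holomorphic:
  assumes f: "integrable lborel (\<lambda>t. exp (- c * t) *\<^sub>R f t)" and 0: "\<And>t. t < 0 \<Longrightarrow> f t = 0"
  shows "bilaplace f holomorphic_on {z. c < Re z}"
proof (subst holomorphic_on_open[OF open_halfspace_Re_gt], intro ballI)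
  fix z assume "z \<in> {z. c < Re z}"
  then have z: "c < Re z" by simp
  have [measurable]: "(\<lambda>t. exp (- c * t) *\<^sub>R f t) \<in> borel_measurable borel"
    using borel_measurable_integrable[OF f] by simp
  have "(\<lambda>t. exp (c * t) *\<^sub>R (exp (- c * t) *\<^sub>R f t)) \<in> borel_measurable borel"
    by measurable
  then have [measurable]: "f \<in> borel_measurable borel" by (simp flip: exp_add)
  \<comment> \<open>Half the distance from \<open>z\<close> to the abscissa \<open>c\<close>: an
    increment shorter than \<open>d\<close> costs exp (d t), and the remaining decay exp (- d t)
    absorbs the factor \<open>t\<close> produced by differentiation, at the price 1 / d.\<close>
  define d where "d = (Re z - c) / 2"
  have d: "d > 0" using z by (simp add: d_def)
  let ?D = "LINT t|lborel. - of_real t * (exp (- z * of_real t) * f t)"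
  have "(\<lambda>n. (bilaplace f (z + S n) - bilaplace f z) / S n) \<longlonglongrightarrow> ?D" if S: "\<And>n. S n \<noteq> 0" "S \<longlonglongrightarrow> 0" for S
  proof -
    obtain N where N: "\<And>n. n \<ge> N \<Longrightarrow> norm (S n) < d"
      using S(2) d by (auto simp: LIMSEQ_iff)
    let ?s = "\<lambda>n t. (exp (- (z + S (n + N)) * of_real t) * f t - exp (- z * of_real t) * f t) / S (n + N)"
    have Re: "c \<le> Re (z + S (n + N))" for n
      using N[of "n + N"] abs_Re_le_cmod[of "S (n+N)"] d by (simp add: d_def field_simps)
    have "(\<lambda>n. LINT t|lborel. ?s n t) \<longlonglongrightarrow> ?D"
    proof (rule integral_dominated_convergence[where w="\<lambda>t. norm (exp (- c * t) *\<^sub>R f t) / d"])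
      show "integrable lborel (\<lambda>t. norm (exp (- c * t) *\<^sub>R f t) / d)"
        using f by (intro integrable_norm integrable_divide) auto
      show "AE t in lborel. (\<lambda>n. ?s n t) \<longlonglongrightarrow> - of_real t * (exp (- z * of_real t) * f t)"
      proof (rule AE_I2)
        fix t :: real
        have "((\<lambda>w. exp (- w * of_real t) * f t) has_field_derivative - of_real t * (exp (- z * of_real t) * f t)) (at z)"
          by (auto intro!: derivative_eq_intros)
        then have *: "((\<lambda>h. (exp (- (z + h) * of_real t) * f t - exp (- z * of_real t) * f t) / h) \<longlongrightarrow> - of_real t * (exp (- z * of_real t) * f t)) (at 0)"
          unfolding DERIV_def .
        have "filterlim (\<lambda>n. S (n + N)) (at 0) sequentially"
          using LIMSEQ_ignore_initial_segment[OF S(2), of N] S(1) by (simp add: filterlim_at)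
        from filterlim_compose[OF * this]
        show "(\<lambda>n. ?s n t) \<longlonglongrightarrow> - of_real t * (exp (- z * of_real t) * f t)" .
      qed
      fix n
      show "AE t in lborel. norm (?s n t) \<le> norm (exp (- c * t) *\<^sub>R f t) / d"
      proof (rule AE_I2)
        fix t :: real
        show "norm (?s n t) \<le> norm (exp (- c * t) *\<^sub>R f t) / d"
        proof (cases "t < 0")
          case True then show ?thesis using 0[of t] by simp
        next
          case False
          then have t: "t \<ge> 0" by simp
          let ?w = "S (n + N)"
          have "?s n t = exp (- z * of_real t) * f t * (exp (- ?w * of_real t) - 1) / ?w"
            by (simp add: algebra_simps flip: exp_add)
          then have "norm (?s n t) = norm (exp (- z * of_real t) * f t * (exp (- ?w * of_real t) - 1) / ?w)"
            by (rule arg_cong)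
          also have "\<dots> = exp (- Re z * t) * norm (f t) * norm (exp (- ?w * of_real t) - 1) / norm ?w"
            by (simp add: norm_mult norm_divide norm_exp_eq_Re)
          also have "\<dots> \<le> exp (- Re z * t) * norm (f t) * ((norm ?w * t) * exp (norm ?w * t)) / norm ?w"
            using norm_exp_minus_1_le[of "- ?w * of_real t"] t
            by (intro divide_right_mono mult_left_mono) (auto simp: norm_mult)
          also have "\<dots> = exp (- Re z * t) * norm (f t) * (t * exp (norm ?w * t))"
            using S(1) by simp
          also have "\<dots> \<le> exp (- Re z * t) * norm (f t) * (t * exp (d * t))"
            using N[of "n+N"] t by (intro mult_left_mono) (auto intro: mult_right_mono)
          also have "\<dots> = exp (- c * t) * norm (f t) * (t * exp (- d * t))"
            by (simp add: d_def algebra_simps flip: exp_add)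
          also have "\<dots> \<le> exp (- c * t) * norm (f t) * (1 / d)"
          proof (intro mult_left_mono)
            have "d * t \<le> exp (d * t)" using exp_ge_add_one_self[of "d * t"] by linarith
            then show "t * exp (- d * t) \<le> 1 / d" using d by (simp add: exp_minus field_simps)
          qed auto
          finally show ?thesis by simp
        qed
      qed
    qed (measurable)
    moreover have "(LINT t|lborel. ?s n t) = (bilaplace f (z + S (n + N)) - bilaplace f z) / S (n + N)" for n
      unfolding bilaplace_def using bilaplace_integrable(1)[OF f 0 Re[of n]] bilaplace_integrable(1)[OF f 0 less_imp_le[OF z]]
      by simp
    ultimately have "(\<lambda>n. (bilaplace f (z + S (n + N)) - bilaplace f z) / S (n + N)) \<longlonglongrightarrow> ?D" by (simp only:)
    then show ?thesis by (rule LIMSEQ_offset)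
  qed
  then have "((\<lambda>h. (bilaplace f (z + h) - bilaplace f z) / h) \<longlongrightarrow> ?D) (at 0)"
    by (simp add: tendsto_at_iff_sequentially o_def)
  then show "\<exists>D. (bilaplace f has_field_derivative D) (at z)" unfolding DERIV_def by blast
qed

text \<open>The exponential splits as exp (- z s) exp (- z (t - s)), so a weighted convolution is
  the convolution of the weighted functions.\<close>

lemma bilaplace_convolution:
  assumes "integrable lborel (\<lambda>t. exp (- z * of_real t) * f t)" and "integrable lborel (\<lambda>t. exp (- z * of_real t) * g t)"
  shows "integrable lborel (\<lambda>t. exp (- z * of_real t) * (LINT s|lborel. f s * g (t - s)))"
    and "bilaplace (\<lambda>t. LINT s|lborel. f s * g (t - s)) z = bilaplace f z * bilaplace g z"
proof -
  have eq: "exp (- z * of_real t) * (LINT s|lborel. f s * g (t - s))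
    = (LINT s|lborel. (exp (- z * of_real s) * f s) * (exp (- z * of_real (t - s)) * g (t - s)))" for t
  proof -
    have "(LINT s|lborel. (exp (- z * of_real s) * f s) * (exp (- z * of_real (t - s)) * g (t - s)))
      = (LINT s|lborel. exp (- z * of_real t) * (f s * g (t - s)))"
      by (intro Bochner_Integration.integral_cong refl) (simp add: algebra_simps flip: exp_add)
    then show ?thesis by simp
  qed
  show "integrable lborel (\<lambda>t. exp (- z * of_real t) * (LINT s|lborel. f s * g (t - s)))"
    unfolding eq by (rule convolution_integral(1)[OF assms])
  show "bilaplace (\<lambda>t. LINT s|lborel. f s * g (t - s)) z = bilaplace f z * bilaplace g z"
    unfolding bilaplace_def eq by (rule convolution_integral(2)[OF assms])
qed

text \<open>Serves in three roles: with \<open>c = 0\<close> for integration in time, with the pole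
  \<open>c\<close> for the explicitly inverted part, and at real points as the integral of
  exponential majorants.\<close>

lemma bilaplace_exp:
  assumes c: "c < Re z"
  shows "integrable lborel (\<lambda>t. exp (- z * of_real t) * complex_of_real (indicator {0..} t * exp (c * t)))"
    and "bilaplace (\<lambda>t. of_real (indicator {0..} t * exp (c * t))) z = 1 / (z - of_real c)"
proof -
  let ?e = "\<lambda>t. indicator {0..} t *\<^sub>R exp (- (z - of_real c) * of_real t)"
  let ?s = "\<lambda>n t. indicator {0..real n} t *\<^sub>R exp (- (z - of_real c) * of_real t)"
  have eq: "exp (- z * of_real t) * complex_of_real (indicator {0..} t * exp (c * t)) = ?e t" for t
    by (simp add: indicator_def algebra_simps exp_diff exp_minus divide_inverse mult.commute flip: exp_of_real)
  define \<kappa> where "\<kappa> = Re z - c"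
  have \<kappa>: "\<kappa> > 0" using c by (simp add: \<kappa>_def)
  have "(\<integral>\<^sup>+x. ennreal (exp (- \<kappa> * x)) * indicator {0..} x \<partial>lborel) = ennreal (0 - (- exp (- \<kappa> * 0) / \<kappa>))"
  proof (rule nn_integral_FTC_atLeast)
    show "((\<lambda>x. - exp (- \<kappa> * x) / \<kappa>) \<longlongrightarrow> 0) at_top"
      using \<kappa> by real_asymp
  qed (use \<kappa> in \<open>auto intro!: derivative_eq_intros\<close>)
  then have "integrable lborel (\<lambda>x. indicator {0..} x * exp (- \<kappa> * x))"
    by (intro integrableI_nonneg) (auto simp: indicator_mult_ennreal mult.commute)
  then have R: "integrable lborel (\<lambda>x. indicator {0..} x * exp ((c - Re z) * x))" by (simp add: \<kappa>_def)
  have cv: "AE t in lborel. (\<lambda>n. ?s n t) \<longlonglongrightarrow> ?e t"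
  proof (rule AE_I2)
    fix t :: real
    have "eventually (\<lambda>n. ?s n t = ?e t) sequentially"
      using eventually_ge_at_top[of "nat \<lceil>t\<rceil>"]
    proof eventually_elim
      case (elim n)
      then have "t \<le> real n" by linarith
      then show ?case by (simp add: indicator_def)
    qed
    then show "(\<lambda>n. ?s n t) \<longlonglongrightarrow> ?e t" by (rule tendsto_eventually)
  qed
  have bd: "AE t in lborel. norm (?s n t) \<le> indicator {0..} t * exp ((c - Re z) * t)" for n
    by (auto simp: indicator_def norm_exp_eq_Re algebra_simps)
  have m: "?e \<in> borel_measurable lborel" "?s n \<in> borel_measurable lborel" for n by measurable
  from integrable_dominated_convergence[OF m R cv bd]
  show "integrable lborel (\<lambda>t. exp (- z * of_real t) * complex_of_real (indicator {0..} t * exp (c * t)))"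
    unfolding eq .
  have zc: "z - of_real c \<noteq> 0" using c by (metis Re_complex_of_real diff_eq_eq add_0 less_irrefl)
  have "(\<lambda>n. LINT t|lborel. ?s n t) \<longlonglongrightarrow> (LINT t|lborel. ?e t)"
    by (rule integral_dominated_convergence[OF m R cv bd])
  moreover have "(LINT t|lborel. ?s n t) = (1 - exp (- (z - of_real c) * real n)) / (z - of_real c)" for n
  proof -
    have "(LINT t|lborel. ?s n t) = (- exp (- (z - of_real c) * of_real (real n)) / (z - of_real c)) - (- exp (- (z - of_real c) * of_real 0) / (z - of_real c))"
    proof (rule integral_FTC_atLeastAtMost)
      fix t :: real
      have "((\<lambda>t. - exp (- q * of_real t) / q) has_vector_derivative exp (- q * of_real t)) (at t within {0..real n})" if "q \<noteq> 0" for q :: complex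
        by (rule has_vector_derivative_real_field[where f="\<lambda>w. - exp (- q * w) / q"])
          (use that in \<open>auto intro!: derivative_eq_intros\<close>)
      from this[OF zc]
      show "((\<lambda>t. - exp (- (z - of_real c) * of_real t) / (z - of_real c)) has_vector_derivative exp (- (z - of_real c) * of_real t)) (at t within {0..real n})" .
    qed (auto intro!: continuous_intros)
    then show ?thesis by (simp add: diff_divide_distrib)
  qed
  moreover have "(\<lambda>n. (1 - exp (- (z - of_real c) * real n)) / (z - of_real c)) \<longlonglongrightarrow> (1 - 0) / (z - of_real c)"
  proof (intro tendsto_intros zc)
    have "(\<lambda>n. norm (exp (- (z - of_real c) * of_real (real n)))) \<longlonglongrightarrow> 0"
      unfolding norm_exp_eq_Re using c by simp real_asymp
    then show "(\<lambda>n. exp (- (z - of_real c) * of_real (real n))) \<longlonglongrightarrow> 0"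
      by (rule tendsto_norm_zero_cancel)
  qed
  ultimately have "(LINT t|lborel. ?e t) = 1 / (z - of_real c)"
    using LIMSEQ_unique by simp
  then show "bilaplace (\<lambda>t. of_real (indicator {0..} t * exp (c * t))) z = 1 / (z - of_real c)"
    unfolding bilaplace_def eq .
qed

text \<open>A primitive on the convex half plane replaces the contour integral over a rectangle:
  truncated line integrals are differences of \<open>P\<close> at the corners, and the two lines
  differ by increments of \<open>P\<close> along horizontal segments. These have the fixed length
  \<beta> - \<alpha>, so decay like 1 / |Im z| suffices.\<close>

lemma vertical_line_integral_shift:
  fixes \<Psi> :: "complex \<Rightarrow> complex"
  assumes hol: "\<Psi> holomorphic_on {z. c < Re z}" and c: "c < \<alpha>" "\<alpha> \<le> \<beta>"
    and I: "integrable lborel (\<lambda>w. \<Psi> (Complex \<alpha> w))" "integrable lborel (\<lambda>w. \<Psi> (Complex \<beta> w))"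
    and decay: "\<And>z. \<alpha> \<le> Re z \<Longrightarrow> Re z \<le> \<beta> \<Longrightarrow> R0 \<le> \<bar>Im z\<bar> \<Longrightarrow> norm (\<Psi> z) \<le> Q / \<bar>Im z\<bar>"
  shows "(LINT w|lborel. \<Psi> (Complex \<alpha> w)) = (LINT w|lborel. \<Psi> (Complex \<beta> w))"
proof -
  let ?H = "{z. c < Re z}"
  have H: "open ?H" "convex ?H" by (rule open_halfspace_Re_gt, rule convex_halfspace_Re_gt)
  obtain P where P: "\<And>z. z \<in> ?H \<Longrightarrow> (P has_field_derivative \<Psi> z) (at z)"
  proof (rule holomorphic_convex_primitive[OF H(2) finite.emptyI holomorphic_on_imp_continuous_on[OF hol]])
    show "\<Psi> field_differentiable at x" if "x \<in> interior ?H - {}" for x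
      using that hol H(1) by (simp add: interior_open holomorphic_on_imp_differentiable_at)
    fix g assume "\<And>x. x \<in> ?H \<Longrightarrow> (g has_field_derivative \<Psi> x) (at x within ?H)"
    then show thesis using that[of g] H(1) by (metis at_within_open)
  qed
  have line: "(LINT w|lborel. indicator {- R..R} w *\<^sub>R \<Psi> (Complex x w)) = - \<i> * (P (Complex x R) - P (Complex x (-R)))"
    if R: "R \<ge> 0" and x: "c < x" for R x
  proof -
    have "(LINT w|lborel. indicator {- R..R} w *\<^sub>R \<Psi> (Complex x w)) = - \<i> * P (Complex x R) - - \<i> * P (Complex x (-R))"
    proof (rule integral_FTC_atLeastAtMost)
      show "continuous_on {-R..R} (\<lambda>w. \<Psi> (Complex x w))"
        by (rule continuous_on_compose2[OF holomorphic_on_imp_continuous_on[OF hol]])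
          (use x in \<open>auto simp: Complex_eq intro!: continuous_intros\<close>)
      fix w :: real
      have "((\<lambda>w. Complex x w) has_vector_derivative \<i>) (at w within {-R..R})"
        unfolding Complex_eq has_vector_derivative_def
        by (auto intro!: derivative_eq_intros simp: scaleR_conv_of_real)
      moreover have "((\<lambda>z. - \<i> * P z) has_field_derivative - \<i> * \<Psi> (Complex x w)) (at (Complex x w))"
        using P[of "Complex x w"] x by (auto intro!: derivative_eq_intros)
      ultimately have "((\<lambda>z. - \<i> * P z) \<circ> Complex x has_vector_derivative \<i> * (- \<i> * \<Psi> (Complex x w))) (at w within {-R..R})"
        by (rule field_vector_diff_chain_within[OF _ has_field_derivative_at_within])
      then show "((\<lambda>w. - \<i> * P (Complex x w)) has_vector_derivative \<Psi> (Complex x w)) (at w within {-R..R})"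
        by (simp add: o_def)
    qed (use R in auto)
    then show ?thesis by (simp add: algebra_simps)
  qed
  have lim: "(\<lambda>n. LINT w|lborel. indicator {- real n..real n} w *\<^sub>R \<Psi> (Complex x w)) \<longlonglongrightarrow> (LINT w|lborel. \<Psi> (Complex x w))"
    if I: "integrable lborel (\<lambda>w. \<Psi> (Complex x w))" for x
  proof (rule integral_dominated_convergence[where w="\<lambda>w. norm (\<Psi> (Complex x w))"])
    show "AE w in lborel. (\<lambda>n. indicator {- real n..real n} w *\<^sub>R \<Psi> (Complex x w)) \<longlonglongrightarrow> \<Psi> (Complex x w)"
    proof (rule AE_I2)
      fix w :: real
      have "eventually (\<lambda>n. indicator {- real n..real n} w *\<^sub>R \<Psi> (Complex x w) = \<Psi> (Complex x w)) sequentially"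
        using eventually_ge_at_top[of "nat \<lceil>\<bar>w\<bar>\<rceil>"]
      proof eventually_elim
        case (elim n)
        then have "\<bar>w\<bar> \<le> real n" by linarith
        then show ?case by (simp add: abs_le_iff)
      qed
      then show "(\<lambda>n. indicator {- real n..real n} w *\<^sub>R \<Psi> (Complex x w)) \<longlonglongrightarrow> \<Psi> (Complex x w)" by (rule tendsto_eventually)
    qed
    show "(\<lambda>w. indicator {- real n..real n} w *\<^sub>R \<Psi> (Complex x w)) \<in> borel_measurable lborel" for n
      using I by measurable
  qed (use I in \<open>auto simp: indicator_def\<close>)
  have horiz: "norm (P (Complex \<beta> y) - P (Complex \<alpha> y)) \<le> (Q / \<bar>y\<bar>) * (\<beta> - \<alpha>)" if y: "R0 \<le> \<bar>y\<bar>" for y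
  proof -
    let ?S = "closed_segment (Complex \<alpha> y) (Complex \<beta> y)"
    have seg: "\<alpha> \<le> Re z \<and> Re z \<le> \<beta> \<and> Im z = y" if z: "z \<in> ?S" for z
    proof -
      obtain u where u: "0 \<le> u" "u \<le> 1" "z = (1 - u) *\<^sub>R Complex \<alpha> y + u *\<^sub>R Complex \<beta> y"
        using z by (auto simp: closed_segment_def)
      have "u * (\<beta> - \<alpha>) \<le> \<beta> - \<alpha>" "0 \<le> u * (\<beta> - \<alpha>)" using u c by (auto intro: mult_left_le_one_le)
      moreover have "Re z = (1 - u) * \<alpha> + u * \<beta>" "Im z = (1 - u) * y + u * y" using u(3) by simp_all
      ultimately show ?thesis by (auto simp: algebra_simps)
    qed
    have "norm (P (Complex \<beta> y) - P (Complex \<alpha> y)) \<le> (Q / \<bar>y\<bar>) * norm (Complex \<beta> y - Complex \<alpha> y)"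
    proof (rule field_differentiable_bound)
      show "(P has_field_derivative \<Psi> z) (at z within ?S)" if "z \<in> ?S" for z
        using P[of z] seg[OF that] c(1) by (auto intro: has_field_derivative_at_within)
      show "norm (\<Psi> z) \<le> Q / \<bar>y\<bar>" if "z \<in> ?S" for z
        using seg[OF that] decay[of z] y by auto
    qed auto
    also have "norm (Complex \<beta> y - Complex \<alpha> y) = \<beta> - \<alpha>" using c by (simp add: cmod_def)
    finally show ?thesis .
  qed
  have "(\<lambda>n. (LINT w|lborel. indicator {- real n..real n} w *\<^sub>R \<Psi> (Complex \<beta> w)) - (LINT w|lborel. indicator {- real n..real n} w *\<^sub>R \<Psi> (Complex \<alpha> w))) \<longlonglongrightarrow> 0"
  proof (rule Lim_null_comparison)
    show "(\<lambda>n. 2 * ((Q / real n) * (\<beta> - \<alpha>))) \<longlonglongrightarrow> 0" by real_asymp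
    show "\<forall>\<^sub>F n in sequentially. norm ((LINT w|lborel. indicator {- real n..real n} w *\<^sub>R \<Psi> (Complex \<beta> w)) - (LINT w|lborel. indicator {- real n..real n} w *\<^sub>R \<Psi> (Complex \<alpha> w))) \<le> 2 * ((Q / real n) * (\<beta> - \<alpha>))"
      using eventually_ge_at_top[of "nat \<lceil>R0\<rceil>"]
    proof eventually_elim
      case (elim n)
      then have n: "R0 \<le> real n" by linarith
      have "(LINT w|lborel. indicator {- real n..real n} w *\<^sub>R \<Psi> (Complex \<beta> w)) - (LINT w|lborel. indicator {- real n..real n} w *\<^sub>R \<Psi> (Complex \<alpha> w))
        = - \<i> * ((P (Complex \<beta> n) - P (Complex \<alpha> n)) - (P (Complex \<beta> (-n)) - P (Complex \<alpha> (-n))))"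
        using c by (simp add: line algebra_simps)
      also have "norm \<dots> \<le> norm (P (Complex \<beta> n) - P (Complex \<alpha> n)) + norm (P (Complex \<beta> (-n)) - P (Complex \<alpha> (-n)))"
        by (simp add: norm_mult norm_triangle_ineq4)
      also have "\<dots> \<le> 2 * ((Q / real n) * (\<beta> - \<alpha>))"
        using horiz[of n] horiz[of "- n"] n by simp
      finally show ?case .
    qed
  qed
  moreover have "(\<lambda>n. (LINT w|lborel. indicator {- real n..real n} w *\<^sub>R \<Psi> (Complex \<beta> w)) - (LINT w|lborel. indicator {- real n..real n} w *\<^sub>R \<Psi> (Complex \<alpha> w))) \<longlonglongrightarrow> (LINT w|lborel. \<Psi> (Complex \<beta> w)) - (LINT w|lborel. \<Psi> (Complex \<alpha> w))"
    by (intro tendsto_diff lim I)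
  ultimately show ?thesis using LIMSEQ_unique by fastforce
qed

text \<open>\<open>f\<close> is meant to carry a decaying weight already, strong enough that an
  integral equation returns at most half of any bound \<open>N\<close> put into it. Applied to the
  supremum this reads N <= A + N / 2; the a priori bound \<open>B\<close> makes the supremum
  finite.\<close>

lemma weighted_gronwall:
  fixes f :: "real \<Rightarrow> real"
  assumes bd: "\<And>t. t \<in> {0..T} \<Longrightarrow> f t \<le> B"
    and step: "\<And>N t. 0 \<le> N \<Longrightarrow> (\<And>s. s \<in> {0..T} \<Longrightarrow> f s \<le> N) \<Longrightarrow> t \<in> {0..T} \<Longrightarrow> f t \<le> A + N / 2"
    and A: "0 \<le> A" and t: "t \<in> {0..T}"
  shows "f t \<le> 2 * A"
proof -
  \<comment> \<open>The maximum with 0 makes \<open>N\<close> admissible in \<open>step\<close>,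
    which asks for a nonnegative bound.\<close>
  define N where "N = max 0 (SUP t\<in>{0..T}. f t)"
  have le: "f s \<le> N" if "s \<in> {0..T}" for s
  proof -
    have "bdd_above (f ` {0..T})" by (rule bdd_aboveI2) (rule bd)
    from cSUP_upper[OF that this] show ?thesis by (simp add: N_def)
  qed
  have "(SUP t\<in>{0..T}. f t) \<le> A + N / 2"
    using t step[of N] le by (intro cSUP_least) (auto simp: N_def)
  then have "N \<le> A + N / 2" using A by (auto simp: N_def max_def)
  then show ?thesis using le[OF t] by simp
qed

section \<open>Volterra equations\<close>

text \<open>Continuity is taken over from the gauge integral, with which the Lebesgue integral
  agrees here.\<close>

lemma set_integral_upper_limit:
  fixes n :: "real \<Rightarrow> real"
  assumes n[measurable]: "n \<in> borel_measurable borel" and bd: "\<And>t. t \<in> {0..T} \<Longrightarrow> \<bar>n t\<bar> \<le> B"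
  shows "set_integrable lborel {0..T} n" and "continuous_on {0..T} (\<lambda>t. LINT s:{0..t}|lborel. n s)"
proof -
  have I: "set_integrable lborel {0..t} n" if "t \<le> T" for t
    unfolding set_integrable_def
  proof (rule Bochner_Integration.integrable_bound[of _ "\<lambda>s. indicator {0..t} s *\<^sub>R B"])
    show "integrable lborel (\<lambda>s. indicator {0..t} s *\<^sub>R B)"
      using borel_integrable_atLeastAtMost'[of 0 t "\<lambda>_. B"] unfolding set_integrable_def by simp
    show "AE s in lborel. norm (indicator {0..t} s *\<^sub>R n s) \<le> norm (indicator {0..t} s *\<^sub>R B)"
    proof (rule AE_I2)
      fix s show "norm (indicator {0..t} s *\<^sub>R n s) \<le> norm (indicator {0..t} s *\<^sub>R B)"
        using bd[of s] that by (auto simp: indicator_def)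
    qed
  qed simp
  show "set_integrable lborel {0..T} n" by (rule I) simp
  have "continuous_on {0..T} (\<lambda>t. integral {0..t} n)"
    by (rule indefinite_integral_continuous_1) (rule set_borel_integral_eq_integral(1)[OF I], simp)
  then show "continuous_on {0..T} (\<lambda>t. LINT s:{0..t}|lborel. n s)"
    by (rule continuous_on_eq) (use set_borel_integral_eq_integral(2)[OF I] in auto)
qed

lemma set_integral_exp_le:
  fixes \<beta> :: real
  assumes "\<beta> > 0" "t \<ge> 0"
  shows "(LINT s:{0..t}|lborel. exp (\<beta> * s)) \<le> exp (\<beta> * t) / \<beta>"
proof -
  have "(LINT s:{0..t}|lborel. exp (\<beta> * s)) = exp (\<beta> * t) / \<beta> - exp (\<beta> * 0) / \<beta>"
    unfolding set_lebesgue_integral_def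
    by (rule integral_FTC_atLeastAtMost)
      (use assms in \<open>auto intro!: derivative_eq_intros continuous_intros simp flip: has_real_derivative_iff_has_vector_derivative\<close>)
  then show ?thesis using assms by simp
qed

definition convolution :: "(real \<Rightarrow> real) \<Rightarrow> (real \<Rightarrow> real) \<Rightarrow> real \<Rightarrow> real" where
  "convolution f g t = (LINT s|lborel. f s * g (t - s))"

lemma measurable_convolution[measurable]:
  assumes [measurable]: "f \<in> borel_measurable borel" "g \<in> borel_measurable borel"
  shows "convolution f g \<in> borel_measurable borel"
  unfolding convolution_def by measurable

lemma of_real_convolution:
  "complex_of_real (convolution f g t) = (LINT s|lborel. complex_of_real (f s) * complex_of_real (g (t - s)))"
  unfolding convolution_def by (simp flip: integral_complex_of_real)

abbreviation laplace_real :: "(real \<Rightarrow> real) \<Rightarrow> complex \<Rightarrow> complex" where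
  "laplace_real f \<equiv> bilaplace (\<lambda>t. complex_of_real (f t))"

section \<open>Half-plane estimates for the reciprocal of the characteristic function\<close>

locale volterra_kernel =
  fixes k :: "real \<Rightarrow> real" and a b \<nu> c \<alpha> :: real
  assumes k_int: "integrable lborel (\<lambda>t. exp (\<nu> * t) * k t)" and k_neg: "\<And>t. t < 0 \<Longrightarrow> k t = 0"
    and \<nu>: "0 \<le> \<nu>" "- \<nu> < c" and c: "c < \<alpha>"
    and nonzero: "\<And>z. c \<le> Re z \<Longrightarrow> z - of_real a - of_real b * laplace_real k z \<noteq> 0"
begin

text \<open>An absolute moment, since \<open>k\<close> may change sign here. It bounds the transform
  on Re z >= - \<nu> and, by \<nu> >= 0, also the mass of |k|.\<close>

definition \<rho> where "\<rho> = (LINT t|lborel. exp (\<nu> * t) * \<bar>k t\<bar>)"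

definition h where "h z = z - of_real a - of_real b * laplace_real k z"

text \<open>The two terms share the leading order 1 / z at infinity, and the pole \<open>c\<close>
  sits on the edge of the half plane in which \<open>G\<close> is holomorphic.\<close>

definition G where "G z = 1 / h z - 1 / (z - of_real c)"

text \<open>Beyond this radius both |h z| and |z - c| are at least |z| / 2. The same quantity bounds
  the numerator of \<open>G\<close> by \<open>R0 / 2\<close>, and the summand 1 ensures
  \<open>R0 \<ge> 1\<close>.\<close>

definition R0 where "R0 = 2 * (\<bar>a\<bar> + \<bar>b\<bar> * \<rho> + \<bar>c\<bar>) + 1"

lemma k_measurable[measurable]: "k \<in> borel_measurable borel"
proof -
  have [measurable]: "(\<lambda>t. exp (\<nu> * t) * k t) \<in> borel_measurable borel"
    using borel_measurable_integrable[OF k_int] by simp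
  have "(\<lambda>t. exp (- \<nu> * t) * (exp (\<nu> * t) * k t)) \<in> borel_measurable borel" by measurable
  then show ?thesis by (simp flip: exp_add mult.assoc)
qed

lemma k_int': "integrable lborel (\<lambda>t. exp (- (- \<nu>) * t) *\<^sub>R complex_of_real (k t))"
  using integrable_of_real[OF k_int, where 'a=complex] by (simp add: scaleR_conv_of_real)

lemma k_integrable: "- \<nu> \<le> Re z \<Longrightarrow> integrable lborel (\<lambda>t. exp (- z * of_real t) * complex_of_real (k t))"
  by (rule bilaplace_integrable(1)[OF k_int']) (auto simp: k_neg)

lemma norm_laplace_k: "- \<nu> \<le> Re z \<Longrightarrow> norm (laplace_real k z) \<le> \<rho>"
  using bilaplace_integrable(2)[OF k_int', of z] by (auto simp: k_neg \<rho>_def)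

lemma \<rho>_nonneg: "0 \<le> \<rho>" by (simp add: \<rho>_def)

lemma k_abs: "integrable lborel (\<lambda>t. \<bar>k t\<bar>)" "(LINT t|lborel. \<bar>k t\<bar>) \<le> \<rho>"
proof -
  have le: "\<bar>k t\<bar> \<le> exp (\<nu> * t) * \<bar>k t\<bar>" for t
    using k_neg[of t] \<nu> mult_right_mono[of 1 "exp (\<nu> * t)" "\<bar>k t\<bar>"] by (cases "t < 0") auto
  have I: "integrable lborel (\<lambda>t. exp (\<nu> * t) * \<bar>k t\<bar>)"
    using integrable_abs[OF k_int] by (simp add: abs_mult)
  show "integrable lborel (\<lambda>t. \<bar>k t\<bar>)"
    by (rule Bochner_Integration.integrable_bound[OF I]) (use le in \<open>auto simp: abs_mult\<close>)
  then show "(LINT t|lborel. \<bar>k t\<bar>) \<le> \<rho>"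
    unfolding \<rho>_def using I le by (intro integral_mono)
qed

lemma hol_h: "h holomorphic_on {z. c < Re z}"
proof -
  have "laplace_real k holomorphic_on {z. - \<nu> < Re z}"
    by (rule bilaplace_holomorphic[OF k_int']) (simp add: k_neg)
  then have "laplace_real k holomorphic_on {z. c < Re z}"
    by (rule holomorphic_on_subset) (use \<nu> in auto)
  then show ?thesis unfolding h_def by (intro holomorphic_intros)
qed

lemma h_nonzero: "c \<le> Re z \<Longrightarrow> h z \<noteq> 0"
  using nonzero by (simp add: h_def)

lemma hol_G: "G holomorphic_on {z. c < Re z}"
  unfolding G_def using h_nonzero
  by (intro holomorphic_intros hol_h) (auto dest: arg_cong[where f=Re])

text \<open>Over the common denominator h z (z - c) the terms linear in \<open>z\<close> cancel.
  What remains in the numerator is bounded on the half plane, because the transform of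
  \<open>k\<close> is at most \<rho> there; each factor below contributes |z| / 2.\<close>

lemma G_decay:
  assumes z: "c < Re z" and R: "R0 \<le> norm z"
  shows "norm (G z) \<le> 2 * R0 / (norm z)\<^sup>2"
proof -
  have Rez: "- \<nu> \<le> Re z" using z \<nu> by simp
  have R0: "R0 \<ge> 1" using \<rho>_nonneg by (simp add: R0_def)
  have lk: "norm (of_real b * laplace_real k z) \<le> \<bar>b\<bar> * \<rho>"
    using norm_laplace_k[OF Rez] by (simp add: norm_mult mult_left_mono)
  have "norm z - norm (h z) \<le> norm (z - h z)" by (rule norm_triangle_ineq2)
  also have "z - h z = of_real a + of_real b * laplace_real k z" by (simp add: h_def)
  also have "norm \<dots> \<le> \<bar>a\<bar> + \<bar>b\<bar> * \<rho>" using lk by (intro norm_triangle_le) simp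
  finally have hz: "norm z / 2 \<le> norm (h z)" using R by (simp add: R0_def)
  have "norm z - norm (of_real c :: complex) \<le> norm (z - of_real c)" by (rule norm_triangle_ineq2)
  moreover have "0 \<le> \<bar>b\<bar> * \<rho>" using \<rho>_nonneg by simp
  ultimately have zc: "norm z / 2 \<le> norm (z - of_real c)" using R by (simp add: R0_def)
  have pos: "norm z > 0" using R R0 by linarith
  have "z - of_real c \<noteq> 0" "h z \<noteq> 0" using zc hz pos by auto
  then have "G z = (of_real a + of_real b * laplace_real k z - of_real c) / (h z * (z - of_real c))"
    by (simp add: G_def h_def field_simps)
  then have "norm (G z) = norm (of_real a + of_real b * laplace_real k z - of_real c) / (norm (h z) * norm (z - of_real c))"
    by (simp add: norm_divide norm_mult)
  also have "\<dots> \<le> (R0 / 2) / ((norm z / 2) * (norm z / 2))"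
  proof (intro frac_le mult_mono)
    have "norm (of_real a + of_real b * laplace_real k z - of_real c) \<le> norm (of_real a + of_real b * laplace_real k z) + norm (of_real c :: complex)"
      by (rule norm_triangle_ineq4)
    also have "\<dots> \<le> (\<bar>a\<bar> + \<bar>b\<bar> * \<rho>) + \<bar>c\<bar>" using lk by (intro add_mono norm_triangle_le) simp_all
    finally show "norm (of_real a + of_real b * laplace_real k z - of_real c) \<le> R0 / 2" by (simp add: R0_def)
  qed (use hz zc pos R0 in auto)
  also have "\<dots> = 2 * R0 / (norm z)\<^sup>2" by (simp add: power2_eq_square)
  finally show ?thesis .
qed

text \<open>Compactness covers |w| <= R0 and \<open>G_decay\<close> the rest, so that one integrable
  majorant, up to a constant, fits every line to the right of \<open>c\<close>.\<close>

lemma G_line_bound: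
  assumes x: "c < x"
  obtains C where "C \<ge> 0" "\<And>w. norm (G (Complex x w)) \<le> C * inverse (1 + w\<^sup>2)"
proof -
  have R0: "R0 \<ge> 1" using \<rho>_nonneg by (simp add: R0_def)
  have "continuous_on {-R0..R0} (\<lambda>w. G (Complex x w))"
    by (rule continuous_on_compose2[OF holomorphic_on_imp_continuous_on[OF hol_G]])
      (use x in \<open>auto simp: Complex_eq intro!: continuous_intros\<close>)
  then have "bounded ((\<lambda>w. G (Complex x w)) ` {-R0..R0})"
    by (intro compact_imp_bounded compact_continuous_image) auto
  then obtain B where B: "B > 0" "\<And>w. w \<in> {-R0..R0} \<Longrightarrow> norm (G (Complex x w)) \<le> B"
    unfolding bounded_pos by auto
  show thesis
  proof
    show "0 \<le> B * (1 + R0\<^sup>2) + 4 * R0" using B R0 by simp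
    fix w :: real
    show "norm (G (Complex x w)) \<le> (B * (1 + R0\<^sup>2) + 4 * R0) * inverse (1 + w\<^sup>2)"
    proof (cases "\<bar>w\<bar> \<le> R0")
      case True
      then have "1 + w\<^sup>2 \<le> 1 + R0\<^sup>2" using R0 by (simp add: abs_le_square_iff[symmetric])
      then have "B * (1 + w\<^sup>2) \<le> B * (1 + R0\<^sup>2) + 4 * R0" using B R0 by (simp add: add_increasing2)
      moreover have "0 < 1 + w\<^sup>2" by (simp add: add_pos_nonneg)
      ultimately have "B \<le> (B * (1 + R0\<^sup>2) + 4 * R0) * inverse (1 + w\<^sup>2)" by (simp add: field_simps)
      moreover have "norm (G (Complex x w)) \<le> B" using B(2)[of w] True by (auto simp: abs_le_iff)
      ultimately show ?thesis by linarith
    next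
      case False
      then have nw: "\<bar>w\<bar> \<ge> R0" by simp
      have le: "\<bar>w\<bar> \<le> norm (Complex x w)" using abs_Im_le_cmod[of "Complex x w"] by simp
      have w1: "1 \<le> w\<^sup>2" using nw R0 one_le_power[of "\<bar>w\<bar>" 2] by simp
      have "norm (G (Complex x w)) \<le> 2 * R0 / (norm (Complex x w))\<^sup>2"
        using nw le x by (intro G_decay) auto
      also have "\<dots> \<le> 2 * R0 / w\<^sup>2"
        using R0 w1 le by (intro divide_left_mono) (auto simp: abs_le_square_iff[symmetric] intro!: mult_pos_pos)
      also have "\<dots> = 4 * R0 / (2 * w\<^sup>2)" by simp
      also have "\<dots> \<le> 4 * R0 / (1 + w\<^sup>2)"
        using w1 R0 by (intro divide_left_mono) (auto intro!: mult_pos_pos)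
      also have "\<dots> = 4 * R0 * inverse (1 + w\<^sup>2)" by (simp add: divide_inverse)
      also have "\<dots> \<le> (B * (1 + R0\<^sup>2) + 4 * R0) * inverse (1 + w\<^sup>2)"
        using B by (intro mult_right_mono) (auto simp: add_nonneg_nonneg)
      finally show ?thesis .
    qed
  qed
qed

end

section \<open>Exponential growth bounds and the transformed equation\<close>

lemma integrable_inverse_1_plus_square_real: "integrable lborel (\<lambda>w::real. inverse (1 + w\<^sup>2))"
  using integrable_inverse_1_plus_square by (simp add: set_integrable_def)

text \<open>Also valid for non-integrable \<open>f\<close>: its Bochner integral is 0 by convention,
  and the domination forces the integral of \<open>w\<close> to be nonnegative. Where only a bound
  is wanted, measurability of an integrand need not be discussed.\<close>

lemma integral_abs_le:
  fixes f w :: "'a \<Rightarrow> real"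
  assumes w: "integrable M w" and le: "\<And>x. x \<in> space M \<Longrightarrow> \<bar>f x\<bar> \<le> w x"
  shows "\<bar>integral\<^sup>L M f\<bar> \<le> integral\<^sup>L M w"
proof (cases "integrable M f")
  case True
  have "norm (integral\<^sup>L M f) \<le> (LINT x|M. norm (f x))" by simp
  also have "\<dots> \<le> integral\<^sup>L M w"
    using True w le by (intro integral_mono) auto
  finally show ?thesis by simp
next
  case False
  have "0 \<le> integral\<^sup>L M w"
    using le by (intro Bochner_Integration.integral_nonneg) (meson abs_ge_zero order_trans)
  then show ?thesis using False by (simp add: not_integrable_integral_eq)
qed

lemma laplace_exp_bounded:
  assumes [measurable]: "f \<in> borel_measurable borel" and neg: "\<And>t. t < 0 \<Longrightarrow> f t = 0"
    and bd: "\<And>t. 0 \<le> t \<Longrightarrow> \<bar>f t\<bar> \<le> A * exp (\<beta> * t)" and z: "\<beta> < Re z"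
  shows "integrable lborel (\<lambda>t. exp (- z * of_real t) * complex_of_real (f t))"
    and "norm (laplace_real f z) \<le> A / (Re z - \<beta>)"
proof -
  \<comment> \<open>The majorant is written as the integrand of \<open>bilaplace_exp\<close> at the
    real point Re z, which yields both its integrability and its integral; \<open>?v\<close> is the
    same function with real values.\<close>
  let ?w = "\<lambda>t. A *\<^sub>R (exp (- of_real (Re z) * of_real t) * complex_of_real (indicator {0..} t * exp (\<beta> * t)))"
  let ?v = "\<lambda>t. A * (indicator {0..} t * exp ((\<beta> - Re z) * t))"
  have wv: "?w t = of_real (?v t)" for t
  proof -
    have e: "exp (- of_real (Re z) * of_real t) = complex_of_real (exp (- Re z * t))"
      by (simp flip: exp_of_real)
    show ?thesis
      unfolding e scaleR_conv_of_real of_real_mult[symmetric] of_real_eq_iff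
      by (simp add: algebra_simps flip: exp_add)
  qed
  have z': "\<beta> < Re (of_real (Re z))" using z by simp
  have I: "integrable lborel ?w" using bilaplace_exp(1)[OF z'] by (intro integrable_scaleR_right) auto
  have Iv: "integrable lborel ?v" using I unfolding wv by (simp only: complex_of_real_integrable_eq)
  have A: "0 \<le> A" using bd[of 0] by simp
  have le: "norm (exp (- z * of_real t) * complex_of_real (f t)) \<le> ?v t" for t
  proof (cases "t < 0")
    case False
    then have "norm (exp (- z * of_real t) * complex_of_real (f t)) \<le> exp (- Re z * t) * (A * exp (\<beta> * t))"
      using bd[of t] by (auto simp: norm_mult norm_exp_eq_Re)
    also have "\<dots> = ?v t" using False by (simp add: algebra_simps flip: exp_add)
    finally show ?thesis .
  qed (simp add: neg)
  show If: "integrable lborel (\<lambda>t. exp (- z * of_real t) * complex_of_real (f t))"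
    by (rule Bochner_Integration.integrable_bound[OF Iv])
      (use le A in \<open>auto intro!: AE_I2 simp del: mult_minus_left\<close>)
  have "norm (laplace_real f z) \<le> (LINT t|lborel. norm (exp (- z * of_real t) * complex_of_real (f t)))"
    unfolding bilaplace_def by simp
  also have "\<dots> \<le> integral\<^sup>L lborel ?v"
    using If Iv le by (intro integral_mono integrable_norm)
  also have "\<dots> = A / (Re z - \<beta>)"
  proof -
    have "complex_of_real (integral\<^sup>L lborel ?v) = integral\<^sup>L lborel ?w"
      by (simp only: wv integral_complex_of_real)
    also have "\<dots> = A *\<^sub>R bilaplace (\<lambda>t. of_real (indicator {0..} t * exp (\<beta> * t))) (of_real (Re z))"
      unfolding bilaplace_def by (rule integral_scaleR_right)
    also have "\<dots> = complex_of_real (A / (Re z - \<beta>))"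
      unfolding bilaplace_exp(2)[OF z'] by (simp add: scaleR_conv_of_real)
    finally show ?thesis by (simp only: of_real_eq_iff)
  qed
  finally show "norm (laplace_real f z) \<le> A / (Re z - \<beta>)" .
qed

text \<open>For \<beta> >= 0 every past value obeys the bound N exp (\<beta> t) of the present time,
  so convolution costs only the mass of |k|, at most \<rho>.\<close>

lemma (in volterra_kernel) convolution_exp_bound:
  assumes neg: "\<And>t. t < 0 \<Longrightarrow> m t = 0" and N: "\<And>s. s \<in> {0..T} \<Longrightarrow> \<bar>m s\<bar> \<le> N * exp (\<beta> * s)" "0 \<le> N" "0 \<le> \<beta>"
    and t: "t \<le> T"
  shows "\<bar>convolution k m t\<bar> \<le> \<rho> * (N * exp (\<beta> * t))"
proof -
  have "\<bar>convolution k m t\<bar> \<le> (LINT u|lborel. \<bar>k u\<bar> * (N * exp (\<beta> * t)))"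
    unfolding convolution_def
  proof (rule integral_abs_le)
    show "integrable lborel (\<lambda>u. \<bar>k u\<bar> * (N * exp (\<beta> * t)))" using k_abs(1) by simp
    fix u
    have "\<bar>m (t - u)\<bar> \<le> N * exp (\<beta> * t)" if "0 \<le> u"
    proof (cases "t - u < 0")
      case False
      then have "\<bar>m (t - u)\<bar> \<le> N * exp (\<beta> * (t - u))" using t that by (intro N) auto
      also have "\<dots> \<le> N * exp (\<beta> * t)" using N that by (intro mult_left_mono) (auto intro: mult_left_mono)
      finally show ?thesis .
    qed (use neg N in auto)
    then show "\<bar>k u * m (t - u)\<bar> \<le> \<bar>k u\<bar> * (N * exp (\<beta> * t))"
      using k_neg[of u] by (cases "u < 0") (auto simp: abs_mult intro: mult_left_mono)
  qed
  also have "\<dots> = (LINT u|lborel. \<bar>k u\<bar>) * (N * exp (\<beta> * t))" by simp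
  also have "\<dots> \<le> \<rho> * (N * exp (\<beta> * t))" using k_abs(2) N by (intro mult_right_mono) auto
  finally show ?thesis .
qed

text \<open>The forcing has a decay rate \<mu> unrelated to the rate \<nu> of the kernel: a constant
  derived in \<open>volterra_kernel\<close> alone then serves every \<mu> > - \<alpha>. The equation
  is kept in integrated form, in which the mean of the stochastic solution arises.\<close>

locale volterra_solution = volterra_kernel +
  fixes m g :: "real \<Rightarrow> real" and m0 D \<mu> :: real
  assumes m_meas[measurable]: "m \<in> borel_measurable borel" and m_neg: "\<And>t. t < 0 \<Longrightarrow> m t = 0"
    and m_bounded: "\<And>T. \<exists>B. \<forall>t\<in>{0..T}. \<bar>m t\<bar> \<le> B"
    and g_meas[measurable]: "g \<in> borel_measurable borel" and g_neg: "\<And>t. t < 0 \<Longrightarrow> g t = 0"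
    and g_bound: "\<And>t. 0 \<le> t \<Longrightarrow> \<bar>g t\<bar> \<le> D * exp (- \<mu> * t)" and \<mu>: "- \<mu> < \<alpha>"
    and m_eq: "\<And>t. 0 \<le> t \<Longrightarrow> m t = m0 + (LINT s:{0..t}|lborel. a * m s + b * convolution k m s + b * g s)"
begin

definition n where "n s = a * m s + b * convolution k m s + b * g s"

lemma n_meas[measurable]: "n \<in> borel_measurable borel"
  unfolding n_def by measurable

lemma D: "0 \<le> D" using g_bound[of 0] by simp

lemma n_neg: "t < 0 \<Longrightarrow> n t = 0"
proof -
  assume t: "t < 0"
  have "(\<lambda>u. k u * m (t - u)) = (\<lambda>u. 0)"
  proof
    fix u show "k u * m (t - u) = 0" using t k_neg[of u] m_neg[of "t - u"] by (cases "u < 0") auto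
  qed
  then have "convolution k m t = 0" unfolding convolution_def by (simp only: Bochner_Integration.integral_zero)
  then show "n t = 0" using t by (simp add: n_def m_neg g_neg)
qed

lemma n_exp_bound:
  assumes N: "\<And>s. s \<in> {0..T} \<Longrightarrow> \<bar>m s\<bar> \<le> N * exp (\<beta> * s)" "0 \<le> N" "\<bar>\<mu>\<bar> \<le> \<beta>" and t: "t \<in> {0..T}"
  shows "\<bar>n t\<bar> \<le> ((\<bar>a\<bar> + \<bar>b\<bar> * \<rho>) * N + \<bar>b\<bar> * D) * exp (\<beta> * t)"
proof -
  have "\<bar>n t\<bar> \<le> \<bar>a * m t\<bar> + \<bar>b * convolution k m t\<bar> + \<bar>b * g t\<bar>" unfolding n_def by linarith
  also have "\<dots> \<le> \<bar>a\<bar> * (N * exp (\<beta> * t)) + \<bar>b\<bar> * (\<rho> * (N * exp (\<beta> * t))) + \<bar>b\<bar> * (D * exp (\<beta> * t))"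
    unfolding abs_mult
  proof (intro add_mono mult_left_mono)
    show "\<bar>m t\<bar> \<le> N * exp (\<beta> * t)" using N t by auto
    show "\<bar>convolution k m t\<bar> \<le> \<rho> * (N * exp (\<beta> * t))"
      by (rule convolution_exp_bound[OF m_neg N(1,2)]) (use N t in auto)
    have "\<bar>g t\<bar> \<le> D * exp (- \<mu> * t)" using t by (intro g_bound) auto
    also have "\<dots> \<le> D * exp (\<beta> * t)"
    proof (intro mult_left_mono D)
      have "- \<mu> * t \<le> \<beta> * t" using N t by (intro mult_right_mono) auto
      then show "exp (- \<mu> * t) \<le> exp (\<beta> * t)" by simp
    qed
    finally show "\<bar>g t\<bar> \<le> D * exp (\<beta> * t)" .
  qed auto
  finally show ?thesis by (simp add: algebra_simps)
qed

text \<open>Makes the Gronwall step contract: (|a| + |b| \<rho>) / \<beta> is at most 1/2. The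
  summand |\<mu>| lets exp (\<beta> t) dominate the forcing, and 1 keeps the rate positive.\<close>

definition \<beta> where "\<beta> = 2 * (\<bar>a\<bar> + \<bar>b\<bar> * \<rho>) + 1 + \<bar>\<mu>\<bar>"

definition A where "A = 2 * (\<bar>m0\<bar> + \<bar>b\<bar> * D)"

lemma \<beta>: "\<beta> \<ge> 1" "\<bar>\<mu>\<bar> \<le> \<beta>" "2 * (\<bar>a\<bar> + \<bar>b\<bar> * \<rho>) \<le> \<beta>"
  using \<rho>_nonneg by (auto simp: \<beta>_def)

text \<open>A crude rate, whose purpose is a half plane in which the transform of \<open>m\<close>
  converges. Under the weight exp (- \<beta> t) the integral equation returns at most half of any
  bound, apart from a constant.\<close>

lemma m_growth:
  assumes "0 \<le> t"
  shows "\<bar>m t\<bar> \<le> A * exp (\<beta> * t)"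
proof -
  obtain B where B: "\<And>s. s \<in> {0..t} \<Longrightarrow> \<bar>m s\<bar> \<le> B" using m_bounded by blast
  have "\<bar>m t\<bar> * exp (- \<beta> * t) \<le> 2 * (\<bar>m0\<bar> + \<bar>b\<bar> * D)"
  proof (rule weighted_gronwall[where f="\<lambda>t. \<bar>m t\<bar> * exp (- \<beta> * t)" and T=t and B=B])
    show "\<bar>m s\<bar> * exp (- \<beta> * s) \<le> B" if "s \<in> {0..t}" for s
      using B[OF that] that \<beta> mult_left_le[of "exp (- \<beta> * s)" "\<bar>m s\<bar>"] by auto
    show "0 \<le> \<bar>m0\<bar> + \<bar>b\<bar> * D" using D by simp
    fix N r assume N: "0 \<le> N" "\<And>s. s \<in> {0..t} \<Longrightarrow> \<bar>m s\<bar> * exp (- \<beta> * s) \<le> N" and r: "r \<in> {0..t}"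
    have N': "\<bar>m s\<bar> \<le> N * exp (\<beta> * s)" if "s \<in> {0..t}" for s
      using N(2)[OF that] by (simp add: exp_minus field_simps)
    let ?E = "(\<bar>a\<bar> + \<bar>b\<bar> * \<rho>) * N + \<bar>b\<bar> * D"
    have E: "0 \<le> ?E" using N D \<rho>_nonneg by (intro add_nonneg_nonneg mult_nonneg_nonneg) auto
    have "m r = m0 + (LINT s:{0..r}|lborel. n s)" using m_eq[of r] r by (simp add: n_def)
    then have "\<bar>m r\<bar> \<le> \<bar>m0\<bar> + \<bar>LINT s:{0..r}|lborel. n s\<bar>" by linarith
    also have "\<bar>LINT s:{0..r}|lborel. n s\<bar> \<le> (LINT s:{0..r}|lborel. ?E * exp (\<beta> * s))"
      unfolding set_lebesgue_integral_def
    proof (rule integral_abs_le)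
      have "set_integrable lborel {0..r} (\<lambda>s. ?E * exp (\<beta> * s))"
        by (intro borel_integrable_atLeastAtMost' continuous_intros)
      then show "integrable lborel (\<lambda>s. indicator {0..r} s *\<^sub>R (?E * exp (\<beta> * s)))"
        by (simp add: set_integrable_def)
      show "\<bar>indicator {0..r} s *\<^sub>R n s\<bar> \<le> indicator {0..r} s *\<^sub>R (?E * exp (\<beta> * s))" for s
        using n_exp_bound[OF N' N(1) \<beta>(2), of s] r by (auto simp: indicator_def)
    qed
    also have "\<dots> = ?E * (LINT s:{0..r}|lborel. exp (\<beta> * s))" by simp
    also have "\<dots> \<le> ?E * (exp (\<beta> * r) / \<beta>)"
      using E \<beta> r by (intro mult_left_mono set_integral_exp_le) auto
    finally have "\<bar>m r\<bar> * exp (- \<beta> * r) \<le> (\<bar>m0\<bar> + ?E * (exp (\<beta> * r) / \<beta>)) * exp (- \<beta> * r)"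
      by (intro mult_right_mono) auto
    also have "\<dots> = \<bar>m0\<bar> * exp (- \<beta> * r) + ?E / \<beta>" by (simp add: exp_minus field_simps)
    also have "\<dots> \<le> \<bar>m0\<bar> + (\<bar>b\<bar> * D + N / 2)"
    proof (intro add_mono)
      show "\<bar>m0\<bar> * exp (- \<beta> * r) \<le> \<bar>m0\<bar>" using r \<beta> by (intro mult_left_le) auto
      have "?E \<le> \<beta> / 2 * N + \<beta> * (\<bar>b\<bar> * D)"
      proof (intro add_mono)
        show "(\<bar>a\<bar> + \<bar>b\<bar> * \<rho>) * N \<le> \<beta> / 2 * N" using \<beta> N by (intro mult_right_mono) auto
        show "\<bar>b\<bar> * D \<le> \<beta> * (\<bar>b\<bar> * D)" using \<beta> D mult_right_mono[of 1 \<beta> "\<bar>b\<bar> * D"] by auto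
      qed
      then show "?E / \<beta> \<le> \<bar>b\<bar> * D + N / 2" using \<beta> by (simp add: field_simps)
    qed
    finally show "\<bar>m r\<bar> * exp (- \<beta> * r) \<le> (\<bar>m0\<bar> + \<bar>b\<bar> * D) + N / 2" by simp
  qed (use assms in auto)
  then show ?thesis by (simp add: A_def exp_minus field_simps)
qed

lemma A: "0 \<le> A" using D by (simp add: A_def)

lemma n_growth: "0 \<le> t \<Longrightarrow> \<bar>n t\<bar> \<le> ((\<bar>a\<bar> + \<bar>b\<bar> * \<rho>) * A + \<bar>b\<bar> * D) * exp (\<beta> * t)"
  using m_growth A \<beta> by (intro n_exp_bound[where T=t]) auto

lemma m_continuous: "0 < t \<Longrightarrow> isCont m t"
proof -
  assume t: "0 < t"
  let ?E = "(\<bar>a\<bar> + \<bar>b\<bar> * \<rho>) * A + \<bar>b\<bar> * D"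
  have E: "0 \<le> ?E" using A D \<rho>_nonneg by (intro add_nonneg_nonneg mult_nonneg_nonneg) auto
  have "continuous_on {0..t + 1} (\<lambda>t. m0 + (LINT s:{0..t}|lborel. n s))"
  proof (intro continuous_intros set_integral_upper_limit(2) n_meas)
    fix s assume s: "s \<in> {0..t + 1}"
    then have "\<bar>n s\<bar> \<le> ?E * exp (\<beta> * s)" by (intro n_growth) auto
    also have "\<dots> \<le> ?E * exp (\<beta> * (t + 1))" using E s \<beta> by (intro mult_left_mono) auto
    finally show "\<bar>n s\<bar> \<le> ?E * exp (\<beta> * (t + 1))" .
  qed
  then have "continuous_on {0..t + 1} m"
    by (rule continuous_on_eq) (use m_eq in \<open>auto simp: n_def\<close>)
  then show "isCont m t" by (rule continuous_on_interior) (use t in auto)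
qed

text \<open>Integration from 0 is convolution with the unit step, whose transform is 1 / z. The
  integrated equation therefore transforms directly, with no derivative of \<open>m\<close>
  involved.\<close>

lemma laplace_identity:
  assumes z: "\<beta> < Re z"
  shows "(z - of_real a - of_real b * laplace_real k z) * laplace_real m z = of_real m0 + of_real b * laplace_real g z"
proof -
  \<comment> \<open>The factor exp (0 * t) is 1; it makes the unit step an instance of
    \<open>bilaplace_exp\<close>.\<close>
  let ?H = "\<lambda>t. indicator {0..} t * exp (0 * t) :: real"
  have z0: "0 < Re z" using z \<beta> by simp
  have zk: "- \<nu> \<le> Re z" using z0 \<nu> by simp
  have z\<mu>: "- \<mu> < Re z" using z \<beta> by simp
  note Im = laplace_exp_bounded(1)[OF m_meas m_neg m_growth z]
  note In = laplace_exp_bounded(1)[OF n_meas n_neg n_growth z]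
  note Ig = laplace_exp_bounded(1)[OF g_meas g_neg g_bound z\<mu>]
  note Ik = k_integrable[OF zk]
  note IH = bilaplace_exp(1)[OF z0] and H = bilaplace_exp(2)[OF z0]
  have Ic: "integrable lborel (\<lambda>t. exp (- z * of_real t) * complex_of_real (convolution k m t))"
    and lc: "laplace_real (convolution k m) z = laplace_real k z * laplace_real m z"
    using bilaplace_convolution[OF Ik Im] by (simp_all add: of_real_convolution)
  have IcH: "integrable lborel (\<lambda>t. exp (- z * of_real t) * complex_of_real (convolution n ?H t))"
    and lcH: "laplace_real (convolution n ?H) z = laplace_real n z * (1 / z)"
    using bilaplace_convolution[OF In IH] H by (simp_all add: of_real_convolution)
  have m_conv: "m t = m0 * ?H t + convolution n ?H t" for t
  proof (cases "t < 0")
    case True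
    then have "(\<lambda>s. n s * ?H (t - s)) = (\<lambda>s. 0)"
      by (intro ext) (use n_neg in \<open>auto simp: indicator_def\<close>)
    then have "convolution n ?H t = 0" unfolding convolution_def by (simp only: Bochner_Integration.integral_zero)
    then show ?thesis using True by (simp add: m_neg)
  next
    case False
    have "indicator {0..t} s * n s = n s * ?H (t - s)" for s
      using n_neg[of s] by (auto simp: indicator_def)
    then have "(LINT s:{0..t}|lborel. n s) = convolution n ?H t"
      unfolding convolution_def set_lebesgue_integral_def real_scaleR_def by (simp only:)
    then show ?thesis using m_eq[of t] False by (simp add: n_def)
  qed
  have "laplace_real m z = (LINT t|lborel. of_real m0 * (exp (- z * of_real t) * complex_of_real (?H t)) + exp (- z * of_real t) * complex_of_real (convolution n ?H t))"
    unfolding bilaplace_def by (subst m_conv) (simp add: algebra_simps)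
  also have "\<dots> = of_real m0 * laplace_real ?H z + laplace_real (convolution n ?H) z"
    unfolding bilaplace_def using IH IcH by (subst Bochner_Integration.integral_add) auto
  finally have 1: "laplace_real m z = (of_real m0 + laplace_real n z) / z"
    unfolding lcH H by (simp add: add_divide_distrib)
  have "laplace_real n z = (LINT t|lborel. of_real a * (exp (- z * of_real t) * complex_of_real (m t))
      + of_real b * (exp (- z * of_real t) * complex_of_real (convolution k m t))
      + of_real b * (exp (- z * of_real t) * complex_of_real (g t)))"
    unfolding bilaplace_def by (rule Bochner_Integration.integral_cong) (auto simp: n_def algebra_simps)
  also have "\<dots> = of_real a * laplace_real m z + of_real b * laplace_real (convolution k m) z + of_real b * laplace_real g z"
    unfolding bilaplace_def using Im Ic Ig by (simp add: Bochner_Integration.integral_add)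
  finally have 2: "laplace_real n z = of_real a * laplace_real m z + of_real b * (laplace_real k z * laplace_real m z) + of_real b * laplace_real g z"
    unfolding lc .
  have "z \<noteq> 0" using z0 by auto
  then have "z * laplace_real m z = of_real m0 + laplace_real n z" using 1 by (simp add: field_simps)
  then show ?thesis unfolding 2 by (simp add: algebra_simps)
qed

end

section \<open>Inversion of the transform and the bound at the rate \<alpha>\<close>

context volterra_solution
begin

text \<open>Bounds m0 + b (transform of \<open>g\<close>) on Re z >= \<alpha>, where the transform
  of \<open>g\<close> is at most D / (\<alpha> + \<mu>). Both parts of the solution inherit this
  factor.\<close>

definition E where "E = \<bar>m0\<bar> + \<bar>b\<bar> * (D / (\<alpha> + \<mu>))"

lemma E: "0 \<le> E" using D \<mu> by (auto simp: E_def)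

definition e\<^sub>c where "e\<^sub>c t = (indicator {0..} t * exp (c * t) :: real)"

lemma e\<^sub>c_meas[measurable]: "e\<^sub>c \<in> borel_measurable borel"
  unfolding e\<^sub>c_def by measurable

text \<open>In the time domain, division by z - c is convolution with
  \<open>e\<^sub>c\<close>.\<close>

definition p where "p t = m0 * e\<^sub>c t + b * convolution g e\<^sub>c t"

definition \<Phi> where "\<Phi> z = G z * (of_real m0 + of_real b * laplace_real g z)"

lemma p_meas[measurable]: "p \<in> borel_measurable borel"
  unfolding p_def by measurable

text \<open>With exp (c t) pulled out, \<open>t\<close> is left only in the upper limit of an
  integral, where continuity in \<open>t\<close> is visible.\<close>

lemma convolution_g: "0 \<le> t \<Longrightarrow> convolution g e\<^sub>c t = exp (c * t) * (LINT s:{0..t}|lborel. exp (- c * s) * g s)"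
proof -
  assume t: "0 \<le> t"
  have "g s * e\<^sub>c (t - s) = exp (c * t) * (indicator {0..t} s * (exp (- c * s) * g s))" for s
    using g_neg[of s] by (auto simp: e\<^sub>c_def indicator_def exp_diff exp_minus right_diff_distrib field_simps)
  then show ?thesis
    by (simp only: convolution_def set_lebesgue_integral_def real_scaleR_def integral_mult_right_zero)
qed

lemma p_neg: "t < 0 \<Longrightarrow> p t = 0"
proof -
  assume t: "t < 0"
  then have "(\<lambda>s. g s * e\<^sub>c (t - s)) = (\<lambda>s. 0)"
    by (intro ext) (use g_neg in \<open>auto simp: e\<^sub>c_def indicator_def\<close>)
  then have "convolution g e\<^sub>c t = 0" unfolding convolution_def by (simp only: Bochner_Integration.integral_zero)
  then show "p t = 0" using t by (simp add: p_def e\<^sub>c_def)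
qed

text \<open>The rate \<open>c\<close> is raised to \<alpha> before integrating over
  \<open>s\<close>, which leaves the integral of exp (- (\<alpha> + \<mu>) s). The sum c + \<mu>
  could not be used: it may be negative, as \<open>c\<close> is tied to \<nu> only.\<close>

lemma p_bound: "0 \<le> t \<Longrightarrow> \<bar>p t\<bar> \<le> E * exp (\<alpha> * t)"
proof -
  assume t: "0 \<le> t"
  have I: "integrable lborel (\<lambda>s. exp (\<alpha> * t) * D * (indicator {0..} s * exp (- (\<alpha> + \<mu>) * s)))"
    and V: "(LINT s|lborel. indicator {0..} s * exp (- (\<alpha> + \<mu>) * s)) = 1 / (\<alpha> + \<mu>)"
  proof -
    \<comment> \<open>At \<open>z = 0\<close> the transform is the plain integral; it converges
      because the rate - (\<alpha> + \<mu>) is negative.\<close>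
    have z: "- (\<alpha> + \<mu>) < Re 0" using \<mu> by simp
    have "integrable lborel (\<lambda>s. complex_of_real (indicator {0..} s * exp (- (\<alpha> + \<mu>) * s)))"
      using bilaplace_exp(1)[OF z] by simp
    then have I: "integrable lborel (\<lambda>s. indicator {0..} s * exp (- (\<alpha> + \<mu>) * s))" by (simp only: complex_of_real_integrable_eq)
    then show "integrable lborel (\<lambda>s. exp (\<alpha> * t) * D * (indicator {0..} s * exp (- (\<alpha> + \<mu>) * s)))" by simp
    have "complex_of_real (LINT s|lborel. indicator {0..} s * exp (- (\<alpha> + \<mu>) * s)) = bilaplace (\<lambda>s. complex_of_real (indicator {0..} s * exp (- (\<alpha> + \<mu>) * s))) 0"
      unfolding bilaplace_def by (simp flip: integral_complex_of_real)
    also have "\<dots> = complex_of_real (1 / (\<alpha> + \<mu>))" unfolding bilaplace_exp(2)[OF z] by simp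
    finally show "(LINT s|lborel. indicator {0..} s * exp (- (\<alpha> + \<mu>) * s)) = 1 / (\<alpha> + \<mu>)" by (simp only: of_real_eq_iff)
  qed
  have "\<bar>convolution g e\<^sub>c t\<bar> \<le> (LINT s|lborel. exp (\<alpha> * t) * D * (indicator {0..} s * exp (- (\<alpha> + \<mu>) * s)))"
    unfolding convolution_def
  proof (rule integral_abs_le[OF I])
    fix s :: real
    show "\<bar>g s * e\<^sub>c (t - s)\<bar> \<le> exp (\<alpha> * t) * D * (indicator {0..} s * exp (- (\<alpha> + \<mu>) * s))"
    proof (cases "0 \<le> s \<and> s \<le> t")
      case True
      then have "\<bar>g s * e\<^sub>c (t - s)\<bar> = \<bar>g s\<bar> * exp (c * (t - s))" by (simp add: e\<^sub>c_def abs_mult)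
      also have "\<dots> \<le> (D * exp (- \<mu> * s)) * exp (\<alpha> * (t - s))"
      proof (intro mult_mono g_bound)
        have "c * (t - s) \<le> \<alpha> * (t - s)" using c True by (intro mult_right_mono) auto
        then show "exp (c * (t - s)) \<le> exp (\<alpha> * (t - s))" by simp
      qed (use True D in auto)
      also have "\<dots> = exp (\<alpha> * t) * D * (indicator {0..} s * exp (- (\<alpha> + \<mu>) * s))"
        using True by (simp add: algebra_simps flip: exp_add)
      finally show ?thesis .
    next
      case False
      then have eq0: "g s * e\<^sub>c (t - s) = 0" using g_neg[of s] by (auto simp: e\<^sub>c_def)
      show ?thesis unfolding eq0 using D by simp
    qed
  qed
  also have "\<dots> = exp (\<alpha> * t) * D * (1 / (\<alpha> + \<mu>))" using V by simp
  finally have cg: "\<bar>convolution g e\<^sub>c t\<bar> \<le> D / (\<alpha> + \<mu>) * exp (\<alpha> * t)" by (simp add: field_simps)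
  have "\<bar>p t\<bar> \<le> \<bar>m0\<bar> * \<bar>e\<^sub>c t\<bar> + \<bar>b\<bar> * \<bar>convolution g e\<^sub>c t\<bar>" unfolding p_def by (metis abs_mult abs_triangle_ineq)
  also have "\<dots> \<le> \<bar>m0\<bar> * exp (\<alpha> * t) + \<bar>b\<bar> * (D / (\<alpha> + \<mu>) * exp (\<alpha> * t))"
    using t c cg by (intro add_mono mult_left_mono) (auto simp: e\<^sub>c_def intro: mult_right_mono)
  finally show ?thesis by (simp add: E_def algebra_simps)
qed

lemma p_continuous: "0 < t \<Longrightarrow> isCont p t"
proof -
  assume t: "0 < t"
  have "continuous_on {0..t + 1} (\<lambda>t. m0 * exp (c * t) + b * (exp (c * t) * (LINT s:{0..t}|lborel. exp (- c * s) * g s)))"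
  proof (intro continuous_intros set_integral_upper_limit(2))
    fix s assume s: "s \<in> {0..t + 1}"
    have e: "exp (- x * s) \<le> exp (\<bar>x\<bar> * (t + 1))" for x
    proof -
      have "- x * s \<le> \<bar>x\<bar> * s" using s by (intro mult_right_mono) auto
      also have "\<dots> \<le> \<bar>x\<bar> * (t + 1)" using s by (intro mult_left_mono) auto
      finally show ?thesis by simp
    qed
    have "\<bar>exp (- c * s) * g s\<bar> \<le> exp (- c * s) * (D * exp (- \<mu> * s))"
      using g_bound[of s] s by (auto simp: abs_mult)
    also have "\<dots> \<le> exp (\<bar>c\<bar> * (t + 1)) * (D * exp (\<bar>\<mu>\<bar> * (t + 1)))"
      using e[of c] e[of \<mu>] D by (intro mult_mono) auto
    finally show "\<bar>exp (- c * s) * g s\<bar> \<le> exp (\<bar>c\<bar> * (t + 1)) * (D * exp (\<bar>\<mu>\<bar> * (t + 1)))" .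
  qed measurable
  then have "continuous_on {0..t + 1} p"
    by (rule continuous_on_eq) (auto simp: p_def convolution_g e\<^sub>c_def)
  then show "isCont p t" by (rule continuous_on_interior) (use t in auto)
qed

lemma norm_laplace_g:
  assumes "\<alpha> \<le> Re z" shows "norm (of_real m0 + of_real b * laplace_real g z) \<le> E"
proof -
  have "norm (laplace_real g z) \<le> D / (Re z - - \<mu>)"
    by (rule laplace_exp_bounded(2)[OF g_meas g_neg g_bound]) (use assms \<mu> in auto)
  also have "\<dots> \<le> D / (\<alpha> + \<mu>)" using assms \<mu> D by (intro divide_left_mono) (auto intro!: mult_pos_pos)
  finally have "norm (of_real b * laplace_real g z) \<le> \<bar>b\<bar> * (D / (\<alpha> + \<mu>))"
    unfolding norm_mult norm_of_real by (rule mult_left_mono) simp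
  then show ?thesis unfolding E_def by (intro norm_triangle_le) simp
qed

text \<open>Right of max \<beta> \<alpha> the transforms of \<open>m\<close> and \<open>p\<close>
  both converge, and division by \<open>h\<close> is allowed since \<open>h\<close> has no zero
  right of \<open>c\<close>.\<close>

lemma laplace_difference:
  assumes z: "max \<beta> \<alpha> < Re z"
  shows "integrable lborel (\<lambda>t. exp (- z * of_real t) * complex_of_real (m t - p t))"
    and "laplace_real (\<lambda>t. m t - p t) z = \<Phi> z"
proof -
  have z1: "\<beta> < Re z" "\<alpha> < Re z" "c < Re z" "- \<mu> < Re z" using z c \<mu> by auto
  note Im = laplace_exp_bounded(1)[OF m_meas m_neg m_growth z1(1)]
  note Ip = laplace_exp_bounded(1)[OF p_meas p_neg p_bound z1(2)]
  note Ig = laplace_exp_bounded(1)[OF g_meas g_neg g_bound z1(4)]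
  show "integrable lborel (\<lambda>t. exp (- z * of_real t) * complex_of_real (m t - p t))"
    using Bochner_Integration.integrable_diff[OF Im Ip] by (simp add: algebra_simps)
  have Ie: "integrable lborel (\<lambda>t. exp (- z * of_real t) * complex_of_real (e\<^sub>c t))" and le: "laplace_real e\<^sub>c z = 1 / (z - of_real c)"
    using bilaplace_exp[OF z1(3)] by (simp_all add: e\<^sub>c_def[abs_def])
  have Ic: "integrable lborel (\<lambda>t. exp (- z * of_real t) * complex_of_real (convolution g e\<^sub>c t))"
    and lc: "laplace_real (convolution g e\<^sub>c) z = laplace_real g z * (1 / (z - of_real c))"
    using bilaplace_convolution[OF Ig Ie] le by (simp_all add: of_real_convolution)
  have "laplace_real p z = (LINT t|lborel. of_real m0 * (exp (- z * of_real t) * complex_of_real (e\<^sub>c t))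
     + of_real b * (exp (- z * of_real t) * complex_of_real (convolution g e\<^sub>c t)))"
    unfolding bilaplace_def by (rule Bochner_Integration.integral_cong) (auto simp: p_def algebra_simps)
  also have "\<dots> = of_real m0 * laplace_real e\<^sub>c z + of_real b * laplace_real (convolution g e\<^sub>c) z"
    unfolding bilaplace_def using Ie Ic by (simp add: Bochner_Integration.integral_add)
  also have "\<dots> = (of_real m0 + of_real b * laplace_real g z) * (1 / (z - of_real c))"
    unfolding lc le by (simp add: algebra_simps)
  finally have lp: "laplace_real p z = (of_real m0 + of_real b * laplace_real g z) * (1 / (z - of_real c))" .
  have lm: "laplace_real m z = (of_real m0 + of_real b * laplace_real g z) * (1 / h z)"
    using laplace_identity[OF z1(1)] h_nonzero[of z] z1 by (simp add: h_def field_simps)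
  have "laplace_real (\<lambda>t. m t - p t) z = (LINT t|lborel. exp (- z * of_real t) * complex_of_real (m t) - exp (- z * of_real t) * complex_of_real (p t))"
    unfolding bilaplace_def by (rule Bochner_Integration.integral_cong) (auto simp: algebra_simps)
  also have "\<dots> = laplace_real m z - laplace_real p z"
    unfolding bilaplace_def by (rule Bochner_Integration.integral_diff[OF Im Ip])
  finally show "laplace_real (\<lambda>t. m t - p t) z = \<Phi> z"
    unfolding lm lp \<Phi>_def G_def by (simp add: algebra_simps)
qed

lemma bound:
  assumes C: "\<And>w. norm (G (Complex \<alpha> w)) \<le> C * inverse (1 + w\<^sup>2)" and t: "0 < t"
  shows "\<bar>m t\<bar> \<le> (1 + C * (LINT w|lborel. inverse (1 + w\<^sup>2)) / (2 * pi)) * exp (\<alpha> * t) * E"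
proof -
  \<comment> \<open>On the line Re z = B the transform of m - p converges absolutely, so the
    inversion takes place there; only afterwards is the line moved to \<alpha>.\<close>
  define B where "B = max \<beta> \<alpha> + 1"
  have B: "max \<beta> \<alpha> < B" "\<alpha> \<le> B" "0 < B" "\<beta> < B" using \<beta> by (auto simp: B_def)
  \<comment> \<open>At least \<open>c\<close>, for \<open>G\<close>, and at least the midpoint of -
    \<mu> and \<alpha>, for the transform of \<open>g\<close>; still below \<alpha>, so that the
    target line lies inside the half plane.\<close>
  define c' where "c' = max c ((\<alpha> - \<mu>) / 2)"
  have c': "c \<le> c'" "- \<mu> < c'" "c' < \<alpha>" using c \<mu> by (auto simp: c'_def less_max_iff_disj field_simps)
  have hol: "\<Phi> holomorphic_on {z. c' < Re z}"
  proof -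
    have "laplace_real g holomorphic_on {z. c' < Re z}"
    proof (rule bilaplace_holomorphic)
      show "integrable lborel (\<lambda>t. exp (- c' * t) *\<^sub>R complex_of_real (g t))"
        using laplace_exp_bounded(1)[OF g_meas g_neg g_bound, of "of_real c'"] c'
        by (simp add: scaleR_conv_of_real flip: exp_of_real)
    qed (simp add: g_neg)
    moreover have "G holomorphic_on {z. c' < Re z}"
      by (rule holomorphic_on_subset[OF hol_G]) (use c' in auto)
    ultimately show ?thesis unfolding \<Phi>_def by (intro holomorphic_intros)
  qed
  have meas: "(\<lambda>w. \<Phi> (Complex x w)) \<in> borel_measurable borel" if "\<alpha> \<le> x" for x
    by (intro borel_measurable_continuous_onI continuous_on_compose2[OF holomorphic_on_imp_continuous_on[OF hol]])
      (use that c' in \<open>auto simp: Complex_eq intro!: continuous_intros\<close>)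
  have norm_\<Phi>: "norm (\<Phi> z) \<le> norm (G z) * E" if "\<alpha> \<le> Re z" for z
    unfolding \<Phi>_def norm_mult using norm_laplace_g[OF that] by (intro mult_left_mono) auto
  have int: "integrable lborel (\<lambda>w. \<Phi> (Complex x w))" if x: "\<alpha> \<le> x" for x
  proof -
    obtain Cx where Cx: "\<And>w. norm (G (Complex x w)) \<le> Cx * inverse (1 + w\<^sup>2)" using G_line_bound[of x] c x by auto
    have I: "integrable lborel (\<lambda>w. Cx * inverse (1 + w\<^sup>2) * E)"
      using integrable_inverse_1_plus_square_real by simp
    show ?thesis
    proof (rule Bochner_Integration.integrable_bound[OF I])
      show "AE w in lborel. norm (\<Phi> (Complex x w)) \<le> norm (Cx * inverse (1 + w\<^sup>2) * E)"
      proof (rule AE_I2)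
        fix w
        have "norm (\<Phi> (Complex x w)) \<le> norm (G (Complex x w)) * E" using norm_\<Phi> x by simp
        also have "\<dots> \<le> Cx * inverse (1 + w\<^sup>2) * E" using Cx E by (intro mult_right_mono) auto
        also have "\<dots> \<le> norm (Cx * inverse (1 + w\<^sup>2) * E)" by simp
        finally show "norm (\<Phi> (Complex x w)) \<le> norm (Cx * inverse (1 + w\<^sup>2) * E)" .
      qed
    qed (use meas[OF x] in simp)
  qed
  define \<Psi> where "\<Psi> z = exp (z * of_real t) * \<Phi> z" for z
  have \<Psi>_line: "\<Psi> (Complex x w) = of_real (exp (x * t)) * (iexp (w * t) * \<Phi> (Complex x w))" for x w
    by (simp add: \<Psi>_def Complex_eq algebra_simps exp_add flip: exp_of_real)
  have int\<Psi>: "integrable lborel (\<lambda>w. \<Psi> (Complex x w))" if x: "\<alpha> \<le> x" for x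
    unfolding \<Psi>_line
    by (rule Bochner_Integration.integrable_bound[OF integrable_mult_right[OF int[OF x], of "of_real (exp (x * t))"]])
      (use meas[OF x] in \<open>auto simp: norm_mult\<close>)
  have shift: "(LINT w|lborel. \<Psi> (Complex \<alpha> w)) = (LINT w|lborel. \<Psi> (Complex B w))"
  proof (rule vertical_line_integral_shift[of _ c' _ _ R0 "exp (B * t) * (2 * R0 * E)"])
    show "\<Psi> holomorphic_on {z. c' < Re z}" unfolding \<Psi>_def by (intro holomorphic_intros hol)
    fix z assume z: "\<alpha> \<le> Re z" "Re z \<le> B" "R0 \<le> \<bar>Im z\<bar>"
    have R0: "1 \<le> R0" using \<rho>_nonneg by (simp add: R0_def)
    have Im: "\<bar>Im z\<bar> \<le> norm z" by (rule abs_Im_le_cmod)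
    have "norm (\<Psi> z) = exp (Re z * t) * norm (\<Phi> z)" by (simp add: \<Psi>_def norm_mult norm_exp_eq_Re)
    also have "\<dots> \<le> exp (B * t) * (2 * R0 / \<bar>Im z\<bar> * E)"
    proof (intro mult_mono)
      show "exp (Re z * t) \<le> exp (B * t)" using z t by auto
      have "norm (G z) \<le> 2 * R0 / (norm z)\<^sup>2" using z Im c by (intro G_decay) auto
      \<comment> \<open>Here |z| >= R0 >= 1, hence |z|^2 >= |Im z|. The shift asks for no faster
        decay than this.\<close>
      also have "\<dots> \<le> 2 * R0 / \<bar>Im z\<bar>"
      proof (intro divide_left_mono)
        have "1 * \<bar>Im z\<bar> \<le> norm z * norm z" using R0 z Im by (intro mult_mono) auto
        then show "\<bar>Im z\<bar> \<le> (norm z)\<^sup>2" by (simp add: power2_eq_square)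
      qed (use R0 z Im in \<open>auto intro!: mult_pos_pos\<close>)
      finally have "norm (G z) * E \<le> 2 * R0 / \<bar>Im z\<bar> * E" using E by (rule mult_right_mono)
      then show "norm (\<Phi> z) \<le> 2 * R0 / \<bar>Im z\<bar> * E" using norm_\<Phi>[OF z(1)] by linarith
    qed auto
    finally show "norm (\<Psi> z) \<le> exp (B * t) * (2 * R0 * E) / \<bar>Im z\<bar>" by simp
  qed (use c' B int\<Psi> in auto)
  \<comment> \<open>The factor exp (- B s) makes m - p integrable and bounded, and turns its Fourier
    transform at \<open>w\<close> into the value of \<Phi> at B + i w.\<close>
  define f where "f s = exp (- of_real B * of_real s) * complex_of_real (m s - p s)" for s
  have ft: "iexp (- (w * s)) * f s = exp (- Complex B w * of_real s) * complex_of_real (m s - p s)" for w s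
    by (simp add: f_def Complex_eq algebra_simps exp_diff exp_minus field_simps)
  have lt_f: "(LINT s|lborel. iexp (- (w * s)) * f s) = \<Phi> (Complex B w)" for w
    unfolding ft using laplace_difference(2)[of "Complex B w"] B by (simp add: bilaplace_def)
  have "f t = (LINT w|lborel. iexp (w * t) * (LINT s|lborel. iexp (- (w * s)) * f s)) / (2 * pi)"
  proof (rule fourier_inversion)
    show "integrable lborel f"
      using laplace_difference(1)[of "of_real B"] B by (simp add: f_def[abs_def])
    show "integrable lborel (\<lambda>w. LINT s|lborel. iexp (- (w * s)) * f s)"
      unfolding lt_f by (rule int) (use B in auto)
    show "isCont f t" unfolding f_def
      by (intro continuous_intros m_continuous p_continuous t)
    show "norm (f s) \<le> A + E" for s
    proof (cases "s < 0")
      case True then show ?thesis using A E by (simp add: f_def m_neg p_neg)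
    next
      case False
      have "norm (f s) = exp (- B * s) * \<bar>m s - p s\<bar>"
        unfolding f_def norm_mult by (simp add: norm_exp_eq_Re flip: of_real_diff)
      also have "\<dots> \<le> exp (- B * s) * (A * exp (\<beta> * s) + E * exp (\<alpha> * s))"
        using m_growth[of s] p_bound[of s] False by (intro mult_left_mono) auto
      also have "\<dots> \<le> exp (- B * s) * (A * exp (B * s) + E * exp (B * s))"
        using A E B False by (intro mult_left_mono add_mono) (auto intro!: mult_right_mono)
      also have "\<dots> = A + E" by (simp add: exp_minus field_simps)
      finally show ?thesis .
    qed
  qed
  then have "of_real (exp (B * t)) * f t = (LINT w|lborel. \<Psi> (Complex B w)) / (2 * pi)"
    unfolding lt_f \<Psi>_line by simp
  moreover have "of_real (exp (B * t)) * f t = complex_of_real (m t - p t)"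
    by (simp add: f_def exp_minus flip: exp_of_real)
  ultimately have "complex_of_real (m t - p t) = (LINT w|lborel. \<Psi> (Complex \<alpha> w)) / (2 * pi)"
    using shift by simp
  then have "norm (complex_of_real (m t - p t)) = norm ((LINT w|lborel. \<Psi> (Complex \<alpha> w)) / (2 * pi))"
    by (rule arg_cong)
  then have "\<bar>m t - p t\<bar> = norm (LINT w|lborel. \<Psi> (Complex \<alpha> w)) / (2 * pi)"
    by (simp add: norm_divide norm_mult del: of_real_diff)
  also have "norm (LINT w|lborel. \<Psi> (Complex \<alpha> w)) \<le> (LINT w|lborel. norm (\<Psi> (Complex \<alpha> w)))" by simp
  also have "\<dots> \<le> (LINT w|lborel. exp (\<alpha> * t) * E * C * inverse (1 + w\<^sup>2))"
  proof (rule integral_mono)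
    show "integrable lborel (\<lambda>w. norm (\<Psi> (Complex \<alpha> w)))" using int\<Psi> by simp
    show "integrable lborel (\<lambda>w. exp (\<alpha> * t) * E * C * inverse (1 + w\<^sup>2))"
      using integrable_inverse_1_plus_square_real by simp
    fix w :: real
    have "norm (\<Psi> (Complex \<alpha> w)) = exp (\<alpha> * t) * norm (\<Phi> (Complex \<alpha> w))"
      unfolding \<Psi>_line by (simp add: norm_mult)
    also have "\<dots> \<le> exp (\<alpha> * t) * ((C * inverse (1 + w\<^sup>2)) * E)"
      using norm_\<Phi>[of "Complex \<alpha> w"] mult_right_mono[OF C[of w] E] by (intro mult_left_mono) auto
    finally show "norm (\<Psi> (Complex \<alpha> w)) \<le> exp (\<alpha> * t) * E * C * inverse (1 + w\<^sup>2)" by (simp add: mult_ac)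
  qed
  also have "\<dots> = exp (\<alpha> * t) * E * C * (LINT w|lborel. inverse (1 + w\<^sup>2))" by simp
  finally have "\<bar>m t - p t\<bar> \<le> exp (\<alpha> * t) * E * C * (LINT w|lborel. inverse (1 + w\<^sup>2)) / (2 * pi)"
    by (simp add: divide_right_mono)
  moreover have "\<bar>p t\<bar> \<le> E * exp (\<alpha> * t)" using p_bound t by simp
  ultimately have "\<bar>m t\<bar> \<le> E * exp (\<alpha> * t) + exp (\<alpha> * t) * E * C * (LINT w|lborel. inverse (1 + w\<^sup>2)) / (2 * pi)" by linarith
  then show ?thesis by (simp add: algebra_simps)
qed

end

text \<open>The constant comes from \<open>G\<close> on the line Re z = \<alpha>, hence from the
  kernel, \<open>a\<close>, \<open>b\<close>, \<open>c\<close> and \<alpha> only. It therefore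
  precedes the quantifiers over the solution, its forcing and \<mu>.\<close>

theorem (in volterra_kernel) volterra_bound:
  obtains C where "C > 0"
    "\<And>m g m0 D \<mu> t. volterra_solution k a b \<nu> c \<alpha> m g m0 D \<mu> \<Longrightarrow> 0 \<le> t \<Longrightarrow>
        \<bar>m t\<bar> \<le> C * exp (\<alpha> * t) * (\<bar>m0\<bar> + \<bar>b\<bar> * (D / (\<alpha> + \<mu>)))"
proof -
  obtain C where C: "C \<ge> 0" "\<And>w. norm (G (Complex \<alpha> w)) \<le> C * inverse (1 + w\<^sup>2)"
    using G_line_bound[OF c] by blast
  \<comment> \<open>The summand 1 is the share of the explicit part \<open>p\<close>; the other is
    the absolute Fourier integral of the remainder.\<close>
  define C' where "C' = 1 + C * (LINT w|lborel. inverse (1 + w\<^sup>2)) / (2 * pi)"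
  have C': "C' \<ge> 1"
    unfolding C'_def using C(1) by (simp add: add_nonneg_nonneg)
  show thesis
  proof
    show "C' > 0" using C' by simp
    fix m g m0 D \<mu> and t :: real
    assume "volterra_solution k a b \<nu> c \<alpha> m g m0 D \<mu>" and t: "0 \<le> t"
    then interpret volterra_solution k a b \<nu> c \<alpha> m g m0 D \<mu> by simp
    show "\<bar>m t\<bar> \<le> C' * exp (\<alpha> * t) * (\<bar>m0\<bar> + \<bar>b\<bar> * (D / (\<alpha> + \<mu>)))"
    proof (cases "t = 0")
      \<comment> \<open>Inversion is available for t > 0 only; at 0 the equation itself gives the
        initial value.\<close>
      case True
      have "(LINT s:{0..0}|lborel. a * m s + b * convolution k m s + b * g s) = 0"
        unfolding set_lebesgue_integral_def
        by (rule integral_eq_zero_AE) (use AE_lborel_singleton[of 0] in eventually_elim, auto simp: indicator_def)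
      then have "m t = m0" using m_eq[of 0] True by simp
      moreover have "\<bar>m0\<bar> \<le> E" using D \<mu> by (simp add: E_def)
      then have "\<bar>m0\<bar> \<le> C' * E" using C' E mult_right_mono[of 1 C' E] by simp
      ultimately show ?thesis using True by (simp add: E_def)
    next
      case False
      then show ?thesis using bound[OF C(2)] t by (simp add: E_def C'_def)
    qed
  qed
qed

section \<open>Sums of Wiener increments\<close>

locale wiener =
  fixes M :: "'w measure" and F :: "real \<Rightarrow> 'w measure" and W :: "real \<Rightarrow> 'w \<Rightarrow> real"
  assumes wiener: "wiener_process M F W"

sublocale wiener \<subseteq> prob_space M
  using wiener by (simp add: wiener_process_def)

context wiener
begin

lemma space_F: "space (F t) = space M"
  using wiener by (simp add: wiener_process_def subalgebra_def)

lemma sets_F_mono: "s \<le> t \<Longrightarrow> sets (F s) \<subseteq> sets (F t)"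
  using wiener by (simp add: wiener_process_def filtration_def)

lemma sets_F: "sets (F t) \<subseteq> sets M"
  using wiener by (simp add: wiener_process_def subalgebra_def)

lemma measurable_F_mono: "f \<in> measurable (F s) N \<Longrightarrow> s \<le> t \<Longrightarrow> f \<in> measurable (F t) N"
  using sets_F_mono[of s t] by (auto simp: measurable_def space_F)

lemma measurable_F: "f \<in> measurable (F s) N \<Longrightarrow> f \<in> measurable M N"
  using sets_F[of s] by (auto simp: measurable_def space_F)

lemma W_measurable: "0 \<le> t \<Longrightarrow> W t \<in> borel_measurable (F t)"
  using wiener by (simp add: wiener_process_def)

lemma increment_moments:
  assumes "0 \<le> s" "s < t"
  shows "integrable M (\<lambda>\<omega>. W t \<omega> - W s \<omega>)" "expectation (\<lambda>\<omega>. W t \<omega> - W s \<omega>) = 0"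
    "integrable M (\<lambda>\<omega>. (W t \<omega> - W s \<omega>)\<^sup>2)" "expectation (\<lambda>\<omega>. (W t \<omega> - W s \<omega>)\<^sup>2) = t - s"
proof -
  have s: "0 < sqrt (t - s)" using assms by simp
  have D: "distributed M lborel (\<lambda>\<omega>. W t \<omega> - W s \<omega>) (normal_density 0 (sqrt (t - s)))"
    using wiener assms by (simp add: wiener_process_def)
  have "integrable M (\<lambda>\<omega>. (\<lambda>x. x^1) (W t \<omega> - W s \<omega>))" "integrable M (\<lambda>\<omega>. (\<lambda>x. x\<^sup>2) (W t \<omega> - W s \<omega>))"
    using integrable_normal_moment[OF s, of 0 1] integrable_normal_moment[OF s, of 0 2]
    by (subst distributed_integrable[OF D, symmetric]; simp)+
  then show "integrable M (\<lambda>\<omega>. W t \<omega> - W s \<omega>)" "integrable M (\<lambda>\<omega>. (W t \<omega> - W s \<omega>)\<^sup>2)" by simp_all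
  show "expectation (\<lambda>\<omega>. W t \<omega> - W s \<omega>) = 0"
    by (rule normal_distributed_expectation[OF s D])
  then show "expectation (\<lambda>\<omega>. (W t \<omega> - W s \<omega>)\<^sup>2) = t - s"
    using normal_distributed_variance[OF s D] assms by simp
qed

text \<open>The Wiener process provides independence of families of events. It passes to random
  variables because the sigma algebra of \<open>Y\<close> lies in \<open>F s\<close> and the
  preimages under the increment already form a sigma algebra.\<close>

lemma indep_increment:
  assumes st: "0 \<le> s" "s < t" and Y: "Y \<in> borel_measurable (F s)"
  shows "indep_var borel Y borel (\<lambda>\<omega>. W t \<omega> - W s \<omega>)"
proof -
  let ?D = "\<lambda>\<omega>. W t \<omega> - W s \<omega>"
  let ?P = "{?D -` B \<inter> space M |B. B \<in> sets borel}"
  have [measurable]: "W t \<in> borel_measurable M" "W s \<in> borel_measurable M"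
    using st by (auto intro!: measurable_F[OF W_measurable])
  have ind: "indep_set (sets (F s)) ?P"
    using wiener st by (simp add: wiener_process_def)
  have eq: "sigma_sets (space M) ?P = ?P"
    using sets_vimage_algebra[of "space M" ?D borel] sets_vimage_algebra2[of ?D "space M" borel] by simp
  have sub: "sigma_sets (space M) {Y -` A \<inter> space M |A. A \<in> sets borel} \<subseteq> sets (F s)"
    using sets.sigma_sets_subset[of "{Y -` A \<inter> space M |A. A \<in> sets borel}" "F s"] measurable_sets[OF Y]
    by (auto simp: space_F)
  show ?thesis
    unfolding indep_var_eq
  proof (intro conjI indep_setI)
    show "random_variable borel Y" by (rule measurable_F[OF Y])
    show "sigma_sets (space M) {Y -` A \<inter> space M |A. A \<in> sets borel} \<subseteq> events" using sub sets_F by blast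
    show "sigma_sets (space M) ?P \<subseteq> events" unfolding eq by auto
    show "prob (x \<inter> y) = prob x * prob y"
      if "x \<in> sigma_sets (space M) {Y -` A \<inter> space M |A. A \<in> sets borel}" "y \<in> sigma_sets (space M) ?P" for x y
      using indep_setD[OF ind, of x y] that sub unfolding eq by blast
  qed measurable
qed

lemma indep_increment_product:
  fixes Y :: "'w \<Rightarrow> real" and g :: "real \<Rightarrow> real"
  assumes st: "0 \<le> s" "s < t" and Y: "Y \<in> borel_measurable (F s)" "integrable M Y"
    and g[measurable]: "g \<in> borel_measurable borel" and I: "integrable M (\<lambda>\<omega>. g (W t \<omega> - W s \<omega>))"
  shows "integrable M (\<lambda>\<omega>. Y \<omega> * g (W t \<omega> - W s \<omega>))"
    "expectation (\<lambda>\<omega>. Y \<omega> * g (W t \<omega> - W s \<omega>)) = expectation Y * expectation (\<lambda>\<omega>. g (W t \<omega> - W s \<omega>))"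
proof -
  have "indep_var borel (id \<circ> Y) borel (g \<circ> (\<lambda>\<omega>. W t \<omega> - W s \<omega>))"
    by (rule indep_var_compose[OF indep_increment[OF st Y(1)]]) auto
  then have ind: "indep_var borel Y borel (\<lambda>\<omega>. g (W t \<omega> - W s \<omega>))" by (simp add: o_def)
  show "integrable M (\<lambda>\<omega>. Y \<omega> * g (W t \<omega> - W s \<omega>))" by (rule indep_var_integrable[OF ind Y(2) I])
  show "expectation (\<lambda>\<omega>. Y \<omega> * g (W t \<omega> - W s \<omega>)) = expectation Y * expectation (\<lambda>\<omega>. g (W t \<omega> - W s \<omega>))"
    by (rule indep_var_lebesgue_integral[OF ind Y(2) I])
qed

end

section \<open>Isometry and tail estimate for adapted step sums\<close>

definition increment_sum :: "(real \<Rightarrow> 'w \<Rightarrow> real) \<Rightarrow> (nat \<Rightarrow> real) \<Rightarrow> (nat \<Rightarrow> 'w \<Rightarrow> real) \<Rightarrow> nat \<Rightarrow> 'w \<Rightarrow> real" where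
  "increment_sum W q d n \<omega> = (\<Sum>j<n. d j \<omega> * (W (q (Suc j)) \<omega> - W (q j) \<omega>))"

text \<open>The times increase strictly, because the law of an increment is available only over
  intervals of positive length; the times of an elementary integrand may coincide.\<close>

definition adapted_step :: "'w measure \<Rightarrow> (real \<Rightarrow> 'w measure) \<Rightarrow> nat \<Rightarrow> (nat \<Rightarrow> real) \<Rightarrow> (nat \<Rightarrow> 'w \<Rightarrow> real) \<Rightarrow> bool" where
  "adapted_step M F n q d \<longleftrightarrow> 0 \<le> q 0 \<and> (\<forall>j<n. q j < q (Suc j)) \<and>
     (\<forall>j<n. d j \<in> borel_measurable (F (q j)) \<and> (\<exists>B. \<forall>\<omega>\<in>space M. \<bar>d j \<omega>\<bar> \<le> B))"

lemma adapted_step_Suc: "adapted_step M F (Suc n) q d \<Longrightarrow> adapted_step M F n q d"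
  by (simp add: adapted_step_def)

lemma adapted_step_mono: "adapted_step M F n q d \<Longrightarrow> i \<le> j \<Longrightarrow> j \<le> n \<Longrightarrow> q i \<le> q j"
proof (induction j)
  case (Suc j)
  have "q j < q (Suc j)" using Suc.prems by (simp add: adapted_step_def)
  then show ?case using Suc by (cases "i = Suc j") auto
qed simp

context wiener
begin

text \<open>Induction on the number of steps. The cross term of the square has mean zero, since the
  old sum times the new coefficient is known at the left endpoint and the increment is independent
  of it. Boundedness of the coefficients makes all products integrable.\<close>

lemma increment_sum_isometry:
  assumes "adapted_step M F n q d"
  shows "increment_sum W q d n \<in> borel_measurable (F (q n))"
    and "integrable M (\<lambda>\<omega>. (increment_sum W q d n \<omega>)\<^sup>2)"
    and "expectation (increment_sum W q d n) = 0"
    and "expectation (\<lambda>\<omega>. (increment_sum W q d n \<omega>)\<^sup>2) = (\<Sum>j<n. expectation (\<lambda>\<omega>. (d j \<omega>)\<^sup>2) * (q (Suc j) - q j))"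
proof -
  let ?Y = "increment_sum W q d"
  have "?Y n \<in> borel_measurable (F (q n)) \<and> integrable M (\<lambda>\<omega>. (?Y n \<omega>)\<^sup>2) \<and> expectation (?Y n) = 0 \<and>
    expectation (\<lambda>\<omega>. (?Y n \<omega>)\<^sup>2) = (\<Sum>j<n. expectation (\<lambda>\<omega>. (d j \<omega>)\<^sup>2) * (q (Suc j) - q j))"
    using assms
  proof (induction n)
    case 0
    then show ?case by (simp add: increment_sum_def[abs_def])
  next
    case (Suc n)
    note step = Suc.prems
    from Suc.IH[OF adapted_step_Suc[OF step]]
    have IH: "?Y n \<in> borel_measurable (F (q n))" "integrable M (\<lambda>\<omega>. (?Y n \<omega>)\<^sup>2)" "expectation (?Y n) = 0"
      "expectation (\<lambda>\<omega>. (?Y n \<omega>)\<^sup>2) = (\<Sum>j<n. expectation (\<lambda>\<omega>. (d j \<omega>)\<^sup>2) * (q (Suc j) - q j))" by auto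
    have q: "0 \<le> q n" "q n < q (Suc n)"
      using adapted_step_mono[OF step, of 0 n] step by (auto simp: adapted_step_def)
    obtain B where dF: "d n \<in> borel_measurable (F (q n))" and B: "\<And>\<omega>. \<omega> \<in> space M \<Longrightarrow> \<bar>d n \<omega>\<bar> \<le> B"
    proof -
      have "d n \<in> borel_measurable (F (q n))" "\<exists>B. \<forall>\<omega>\<in>space M. \<bar>d n \<omega>\<bar> \<le> B" using step by (simp_all add: adapted_step_def)
      then show thesis using that by blast
    qed
    define \<Delta> where "\<Delta> = (\<lambda>\<omega>. W (q (Suc n)) \<omega> - W (q n) \<omega>)"
    note \<Delta> = increment_moments[OF q, folded \<Delta>_def]
    have YS: "?Y (Suc n) = (\<lambda>\<omega>. ?Y n \<omega> + d n \<omega> * \<Delta> \<omega>)" by (simp add: increment_sum_def[abs_def] \<Delta>_def)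
    have [measurable]: "?Y n \<in> borel_measurable M" "d n \<in> borel_measurable M" "\<Delta> \<in> borel_measurable M"
      using IH(1) dF \<Delta>(1) measurable_F by auto
    have intY: "integrable M (?Y n)" by (rule square_integrable_imp_integrable[OF _ IH(2)]) simp
    have intd: "integrable M (d n)" by (rule integrable_const_bound[where B=B]) (use B in auto)
    have intd2: "integrable M (\<lambda>\<omega>. (d n \<omega>)\<^sup>2)"
    proof (rule integrable_const_bound[where B="B\<^sup>2"])
      have "\<bar>d n \<omega>\<bar>\<^sup>2 \<le> B\<^sup>2" if "\<omega> \<in> space M" for \<omega> using B[OF that] by (intro power_mono) auto
      then show "AE \<omega> in M. norm ((d n \<omega>)\<^sup>2) \<le> B\<^sup>2" by auto
    qed measurable
    have intYd: "integrable M (\<lambda>\<omega>. ?Y n \<omega> * d n \<omega>)"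
    proof (rule Bochner_Integration.integrable_bound[OF integrable_mult_right[OF intY, of B]])
      show "AE \<omega> in M. norm (?Y n \<omega> * d n \<omega>) \<le> norm (B * ?Y n \<omega>)"
      proof (rule AE_I2)
        fix \<omega> assume "\<omega> \<in> space M"
        then have "\<bar>d n \<omega>\<bar> \<le> \<bar>B\<bar>" using B[of \<omega>] by linarith
        then show "norm (?Y n \<omega> * d n \<omega>) \<le> norm (B * ?Y n \<omega>)"
          by (simp add: abs_mult mult.commute mult_right_mono)
      qed
    qed measurable
    have d\<Delta>: "integrable M (\<lambda>\<omega>. d n \<omega> * \<Delta> \<omega>)" "expectation (\<lambda>\<omega>. d n \<omega> * \<Delta> \<omega>) = 0"
      using indep_increment_product[OF q dF intd, of "\<lambda>x. x"] \<Delta> by (simp_all add: \<Delta>_def)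
    have YdF: "(\<lambda>\<omega>. ?Y n \<omega> * d n \<omega>) \<in> borel_measurable (F (q n))" using IH(1) dF by measurable
    have Yd\<Delta>: "integrable M (\<lambda>\<omega>. ?Y n \<omega> * d n \<omega> * \<Delta> \<omega>)" "expectation (\<lambda>\<omega>. ?Y n \<omega> * d n \<omega> * \<Delta> \<omega>) = 0"
      using indep_increment_product[OF q YdF intYd, of "\<lambda>x. x"] \<Delta> by (simp_all add: \<Delta>_def)
    have d2F: "(\<lambda>\<omega>. (d n \<omega>)\<^sup>2) \<in> borel_measurable (F (q n))" using dF by measurable
    have d2: "integrable M (\<lambda>\<omega>. (d n \<omega>)\<^sup>2 * (\<Delta> \<omega>)\<^sup>2)"
      "expectation (\<lambda>\<omega>. (d n \<omega>)\<^sup>2 * (\<Delta> \<omega>)\<^sup>2) = expectation (\<lambda>\<omega>. (d n \<omega>)\<^sup>2) * (q (Suc n) - q n)"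
      using indep_increment_product[OF q d2F intd2, of "\<lambda>x. x\<^sup>2"] \<Delta> by (simp_all add: \<Delta>_def)
    have sq: "(\<lambda>\<omega>. (?Y (Suc n) \<omega>)\<^sup>2) = (\<lambda>\<omega>. (?Y n \<omega>)\<^sup>2 + (d n \<omega>)\<^sup>2 * (\<Delta> \<omega>)\<^sup>2 + 2 * (?Y n \<omega> * d n \<omega> * \<Delta> \<omega>))"
      unfolding YS by (simp add: power2_eq_square algebra_simps)
    show ?case
    proof (intro conjI)
      have "(\<lambda>\<omega>. ?Y n \<omega> + d n \<omega> * (W (q (Suc n)) \<omega> - W (q n) \<omega>)) \<in> borel_measurable (F (q (Suc n)))"
        using measurable_F_mono[OF IH(1)] measurable_F_mono[OF dF] measurable_F_mono[OF W_measurable[OF q(1)]] W_measurable[of "q (Suc n)"] q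
        by (intro borel_measurable_add borel_measurable_times borel_measurable_diff) auto
      then show "?Y (Suc n) \<in> borel_measurable (F (q (Suc n)))" by (simp add: YS \<Delta>_def)
      show "integrable M (\<lambda>\<omega>. (?Y (Suc n) \<omega>)\<^sup>2)"
        unfolding sq using IH(2) d2(1) Yd\<Delta>(1) by (intro Bochner_Integration.integrable_add integrable_mult_right)
      show "expectation (?Y (Suc n)) = 0"
        unfolding YS using intY d\<Delta> IH(3) by simp
      show "expectation (\<lambda>\<omega>. (?Y (Suc n) \<omega>)\<^sup>2) = (\<Sum>j<Suc n. expectation (\<lambda>\<omega>. (d j \<omega>)\<^sup>2) * (q (Suc j) - q j))"
        unfolding sq using IH(2,4) d2 Yd\<Delta> by simp
    qed
  qed
  then show "?Y n \<in> borel_measurable (F (q n))" "integrable M (\<lambda>\<omega>. (?Y n \<omega>)\<^sup>2)" "expectation (?Y n) = 0"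
    "expectation (\<lambda>\<omega>. (?Y n \<omega>)\<^sup>2) = (\<Sum>j<n. expectation (\<lambda>\<omega>. (d j \<omega>)\<^sup>2) * (q (Suc j) - q j))" by auto
qed

text \<open>
  The sum is cut off once the quadratic sum exceeds \<open>\<delta>\<close>.  The term with index \<open>j\<close> can be
  included in the test because \<open>d j\<close> is known at time \<open>q j\<close>.
\<close>

lemma increment_sum_tail:
  assumes step: "adapted_step M F n q d" and \<epsilon>: "\<epsilon> > 0" and S: "S \<subseteq> space M" "0 \<le> \<delta>"
    and le: "\<And>\<omega>. \<omega> \<in> S \<Longrightarrow> (\<Sum>j<n. (d j \<omega>)\<^sup>2 * (q (Suc j) - q j)) \<le> \<delta>"
    and ge: "\<And>\<omega>. \<omega> \<in> S \<Longrightarrow> \<epsilon> \<le> \<bar>increment_sum W q d n \<omega>\<bar>"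
  shows "prob S \<le> \<delta> / \<epsilon>\<^sup>2"
proof -
  define A where "A j \<omega> = (\<Sum>i\<le>j. (d i \<omega>)\<^sup>2 * (q (Suc i) - q i))" for j \<omega>
  define d' where "d' j \<omega> = (if A j \<omega> \<le> \<delta> then d j \<omega> else 0)" for j \<omega>
  have q: "q j < q (Suc j)" if "j < n" for j using step that by (simp add: adapted_step_def)
  have step': "adapted_step M F n q d'"
    unfolding adapted_step_def
  proof (intro conjI allI impI)
    show "0 \<le> q 0" "\<And>j. j < n \<Longrightarrow> q j < q (Suc j)" using step by (auto simp: adapted_step_def)
    fix j assume j: "j < n"
    have "d i \<in> borel_measurable (F (q j))" if "i \<le> j" for i
      using step that j adapted_step_mono[OF step, of i j] measurable_F_mono[of "d i" "q i" borel "q j"]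
      by (auto simp: adapted_step_def)
    then have A: "A j \<in> borel_measurable (F (q j))" "d j \<in> borel_measurable (F (q j))"
      unfolding A_def[abs_def] by (auto intro!: borel_measurable_sum borel_measurable_times borel_measurable_power)
    then show "d' j \<in> borel_measurable (F (q j))"
      unfolding d'_def[abs_def] by measurable
    obtain B where "\<forall>\<omega>\<in>space M. \<bar>d j \<omega>\<bar> \<le> B" using step j by (auto simp: adapted_step_def)
    then have "\<forall>\<omega>\<in>space M. \<bar>d' j \<omega>\<bar> \<le> \<bar>B\<bar>" by (fastforce simp: d'_def)
    then show "\<exists>B. \<forall>\<omega>\<in>space M. \<bar>d' j \<omega>\<bar> \<le> B" ..
  qed
  \<comment> \<open>The two bounds need each other: if step \<open>k\<close> is kept, then A k <=
    \<delta> bounds the full sum and hence the cut one; if it is dropped, the cut sum does not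
    grow.\<close>
  have cut: "(\<Sum>j<k. (d' j \<omega>)\<^sup>2 * (q (Suc j) - q j)) \<le> \<delta> \<and> (\<Sum>j<k. (d' j \<omega>)\<^sup>2 * (q (Suc j) - q j)) \<le> (\<Sum>j<k. (d j \<omega>)\<^sup>2 * (q (Suc j) - q j))"
    if "k \<le> n" for k \<omega>
    using that
  proof (induction k)
    case 0 then show ?case using S by simp
  next
    case (Suc k)
    have "A k \<omega> = (\<Sum>j<k. (d j \<omega>)\<^sup>2 * (q (Suc j) - q j)) + (d k \<omega>)\<^sup>2 * (q (Suc k) - q k)"
      by (simp add: A_def lessThan_Suc_atMost[symmetric])
    moreover have "0 \<le> (d k \<omega>)\<^sup>2 * (q (Suc k) - q k)" using q[of k] Suc.prems by simp
    ultimately show ?case using Suc by (auto simp: d'_def)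
  qed
  let ?Y = "increment_sum W q d' n"
  note iso = increment_sum_isometry[OF step']
  have [measurable]: "?Y \<in> borel_measurable M" using iso(1) by (rule measurable_F)
  have d'2: "integrable M (\<lambda>\<omega>. (d' j \<omega>)\<^sup>2)" if "j < n" for j
  proof -
    obtain B where B: "\<And>\<omega>. \<omega> \<in> space M \<Longrightarrow> \<bar>d' j \<omega>\<bar> \<le> B" "d' j \<in> borel_measurable M"
    proof -
      assume *: "\<And>B. (\<And>\<omega>. \<omega> \<in> space M \<Longrightarrow> \<bar>d' j \<omega>\<bar> \<le> B) \<Longrightarrow> d' j \<in> borel_measurable M \<Longrightarrow> thesis"
      have "d' j \<in> borel_measurable (F (q j))" "\<exists>B. \<forall>\<omega>\<in>space M. \<bar>d' j \<omega>\<bar> \<le> B"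
        using step' \<open>j < n\<close> by (simp_all add: adapted_step_def)
      then show thesis using * measurable_F by blast
    qed
    have "\<bar>d' j \<omega>\<bar>\<^sup>2 \<le> B\<^sup>2" if "\<omega> \<in> space M" for \<omega> using B(1)[OF that] by (intro power_mono) auto
    then show ?thesis using B(2) by (intro integrable_const_bound[where B="B\<^sup>2"]) auto
  qed
  have "expectation (\<lambda>\<omega>. ?Y \<omega> ^ 2) = expectation (\<lambda>\<omega>. \<Sum>j<n. (d' j \<omega>)\<^sup>2 * (q (Suc j) - q j))"
    unfolding iso(4) using d'2 by (subst Bochner_Integration.integral_sum) auto
  also have "\<dots> \<le> expectation (\<lambda>_. \<delta>)"
    using d'2 cut[of n] by (intro integral_mono Bochner_Integration.integrable_sum) auto
  also have "\<dots> = \<delta>" by (simp add: prob_space)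
  finally have var: "expectation (\<lambda>\<omega>. ?Y \<omega> ^ 2) \<le> \<delta>" .
  \<comment> \<open>On \<open>S\<close> the quadratic sum never exceeds \<delta>, so nothing is cut
    and the two sums coincide. The mean of \<open>?Y\<close> is 0; it is written out to match the
    inequality of Chebyshev.\<close>
  have "S \<subseteq> {\<omega>\<in>space M. \<epsilon> \<le> \<bar>?Y \<omega> - expectation ?Y\<bar>}"
  proof
    fix \<omega> assume \<omega>: "\<omega> \<in> S"
    have "A j \<omega> \<le> \<delta>" if "j < n" for j
    proof -
      have "A j \<omega> \<le> (\<Sum>j<n. (d j \<omega>)\<^sup>2 * (q (Suc j) - q j))"
        unfolding A_def using that q by (intro sum_mono2) (auto simp: less_imp_le)
      then show ?thesis using le[OF \<omega>] by linarith
    qed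
    then have "?Y \<omega> = increment_sum W q d n \<omega>" by (simp add: increment_sum_def d'_def)
    then show "\<omega> \<in> {\<omega>\<in>space M. \<epsilon> \<le> \<bar>?Y \<omega> - expectation ?Y\<bar>}" using ge[OF \<omega>] \<omega> S iso(3) by auto
  qed
  then have "prob S \<le> prob {\<omega>\<in>space M. \<epsilon> \<le> \<bar>?Y \<omega> - expectation ?Y\<bar>}"
    by (rule finite_measure_mono) measurable
  also have "\<dots> \<le> expectation (\<lambda>\<omega>. ?Y \<omega> ^ 2) / \<epsilon>\<^sup>2"
    using Chebyshev_inequality[of ?Y \<epsilon>] iso(2,3) \<epsilon> by simp
  also have "\<dots> \<le> \<delta> / \<epsilon>\<^sup>2" using var by (intro divide_right_mono) auto
  finally show ?thesis .
qed

end

text \<open>An elementary integrand may start late, run past \<open>t\<close>, repeat times and have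
  long steps. Its breakpoints together with a uniform grid, sorted, give a strict partition of [0,t]
  of small mesh; on each step it is constant, with a value known at the left endpoint.\<close>

lemma elementary_integrand_refine:
  fixes p :: "nat \<Rightarrow> real" and t \<delta> :: real
  assumes wiener: "wiener M F W" and el: "elementary_integrand M F n p \<xi>" and t: "0 < t" and \<delta>: "0 < \<delta>"
  obtains n' q \<eta> where "adapted_step M F n' q \<eta>" "q 0 = 0" "q n' = t"
    "\<And>j. j < n' \<Longrightarrow> q (Suc j) - q j \<le> \<delta>"
    "\<And>\<omega>. elementary_integral W n p \<xi> t \<omega> = increment_sum W q \<eta> n' \<omega>"
    "\<And>j s \<omega>. j < n' \<Longrightarrow> q j < s \<Longrightarrow> s \<le> q (Suc j) \<Longrightarrow> elementary_process n p \<xi> s \<omega> = \<eta> j \<omega>"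
proof -
  interpret wiener M F W by fact
  obtain m :: nat where m: "t / \<delta> < real m" using reals_Archimedean2 by blast
  have m0: "0 < real m" using m t \<delta> by (meson divide_pos_pos less_trans)
  have p_mono: "p i \<le> p j" if "i \<le> j" "j \<le> n" for i j
    using that
  proof (induction j)
    case (Suc j)
    have "p j \<le> p (Suc j)" using Suc.prems el by (simp add: elementary_integrand_def)
    then show ?case using Suc by (cases "i = Suc j") auto
  qed simp
  have p0: "0 \<le> p i" if "i \<le> n" for i
    using p_mono[of 0 i] that el by (auto simp: elementary_integrand_def)
  \<comment> \<open>Breakpoints beyond \<open>t\<close> are dropped because the integral stops at
    \<open>t\<close>. The equal grid steps have length t / m < \<delta>.\<close>
  define S where "S = insert 0 (insert t ({s \<in> p ` {..n}. s \<le> t} \<union> (\<lambda>i. t * real i / real m) ` {..m}))"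
  have finS: "finite S" by (simp add: S_def)
  have S_range: "S \<subseteq> {0..t}"
    using p0 t m0 by (auto simp: S_def field_simps intro!: mult_left_mono)
  have S0: "0 \<in> S" and St: "t \<in> S" by (auto simp: S_def)
  define l where "l = sorted_list_of_set S"
  have l: "sorted l" "distinct l" "set l = S" using finS by (auto simp: l_def)
  define q where "q j = l ! j" for j
  define n' where "n' = length l - 1"
  have len: "length l = Suc n'" using l(3) S0 by (cases l) (auto simp: n'_def)
  have q_less: "q i < q j" if "i < j" "j \<le> n'" for i j
    using that l len by (simp add: q_def sorted_wrt_nth_less strict_sorted_iff)
  have q_le: "q i \<le> q j" if "i \<le> j" "j \<le> n'" for i j
    using q_less[of i j] that by (cases "i = j") auto
  have q_S: "q j \<in> S" if "j \<le> n'" for j using that len nth_mem[of j l] by (simp add: q_def l(3))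
  have S_q: "\<exists>j\<le>n'. s = q j" if "s \<in> S" for s
  proof -
    obtain j where "j < length l" "s = l ! j" using \<open>s \<in> S\<close>[folded l(3)] unfolding in_set_conv_nth by blast
    then show ?thesis using len by (auto simp: q_def less_Suc_eq_le)
  qed
  have gap: "s \<le> q j \<or> q (Suc j) \<le> s" if "s \<in> S" "j < n'" for s j
  proof -
    obtain i where "i \<le> n'" "s = q i" using S_q[OF \<open>s \<in> S\<close>] by blast
    then show ?thesis using q_le[of i j] q_le[of "Suc j" i] that by (cases "i \<le> j") auto
  qed
  have q0: "q 0 = 0"
  proof -
    obtain i where "i \<le> n'" "0 = q i" using S_q[OF S0] by blast
    then show ?thesis using q_le[of 0 i] q_S[of 0] S_range by force
  qed
  have qn: "q n' = t"
  proof -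
    obtain i where "i \<le> n'" "t = q i" using S_q[OF St] by blast
    then show ?thesis using q_le[of i n'] q_S[of n'] S_range by force
  qed
  have mesh: "q (Suc j) - q j \<le> \<delta>" if j: "j < n'" for j
  proof -
    \<comment> \<open>The index of the grid cell containing \<open>q j\<close>. The right end of
      this cell belongs to \<open>S\<close>, so the next partition point cannot lie beyond
      it.\<close>
    define i where "i = nat \<lfloor>q j * m / t\<rfloor>"
    have qj: "0 \<le> q j" "q j < t" using q_le[of 0 j] q_less[of j n'] j q0 qn by auto
    have "0 \<le> q j * m / t" using qj t by simp
    then have i: "real i \<le> q j * m / t" "q j * m / t < real i + 1" unfolding i_def by linarith+
    have "q j * m / t < m" using qj t m0 by (simp add: field_simps)
    then have "i < m" using i by linarith
    then have "t * real (Suc i) / m \<in> S" unfolding S_def by (intro insertI2 UnI2 imageI) auto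
    moreover have "q j < t * real (Suc i) / m" using i t m0 by (simp add: field_simps)
    ultimately have "q (Suc j) \<le> t * real (Suc i) / m" using gap j by force
    moreover have "t * real i / m \<le> q j" using i t m0 by (simp add: field_simps)
    moreover have "t * real (Suc i) / m = t * real i / m + t / m" by (simp add: distrib_left add_divide_distrib)
    ultimately have "q (Suc j) - q j \<le> t / m" by linarith
    also have "\<dots> \<le> \<delta>" using m m0 \<delta> by (simp add: field_simps)
    finally show ?thesis .
  qed
  \<comment> \<open>The half-open interval is closed on the left here, because it is tested at the
    left endpoint \<open>q j\<close> and not inside the step. No breakpoint lies strictly between
    two partition points, so the two tests agree.\<close>
  define \<eta> where "\<eta> j \<omega> = (\<Sum>i<n. \<xi> i \<omega> * indicator {p i..<p (Suc i)} (q j))" for j \<omega>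
  have step: "adapted_step M F n' q \<eta>"
    unfolding adapted_step_def
  proof (intro conjI allI impI)
    show "0 \<le> q 0" using q0 by simp
    fix j assume j: "j < n'"
    show "q j < q (Suc j)" using q_less j by simp
    have "(\<lambda>\<omega>. \<xi> i \<omega> * indicator {p i..<p (Suc i)} (q j)) \<in> borel_measurable (F (q j))" if "i < n" for i
    proof (cases "p i \<le> q j")
      case True
      have "\<xi> i \<in> borel_measurable (F (q j))"
        using el that True measurable_F_mono[of "\<xi> i" "p i" borel "q j"] by (simp add: elementary_integrand_def)
      then show ?thesis by measurable
    qed simp
    then show "\<eta> j \<in> borel_measurable (F (q j))" unfolding \<eta>_def[abs_def] by (intro borel_measurable_sum) auto
    have "\<exists>B. \<forall>i<n. \<forall>\<omega>\<in>space M. \<bar>\<xi> i \<omega>\<bar> \<le> B i"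
      using el unfolding elementary_integrand_def by metis
    then obtain B where B: "\<And>i \<omega>. i < n \<Longrightarrow> \<omega> \<in> space M \<Longrightarrow> \<bar>\<xi> i \<omega>\<bar> \<le> B i" by blast
    have "\<bar>\<eta> j \<omega>\<bar> \<le> (\<Sum>i<n. B i)" if \<omega>: "\<omega> \<in> space M" for \<omega>
    proof -
      have "\<bar>\<eta> j \<omega>\<bar> \<le> (\<Sum>i<n. \<bar>\<xi> i \<omega> * indicator {p i..<p (Suc i)} (q j)\<bar>)" unfolding \<eta>_def by (rule sum_abs)
      also have "\<dots> \<le> (\<Sum>i<n. B i)"
      proof (rule sum_mono)
        fix i assume "i \<in> {..<n}"
        then have "\<bar>\<xi> i \<omega>\<bar> \<le> B i" using B \<omega> by simp
        then show "\<bar>\<xi> i \<omega> * indicator {p i..<p (Suc i)} (q j)\<bar> \<le> B i"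
          by (cases "q j \<in> {p i..<p (Suc i)}") auto
      qed
      finally show ?thesis .
    qed
    then show "\<exists>B. \<forall>\<omega>\<in>space M. \<bar>\<eta> j \<omega>\<bar> \<le> B" by blast
  qed
  have pS: "p i \<in> S" if "i \<le> n" "p i \<le> t" for i using that by (auto simp: S_def)
  have proc: "elementary_process n p \<xi> s \<omega> = \<eta> j \<omega>" if j: "j < n'" and s: "q j < s" "s \<le> q (Suc j)" for j s \<omega>
    unfolding elementary_process_def \<eta>_def
  proof (rule sum.cong[OF refl])
    fix i assume "i \<in> {..<n}"
    then have i: "i < n" by simp
    have "s \<le> t" using s q_le[of "Suc j" n'] j qn by simp
    have lower: "p i' < s \<longleftrightarrow> p i' \<le> q j" if "i' \<le> n" for i'
      using gap[OF pS[OF that] j] s \<open>s \<le> t\<close> by fastforce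
    have "s \<in> {p i<..p (Suc i)} \<longleftrightarrow> q j \<in> {p i..<p (Suc i)}"
      using lower[of i] lower[of "Suc i"] i by auto
    then show "\<xi> i \<omega> * indicator {p i<..p (Suc i)} s = \<xi> i \<omega> * indicator {p i..<p (Suc i)} (q j)"
      by (simp add: indicator_def)
  qed
  let ?\<Delta> = "\<lambda>j \<omega>. W (q (Suc j)) \<omega> - W (q j) \<omega>"
  \<comment> \<open>The indicator selects the steps that begin before \<open>p i\<close>; their
    increments telescope up to min (p i) t, itself a partition point. Increments over one interval
    of the integrand are differences of two such sums.\<close>
  have tele: "(\<Sum>j<n'. indicator {..<p i} (q j) * ?\<Delta> j \<omega>) = W (min (p i) t) \<omega> - W 0 \<omega>" if i: "i \<le> n" for i \<omega>
  proof -
    have "min (p i) t \<in> S" using pS[OF i] St by (auto simp: min_def)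
    then obtain k where k: "k \<le> n'" "min (p i) t = q k" using S_q by blast
    have "q j < p i \<longleftrightarrow> j < k" if j: "j < n'" for j
    proof -
      have "q j < t" using q_less[of j n'] j qn by simp
      then have "q j < p i \<longleftrightarrow> q j < q k" using k(2) by (auto simp: min_def split: if_splits)
      also have "\<dots> \<longleftrightarrow> j < k" using q_less[of j k] q_le[of k j] j k(1) by force
      finally show ?thesis .
    qed
    then have "(\<Sum>j<n'. indicator {..<p i} (q j) * ?\<Delta> j \<omega>) = (\<Sum>j<n'. if j < k then ?\<Delta> j \<omega> else 0)"
      by (intro sum.cong) auto
    also have "\<dots> = (\<Sum>j<k. ?\<Delta> j \<omega>)" using k(1) by (intro sum.mono_neutral_cong_right) auto
    also have "\<dots> = W (q k) \<omega> - W (q 0) \<omega>" by (rule sum_lessThan_telescope)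
    finally show ?thesis using k q0 by simp
  qed
  have int: "elementary_integral W n p \<xi> t \<omega> = increment_sum W q \<eta> n' \<omega>" for \<omega>
  proof -
    have "W (min (p (Suc i)) t) \<omega> - W (min (p i) t) \<omega> = (\<Sum>j<n'. indicator {p i..<p (Suc i)} (q j) * ?\<Delta> j \<omega>)" if i: "i < n" for i
    proof -
      have ii: "indicator {p i..<p (Suc i)} x = (indicator {..<p (Suc i)} x - indicator {..<p i} x :: real)" for x
        using p_mono[of i "Suc i"] i by (auto simp: indicator_def)
      have "(\<Sum>j<n'. indicator {p i..<p (Suc i)} (q j) * ?\<Delta> j \<omega>)
        = (\<Sum>j<n'. indicator {..<p (Suc i)} (q j) * ?\<Delta> j \<omega>) - (\<Sum>j<n'. indicator {..<p i} (q j) * ?\<Delta> j \<omega>)"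
        unfolding ii left_diff_distrib sum_subtractf ..
      then show ?thesis using tele[of i \<omega>] tele[of "Suc i" \<omega>] i by simp
    qed
    then have "elementary_integral W n p \<xi> t \<omega> = (\<Sum>i<n. \<xi> i \<omega> * (\<Sum>j<n'. indicator {p i..<p (Suc i)} (q j) * ?\<Delta> j \<omega>))"
      unfolding elementary_integral_def by (intro sum.cong) auto
    also have "\<dots> = (\<Sum>j<n'. \<Sum>i<n. \<xi> i \<omega> * indicator {p i..<p (Suc i)} (q j) * ?\<Delta> j \<omega>)"
      unfolding sum_distrib_left by (subst sum.swap) (simp add: mult.assoc)
    also have "\<dots> = increment_sum W q \<eta> n' \<omega>"
      unfolding increment_sum_def \<eta>_def sum_distrib_right ..
    finally show ?thesis .
  qed
  show thesis by (rule that[OF step q0 qn mesh int proc])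
qed

section \<open>Paths of the solution\<close>

text \<open>Countably many fractions approximate every time. For continuous paths this reduces
  statements about all times in an interval to countable, hence measurable ones.\<close>

lemma floor_approx: "(\<lambda>n. of_int \<lfloor>real n * u\<rfloor> / real n) \<longlonglongrightarrow> u" for u :: real
proof (rule LIM_zero_cancel, rule Lim_null_comparison)
  show "(\<lambda>n. 1 / real n) \<longlonglongrightarrow> 0" by real_asymp
  show "\<forall>\<^sub>F n in sequentially. norm (of_int \<lfloor>real n * u\<rfloor> / real n - u) \<le> 1 / real n"
    using eventually_gt_at_top[of 0]
  proof eventually_elim
    case (elim n)
    have "of_int \<lfloor>real n * u\<rfloor> \<le> real n * u" "real n * u < of_int \<lfloor>real n * u\<rfloor> + 1" by linarith+
    then have "\<bar>of_int \<lfloor>real n * u\<rfloor> - real n * u\<bar> \<le> 1" by linarith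
    moreover have "of_int \<lfloor>real n * u\<rfloor> / real n - u = (of_int \<lfloor>real n * u\<rfloor> - real n * u) / real n"
      using elim by (simp add: field_simps)
    ultimately show ?case using elim by (simp add: divide_right_mono)
  qed
qed

text \<open>Evaluated at floor (n t) / n the process uses countably many times only, and continuity
  of the paths makes these discretisations converge.\<close>

lemma continuous_process_measurable:
  fixes x :: "real \<Rightarrow> 'w \<Rightarrow> real"
  assumes m: "\<And>t. x t \<in> borel_measurable M" and c: "\<And>\<omega>. \<omega> \<in> space M \<Longrightarrow> continuous_on UNIV (\<lambda>t. x t \<omega>)"
  shows "(\<lambda>(t, \<omega>). x t \<omega>) \<in> borel_measurable (borel \<Otimes>\<^sub>M M)"
proof (rule borel_measurable_LIMSEQ_real)
  let ?f = "\<lambda>n p. x (of_int \<lfloor>real n * fst p\<rfloor> / real n) (snd p)"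
  show "?f n \<in> borel_measurable (borel \<Otimes>\<^sub>M M)" for n
  proof (rule measurable_compose_countable[where f="\<lambda>i p. x (of_int i / real n) (snd p)"])
    show "(\<lambda>p :: real \<times> 'w. x (of_int i / real n) (snd p)) \<in> borel_measurable (borel \<Otimes>\<^sub>M M)" for i :: int
      by (rule measurable_compose[OF measurable_snd m])
    show "(\<lambda>p. \<lfloor>real n * fst p\<rfloor>) \<in> measurable (borel \<Otimes>\<^sub>M M) (count_space UNIV)" by measurable
  qed
  fix p :: "real \<times> 'w" assume "p \<in> space (borel \<Otimes>\<^sub>M M)"
  then have "continuous_on UNIV (\<lambda>t. x t (snd p))" by (auto simp: space_pair_measure intro: c)
  then have "isCont (\<lambda>t. x t (snd p)) (fst p)" by (simp add: continuous_on_eq_continuous_at)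
  then have "(\<lambda>n. x (of_int \<lfloor>real n * fst p\<rfloor> / real n) (snd p)) \<longlonglongrightarrow> x (fst p) (snd p)"
    by (rule isCont_tendsto_compose) (rule floor_approx)
  then show "(\<lambda>n. ?f n p) \<longlonglongrightarrow> (case p of (t, \<omega>) \<Rightarrow> x t \<omega>)" by (simp add: case_prod_beta)
qed

lemma fraction_mult_Icc: "i \<le> n \<Longrightarrow> 0 \<le> s \<Longrightarrow> real i / real n * s \<in> {0..s}"
proof -
  assume "i \<le> n" "0 \<le> s"
  then have "real i / real n \<le> 1" by (auto simp: divide_le_eq_1)
  then show ?thesis using mult_right_mono[of "real i / real n" 1 s] \<open>0 \<le> s\<close> by auto
qed

lemma BC_norm_upper: "\<phi> \<in> BC_neg \<Longrightarrow> \<theta> \<le> 0 \<Longrightarrow> \<bar>\<phi> \<theta>\<bar> \<le> BC_norm \<phi>"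
proof -
  assume \<phi>: "\<phi> \<in> BC_neg" and \<theta>: "\<theta> \<le> 0"
  have "bdd_above ((\<lambda>\<theta>. \<bar>\<phi> \<theta>\<bar>) ` {..0})"
    using \<phi> by (auto simp: BC_neg_def bounded_iff bdd_above_def)
  then show ?thesis unfolding BC_norm_def using \<theta> by (intro cSUP_upper) auto
qed

lemma BC_norm_nonneg: "\<phi> \<in> BC_neg \<Longrightarrow> 0 \<le> BC_norm \<phi>"
  using BC_norm_upper[of \<phi> 0] by (meson abs_ge_zero order_trans order_refl)

section \<open>Measurability, continuity and bounds for the paths and the delay term\<close>

locale sde_solution = wiener +
  fixes a b \<sigma>0 \<sigma>1 \<sigma>2 :: real and K \<phi> :: "real \<Rightarrow> real" and x :: "real \<Rightarrow> 'a \<Rightarrow> real"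
  assumes K: "delay_kernel K" and \<phi>: "\<phi> \<in> BC_neg"
    and sol: "stochastic_solution M F W a b \<sigma>0 \<sigma>1 \<sigma>2 K \<phi> x"
begin

definition k where "k u = indicator {0..} u * K u"

definition y where "y s \<omega> = delay_term K (\<lambda>r. x r \<omega>) s"

lemma k: "integrable lborel k" "(LINT u|lborel. k u) = 1" "0 \<le> k u" "u < 0 \<Longrightarrow> k u = 0"
  using K by (auto simp: delay_kernel_def set_integrable_def set_lebesgue_integral_def k_def[abs_def] indicator_def)

lemma k_meas[measurable]: "k \<in> borel_measurable borel"
  using k(1) by auto

lemma y_eq: "y s \<omega> = (LINT u|lborel. k u * x (s - u) \<omega>)"
  by (simp add: y_def delay_term_def set_lebesgue_integral_def k_def mult.assoc)

lemma x_neg: "\<omega> \<in> space M \<Longrightarrow> \<theta> \<le> 0 \<Longrightarrow> x \<theta> \<omega> = \<phi> \<theta>"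
  using sol by (simp add: stochastic_solution_def)

text \<open>History and future are continuous on closed half lines that meet at 0, so they paste
  together.\<close>

lemma x_cont: "\<omega> \<in> space M \<Longrightarrow> continuous_on UNIV (\<lambda>t. x t \<omega>)"
proof -
  assume \<omega>: "\<omega> \<in> space M"
  have "continuous_on {..0} \<phi>" using \<phi> by (simp add: BC_neg_def)
  then have "continuous_on {..0} (\<lambda>t. x t \<omega>)"
    by (rule continuous_on_eq) (use x_neg \<omega> in auto)
  moreover have "continuous_on {0..} (\<lambda>t. x t \<omega>)" using sol \<omega> by (simp add: stochastic_solution_def)
  ultimately have "continuous_on ({..0} \<union> {0..}) (\<lambda>t. x t \<omega>)" by (intro continuous_on_closed_Un) auto
  then show ?thesis by (simp add: Un_commute ivl_disj_un_one sup_commute) (metis UNIV_eq_I UnI1 UnI2 atLeast_iff atMost_iff linear)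
qed

lemma x_adapted: "0 \<le> t \<Longrightarrow> x t \<in> borel_measurable (F t)"
  using sol by (simp add: stochastic_solution_def)

lemma x_meas[measurable]: "x t \<in> borel_measurable M"
proof (cases "0 \<le> t")
  case True then show ?thesis by (rule measurable_F[OF x_adapted])
next
  case False
  then have "x t \<in> borel_measurable M \<longleftrightarrow> (\<lambda>\<omega>. \<phi> t) \<in> borel_measurable M"
    by (intro measurable_cong) (simp add: x_neg)
  then show ?thesis by simp
qed

lemma x_joint[measurable]: "(\<lambda>(t, \<omega>). x t \<omega>) \<in> borel_measurable (borel \<Otimes>\<^sub>M M)"
  by (rule continuous_process_measurable[OF x_meas x_cont])

text \<open>Joint measurability in composed form, the shape in which the measurability prover can
  apply it.\<close>

lemma x_joint2[measurable]:
  "f \<in> measurable N borel \<Longrightarrow> g \<in> measurable N M \<Longrightarrow> (\<lambda>z. x (f z) (g z)) \<in> borel_measurable N"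
  using measurable_compose[OF measurable_Pair x_joint, of f N g] by simp

lemma y_joint[measurable]: "(\<lambda>(t, \<omega>). y t \<omega>) \<in> borel_measurable (borel \<Otimes>\<^sub>M M)"
proof -
  have "(\<lambda>p. LINT u|lborel. k u * x (fst p - u) (snd p)) \<in> borel_measurable (borel \<Otimes>\<^sub>M M)"
    by measurable
  then show ?thesis by (simp add: y_eq case_prod_beta)
qed

lemma y_joint2[measurable]:
  "f \<in> measurable N borel \<Longrightarrow> g \<in> measurable N M \<Longrightarrow> (\<lambda>z. y (f z) (g z)) \<in> borel_measurable N"
  using measurable_compose[OF measurable_Pair y_joint, of f N g] by simp

text \<open>
  By continuity of the paths this says $|x| \leq N$ on $[0,s]$, see \<open>below_iff\<close>; quantifying
  over fractions makes it measurable.  For \<open>n = 0\<close> the fraction is 0.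
\<close>

definition below where "below N s \<omega> \<longleftrightarrow> (\<forall>n i. i \<le> n \<longrightarrow> \<bar>x (real i / real n * s) \<omega>\<bar> \<le> N)"

text \<open>Every point of [0,s] is a limit of the tested fractions, and |x| <= N survives the limit
  along a continuous path.\<close>

lemma below_iff:
  assumes \<omega>: "\<omega> \<in> space M" and s: "0 \<le> s"
  shows "below N s \<omega> \<longleftrightarrow> (\<forall>r\<in>{0..s}. \<bar>x r \<omega>\<bar> \<le> N)"
proof
  assume "\<forall>r\<in>{0..s}. \<bar>x r \<omega>\<bar> \<le> N"
  then show "below N s \<omega>" unfolding below_def using fraction_mult_Icc[OF _ s] by blast
next
  assume below: "below N s \<omega>"
  show "\<forall>r\<in>{0..s}. \<bar>x r \<omega>\<bar> \<le> N"
  proof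
    fix r assume r: "r \<in> {0..s}"
    define u where "u = (if s = 0 then 0 else r / s)"
    have u: "0 \<le> u" "u \<le> 1" "r = u * s" using r s by (auto simp: u_def)
    have "isCont (\<lambda>t. x t \<omega>) (u * s)" using x_cont[OF \<omega>] by (simp add: continuous_on_eq_continuous_at)
    then have "(\<lambda>n. x (of_int \<lfloor>real n * u\<rfloor> / real n * s) \<omega>) \<longlonglongrightarrow> x (u * s) \<omega>"
      by (rule isCont_tendsto_compose) (intro tendsto_intros floor_approx)
    then have "(\<lambda>n. \<bar>x (of_int \<lfloor>real n * u\<rfloor> / real n * s) \<omega>\<bar>) \<longlonglongrightarrow> \<bar>x (u * s) \<omega>\<bar>" by (rule tendsto_rabs)
    moreover have "\<bar>x (of_int \<lfloor>real n * u\<rfloor> / real n * s) \<omega>\<bar> \<le> N" for n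
    proof -
      have "real n * u \<le> real n * 1" "0 \<le> real n * u" using u mult_left_mono[OF u(2), of "real n"] by auto
      then have "0 \<le> \<lfloor>real n * u\<rfloor>" "\<lfloor>real n * u\<rfloor> \<le> int n" by linarith+
      then have "of_int \<lfloor>real n * u\<rfloor> = real (nat \<lfloor>real n * u\<rfloor>)" "nat \<lfloor>real n * u\<rfloor> \<le> n" by auto
      then show ?thesis using below unfolding below_def by (simp only:)
    qed
    ultimately show "\<bar>x r \<omega>\<bar> \<le> N" unfolding u(3) by (intro LIMSEQ_le_const2) auto
  qed
qed

lemma below_mono: "\<omega> \<in> space M \<Longrightarrow> 0 \<le> s \<Longrightarrow> s \<le> t \<Longrightarrow> below N t \<omega> \<Longrightarrow> below N s \<omega>"
  using below_iff[of \<omega> s N] below_iff[of \<omega> t N] by auto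

lemma below_joint[measurable]: "Measurable.pred (borel \<Otimes>\<^sub>M M) (\<lambda>(s, \<omega>). below N s \<omega>)"
  unfolding below_def[abs_def] case_prod_beta by measurable

lemma below_joint2[measurable]:
  "f \<in> measurable N borel \<Longrightarrow> g \<in> measurable N M \<Longrightarrow> Measurable.pred N (\<lambda>z. below B (f z) (g z))"
  using measurable_compose[OF measurable_Pair below_joint, of f N g B] by simp

text \<open>Only times in [0,s] are tested. This is what makes the truncated coefficient
  adapted.\<close>

lemma below_adapted: "0 \<le> s \<Longrightarrow> Measurable.pred (F s) (below N s)"
proof -
  assume s: "0 \<le> s"
  have "x (real i / real n * s) \<in> borel_measurable (F s)" if "i \<le> n" for i n
    by (rule measurable_F_mono[OF x_adapted]) (use fraction_mult_Icc[OF that s] s in auto)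
  then have "Measurable.pred (F s) (\<lambda>\<omega>. i \<le> n \<longrightarrow> \<bar>x (real i / real n * s) \<omega>\<bar> \<le> N)" for i n
    by (cases "i \<le> n") auto
  then show ?thesis unfolding below_def[abs_def] by (intro pred_intros_countable)
qed

lemma path_bound:
  assumes \<omega>: "\<omega> \<in> space M"
  obtains B where "BC_norm \<phi> \<le> B" "\<And>r. r \<le> T \<Longrightarrow> \<bar>x r \<omega>\<bar> \<le> B"
proof -
  have "bounded ((\<lambda>t. x t \<omega>) ` {0..T})"
    by (intro compact_imp_bounded compact_continuous_image continuous_on_subset[OF x_cont[OF \<omega>]]) auto
  then obtain C where C: "\<forall>z\<in>(\<lambda>t. x t \<omega>) ` {0..T}. norm z \<le> C" unfolding bounded_iff by blast
  then have "\<bar>x r \<omega>\<bar> \<le> max C (BC_norm \<phi>)" if "r \<le> T" for r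
    using BC_norm_upper[OF \<phi>, of r] x_neg[OF \<omega>, of r] C that by (cases "r \<le> 0") (auto simp: le_max_iff_disj)
  then show thesis by (intro that[of "max C (BC_norm \<phi>)"]) auto
qed

text \<open>As \<open>k\<close> is a probability density on the nonnegative half line,
  \<open>y s\<close> is an average of past values.\<close>

lemma y_bound:
  assumes "\<omega> \<in> space M" "\<And>r. r \<le> s \<Longrightarrow> \<bar>x r \<omega>\<bar> \<le> B"
  shows "\<bar>y s \<omega>\<bar> \<le> B" "integrable lborel (\<lambda>u. k u * x (s - u) \<omega>)"
proof -
  have le: "\<bar>k u * x (s - u) \<omega>\<bar> \<le> k u * B" for u
    using k(3)[of u] k(4)[of u] assms(2)[of "s - u"] by (cases "u < 0") (auto simp: abs_mult mult_left_mono)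
  have I: "integrable lborel (\<lambda>u. k u * B)" using k(1) by simp
  have "\<bar>y s \<omega>\<bar> \<le> (LINT u|lborel. k u * B)" unfolding y_eq using le by (intro integral_abs_le I)
  then show "\<bar>y s \<omega>\<bar> \<le> B" using k(2) by simp
  have [measurable]: "(\<lambda>t. x t \<omega>) \<in> borel_measurable borel"
    by (rule borel_measurable_continuous_onI[OF x_cont[OF assms(1)]])
  show "integrable lborel (\<lambda>u. k u * x (s - u) \<omega>)"
    by (rule Bochner_Integration.integrable_bound[OF I])
      (use le in \<open>auto intro!: AE_I2 intro: order_trans[OF _ abs_ge_self]\<close>)
qed

text \<open>A convergent sequence of times stays below some \<open>T\<close>, and a path is bounded
  on the whole half line up to \<open>T\<close>, history included; \<open>k\<close> times this bound
  dominates the integrands.\<close>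

lemma y_cont: "\<omega> \<in> space M \<Longrightarrow> continuous_on UNIV (\<lambda>s. y s \<omega>)"
proof -
  assume \<omega>: "\<omega> \<in> space M"
  have [measurable]: "(\<lambda>t. x t \<omega>) \<in> borel_measurable borel"
    by (rule borel_measurable_continuous_onI[OF x_cont[OF \<omega>]])
  show ?thesis
    unfolding continuous_on_sequentially
  proof (intro allI ballI impI)
    fix S :: "nat \<Rightarrow> real" and l assume "(\<forall>n. S n \<in> UNIV) \<and> S \<longlonglongrightarrow> l"
    then have S: "S \<longlonglongrightarrow> l" by simp
    then have "bounded (range S)" by (rule convergent_imp_bounded)
    then obtain T where "\<forall>z\<in>range S. norm z \<le> T" unfolding bounded_iff by blast
    then have T: "S n \<le> T" for n by (auto simp: abs_le_iff)
    obtain B where B: "\<And>r. r \<le> T \<Longrightarrow> \<bar>x r \<omega>\<bar> \<le> B" using path_bound[OF \<omega>] by metis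
    have "(\<lambda>n. LINT u|lborel. k u * x (S n - u) \<omega>) \<longlonglongrightarrow> (LINT u|lborel. k u * x (l - u) \<omega>)"
    proof (rule integral_dominated_convergence[where w="\<lambda>u. k u * B"])
      show "integrable lborel (\<lambda>u. k u * B)" using k(1) by simp
      show "AE u in lborel. (\<lambda>n. k u * x (S n - u) \<omega>) \<longlonglongrightarrow> k u * x (l - u) \<omega>"
      proof (rule AE_I2)
        fix u
        have "isCont (\<lambda>t. x t \<omega>) (l - u)" using x_cont[OF \<omega>] by (simp add: continuous_on_eq_continuous_at)
        then have "(\<lambda>n. x (S n - u) \<omega>) \<longlonglongrightarrow> x (l - u) \<omega>"
          by (rule isCont_tendsto_compose) (intro tendsto_intros S)
        then show "(\<lambda>n. k u * x (S n - u) \<omega>) \<longlonglongrightarrow> k u * x (l - u) \<omega>" by (intro tendsto_intros)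
      qed
      show "AE u in lborel. norm (k u * x (S n - u) \<omega>) \<le> k u * B" for n
      proof (rule AE_I2)
        fix u show "norm (k u * x (S n - u) \<omega>) \<le> k u * B"
          using k(3)[of u] k(4)[of u] B[of "S n - u"] T[of n] by (cases "u < 0") (auto simp: abs_mult mult_left_mono)
      qed
    qed measurable
    then show "((\<lambda>s. y s \<omega>) \<circ> S) \<longlonglongrightarrow> y l \<omega>" by (simp add: o_def y_eq)
  qed
qed

end

lemma sum_indicator_steps:
  assumes "\<And>j. j < n \<Longrightarrow> q j < q (Suc j)"
  shows "(\<Sum>j<n. indicator {q j<..q (Suc j)} (s::real) :: ennreal) = indicator {q 0<..q n} s \<and> q 0 \<le> q n"
  using assms
proof (induction n)
  case (Suc n)
  then have "(\<Sum>j<n. indicator {q j<..q (Suc j)} s :: ennreal) = indicator {q 0<..q n} s" "q 0 \<le> q n" "q n < q (Suc n)" by auto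
  then show ?case by (auto simp: indicator_def split: if_splits)
qed simp

lemma power2_sum_le: "(u + v)\<^sup>2 \<le> 2 * u\<^sup>2 + 2 * v\<^sup>2" for u v :: real
  using sum_squares_bound[of u v] by (simp add: power2_sum)

lemma adapted_stepD:
  assumes "adapted_step M F n q d" "j < n"
  shows "d j \<in> borel_measurable (F (q j))" "\<exists>B. \<forall>\<omega>\<in>space M. \<bar>d j \<omega>\<bar> \<le> B"
  using assms by (simp_all add: adapted_step_def)

section \<open>Approximation of the Ito integral by left-endpoint sums\<close>

context sde_solution
begin

definition H where "H s \<omega> = \<sigma>0 + \<sigma>1 * x s \<omega> + \<sigma>2 * y s \<omega>"

lemma H_joint2[measurable]:
  "f \<in> measurable N borel \<Longrightarrow> g \<in> measurable N M \<Longrightarrow> (\<lambda>z. H (f z) (g z)) \<in> borel_measurable N"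
  unfolding H_def
  by (intro borel_measurable_add borel_measurable_times borel_measurable_const x_joint2 y_joint2)

lemma H_cont: "\<omega> \<in> space M \<Longrightarrow> continuous_on UNIV (\<lambda>s. H s \<omega>)"
  unfolding H_def by (intro continuous_on_add continuous_on_mult_left continuous_on_const x_cont y_cont)

lemma ito:
  assumes "0 \<le> t"
  obtains J where "has_ito_integral M F W H t J"
    "AE \<omega> in M. x t \<omega> = \<phi> 0 + (LINT s:{0..t}|lborel. a * x s \<omega> + b * y s \<omega>) + J \<omega>"
proof -
  have H: "H = (\<lambda>s \<omega>. \<sigma>0 + \<sigma>1 * x s \<omega> + \<sigma>2 * delay_term K (\<lambda>r. x r \<omega>) s)"
    by (intro ext) (simp add: H_def y_def)
  have "\<exists>J. has_ito_integral M F W H t J \<and>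
      (AE \<omega> in M. x t \<omega> = \<phi> 0 + (LINT s:{0..t}|lborel. a * x s \<omega> + b * y s \<omega>) + J \<omega>)"
    using sol assms unfolding stochastic_solution_def H y_def by blast
  then show thesis using that by blast
qed

text \<open>Adaptedness of the delay term is not derived from its integral formula: it is part of
  \<open>ito_integrand\<close>, which the notion of solution supplies for every horizon.\<close>

lemma H_adapted: "0 \<le> s \<Longrightarrow> H s \<in> borel_measurable (F s)"
proof -
  assume s: "0 \<le> s"
  obtain J where "has_ito_integral M F W H s J" by (rule ito[OF s])
  then show ?thesis using s by (simp add: has_ito_integral_def ito_integrand_def)
qed

lemma below_bound: "\<omega> \<in> space M \<Longrightarrow> 0 \<le> s \<Longrightarrow> below N s \<omega> \<Longrightarrow> r \<le> s \<Longrightarrow> \<bar>x r \<omega>\<bar> \<le> max N (BC_norm \<phi>)"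
  using BC_norm_upper[OF \<phi>, of r] x_neg[of \<omega> r] below_iff[of \<omega> s N]
  by (cases "r \<le> 0") (auto simp: le_max_iff_disj)

lemma H_bound:
  assumes "\<omega> \<in> space M" "0 \<le> s" "below N s \<omega>"
  shows "\<bar>H s \<omega>\<bar> \<le> \<bar>\<sigma>0\<bar> + (\<bar>\<sigma>1\<bar> + \<bar>\<sigma>2\<bar>) * max N (BC_norm \<phi>)"
proof -
  have "\<bar>x s \<omega>\<bar> \<le> max N (BC_norm \<phi>)" "\<bar>y s \<omega>\<bar> \<le> max N (BC_norm \<phi>)"
    using below_bound[OF assms] by (auto intro!: y_bound assms)
  then have "\<bar>\<sigma>1 * x s \<omega>\<bar> \<le> \<bar>\<sigma>1\<bar> * max N (BC_norm \<phi>)" "\<bar>\<sigma>2 * y s \<omega>\<bar> \<le> \<bar>\<sigma>2\<bar> * max N (BC_norm \<phi>)"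
    unfolding abs_mult by (auto intro: mult_left_mono)
  then show ?thesis unfolding H_def distrib_right by linarith
qed

text \<open>\<open>below\<close> can only turn false as \<open>s\<close> grows, so this is the
  coefficient set to 0 after the path has left [-N,N]. It is bounded, and it agrees with
  \<open>H\<close> on [0,t] whenever \<open>below N t\<close> holds.\<close>

definition hN where "hN N s \<omega> = (if below N s \<omega> then H s \<omega> else 0)"

lemma hN_adapted: "0 \<le> s \<Longrightarrow> hN N s \<in> borel_measurable (F s)"
  unfolding hN_def[abs_def] using H_adapted[of s] below_adapted[of s N] by measurable

lemma hN_bound: "\<omega> \<in> space M \<Longrightarrow> 0 \<le> s \<Longrightarrow> \<bar>hN N s \<omega>\<bar> \<le> \<bar>\<sigma>0\<bar> + (\<bar>\<sigma>1\<bar> + \<bar>\<sigma>2\<bar>) * \<bar>max N (BC_norm \<phi>)\<bar>"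
proof (cases "below N s \<omega>")
  case True
  assume "\<omega> \<in> space M" "0 \<le> s"
  from H_bound[OF this True] BC_norm_nonneg[OF \<phi>] show ?thesis using True by (simp add: hN_def)
qed (simp add: hN_def)

text \<open>The modulus of continuity of \<open>H\<close> on [0,t] at scale 1 / (m + 1) exceeds
  \<delta>; testing it at fractions of \<open>t\<close> only keeps the event measurable.\<close>

definition osc where "osc t \<delta> m \<omega> \<longleftrightarrow>
  (\<exists>n i n' i'. i \<le> n \<and> i' \<le> n' \<and> \<bar>real i / real n * t - real i' / real n' * t\<bar> < 1 / real (Suc m) \<and>
     \<delta> < \<bar>H (real i / real n * t) \<omega> - H (real i' / real n' * t) \<omega>\<bar>)"

lemma osc_meas[measurable]: "Measurable.pred M (osc t \<delta> m)"
  unfolding osc_def[abs_def] by measurable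

text \<open>Both times are limits of fractions of \<open>t\<close>. The strict inequality for their
  distance persists for late approximants, and the weak inequality for \<open>H\<close> passes to
  the limit.\<close>

lemma not_osc:
  assumes \<omega>: "\<omega> \<in> space M" and t: "0 < t" and osc: "\<not> osc t \<delta> m \<omega>"
    and s: "s \<in> {0..t}" and r: "r \<in> {0..t}" and sr: "\<bar>s - r\<bar> < 1 / real (Suc m)"
  shows "\<bar>H s \<omega> - H r \<omega>\<bar> \<le> \<delta>"
proof -
  let ?a = "\<lambda>u n. of_int \<lfloor>real n * (u / t)\<rfloor> / real n * t"
  have lim: "(\<lambda>n. ?a u n) \<longlonglongrightarrow> u" for u
    using tendsto_mult[OF floor_approx[of "u / t"] tendsto_const[of t]] t by simp
  have frac: "\<exists>i\<le>n. ?a u n = real i / real n * t" if u: "u \<in> {0..t}" for u n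
  proof -
    have "0 \<le> u / t" "u / t \<le> 1" using u t by (auto simp: divide_le_eq_1)
    then have "real n * (u / t) \<le> real n * 1" "0 \<le> real n * (u / t)"
      by (intro mult_left_mono, auto intro!: mult_nonneg_nonneg simp del: times_divide_eq_right)
    then have "0 \<le> \<lfloor>real n * (u / t)\<rfloor>" "\<lfloor>real n * (u / t)\<rfloor> \<le> int n" by linarith+
    then show ?thesis by (intro exI[of _ "nat \<lfloor>real n * (u / t)\<rfloor>"]) auto
  qed
  have limH: "(\<lambda>n. H (?a u n) \<omega>) \<longlonglongrightarrow> H u \<omega>" for u
  proof -
    have "isCont (\<lambda>s. H s \<omega>) u" using H_cont[OF \<omega>] by (simp add: continuous_on_eq_continuous_at)
    then show ?thesis by (rule isCont_tendsto_compose) (rule lim)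
  qed
  have "(\<lambda>n. \<bar>?a s n - ?a r n\<bar>) \<longlonglongrightarrow> \<bar>s - r\<bar>" by (intro tendsto_intros lim)
  then have "eventually (\<lambda>n. \<bar>?a s n - ?a r n\<bar> < 1 / real (Suc m)) sequentially"
    using sr by (rule order_tendstoD(2))
  then have "eventually (\<lambda>n. \<bar>H (?a s n) \<omega> - H (?a r n) \<omega>\<bar> \<le> \<delta>) sequentially"
  proof eventually_elim
    case (elim n)
    obtain i i' where i: "i \<le> n" "?a s n = real i / real n * t" "i' \<le> n" "?a r n = real i' / real n * t"
      using frac[OF s, of n] frac[OF r, of n] by blast
    have "\<not> \<delta> < \<bar>H (real i / real n * t) \<omega> - H (real i' / real n * t) \<omega>\<bar>"
      using osc elim i(1,3) unfolding osc_def i(2,4) by blast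
    then show ?case unfolding i(2,4) by simp
  qed
  moreover have "(\<lambda>n. \<bar>H (?a s n) \<omega> - H (?a r n) \<omega>\<bar>) \<longlonglongrightarrow> \<bar>H s \<omega> - H r \<omega>\<bar>" by (intro tendsto_intros limH)
  ultimately show ?thesis by (intro tendsto_upperbound[OF _ _ trivial_limit_sequentially])
qed

text \<open>The events decrease in \<open>m\<close>, and uniform continuity of each path on [0,t]
  leaves their intersection empty.\<close>

lemma osc_prob:
  assumes t: "0 < t" and \<delta>: "0 < \<delta>"
  shows "(\<lambda>m. prob {\<omega>\<in>space M. osc t \<delta> m \<omega>}) \<longlonglongrightarrow> 0"
proof -
  let ?O = "\<lambda>m. {\<omega>\<in>space M. osc t \<delta> m \<omega>}"
  have "(\<lambda>m. prob (?O m)) \<longlonglongrightarrow> prob (\<Inter>m. ?O m)"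
  proof (rule finite_Lim_measure_decseq)
    show "range ?O \<subseteq> events" by auto
    have "osc t \<delta> m \<omega>" if "osc t \<delta> m' \<omega>" "m \<le> m'" for m m' \<omega>
    proof -
      have "1 / real (Suc m') \<le> 1 / real (Suc m)" using that by (simp add: frac_le)
      then show ?thesis using that(1) unfolding osc_def by (meson less_le_trans)
    qed
    then show "decseq ?O" by (auto simp: decseq_def)
  qed
  moreover have "(\<Inter>m. ?O m) = {}"
  proof (rule ccontr)
    assume "(\<Inter>m. ?O m) \<noteq> {}"
    then obtain \<omega> where \<omega>: "\<omega> \<in> space M" "\<And>m. osc t \<delta> m \<omega>" by auto
    have "uniformly_continuous_on {0..t} (\<lambda>s. H s \<omega>)"
      by (intro compact_uniformly_continuous continuous_on_subset[OF H_cont[OF \<omega>(1)]]) auto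
    then obtain d where d: "d > 0" "\<And>s r. s \<in> {0..t} \<Longrightarrow> r \<in> {0..t} \<Longrightarrow> dist r s < d \<Longrightarrow> dist (H r \<omega>) (H s \<omega>) < \<delta>"
      unfolding uniformly_continuous_on_def using \<delta> by metis
    obtain m where m: "inverse (real (Suc m)) < d" using reals_Archimedean[OF d(1)] by auto
    obtain n i n' i' where i: "i \<le> n" "i' \<le> n'" "\<bar>real i / real n * t - real i' / real n' * t\<bar> < 1 / real (Suc m)"
      "\<delta> < \<bar>H (real i / real n * t) \<omega> - H (real i' / real n' * t) \<omega>\<bar>"
      using \<omega>(2)[of m] unfolding osc_def by blast
    have "dist (real i / real n * t) (real i' / real n' * t) < d"
      using i(3) m by (simp add: dist_real_def inverse_eq_divide)
    then have "\<bar>H (real i / real n * t) \<omega> - H (real i' / real n' * t) \<omega>\<bar> < \<delta>"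
      using d(2)[of "real i' / real n' * t" "real i / real n * t"] fraction_mult_Icc[OF i(1) less_imp_le[OF t]] fraction_mult_Icc[OF i(2) less_imp_le[OF t]]
      unfolding dist_real_def by blast
    then show False using i(4) by linarith
  qed
  ultimately show ?thesis by simp
qed

text \<open>On a fine partition the values of an approximating elementary integrand differ from
  those of \<open>hN\<close> by its distance from \<open>H\<close> plus the oscillation of
  \<open>H\<close> within a step. On \<open>below N t\<close>, off small events, both have a small
  square integral over [0,t]. The tail estimate, a statement in probability, transfers this
  closeness to the sums.\<close>

lemma ito_approximation:
  assumes t: "0 < t" and J: "has_ito_integral M F W H t J" and \<epsilon>: "0 < \<epsilon>"
  obtains n q where "adapted_step M F n q (\<lambda>j. hN N (q j))" "q 0 = 0" "q n = t"
    "prob {\<omega>\<in>space M. below N t \<omega> \<and> \<epsilon> < \<bar>increment_sum W q (\<lambda>j. hN N (q j)) n \<omega> - J \<omega>\<bar>} \<le> \<epsilon>"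
proof -
  obtain nn p \<xi> where el: "\<And>k. elementary_integrand M F (nn k) (p k) (\<xi> k)"
    and L1: "\<And>\<epsilon>. \<epsilon> > 0 \<Longrightarrow> (\<lambda>k. prob {\<omega> \<in> space M.
            (\<integral>\<^sup>+s\<in>{0..t}. ennreal ((elementary_process (nn k) (p k) (\<xi> k) s \<omega> - H s \<omega>)\<^sup>2) \<partial>lborel)
              > ennreal \<epsilon>}) \<longlonglongrightarrow> 0"
    and L2: "\<And>\<epsilon>. \<epsilon> > 0 \<Longrightarrow> (\<lambda>k. prob {\<omega> \<in> space M.
            \<bar>elementary_integral W (nn k) (p k) (\<xi> k) t \<omega> - J \<omega>\<bar> > \<epsilon>}) \<longlonglongrightarrow> 0"
    and J_meas[measurable]: "J \<in> borel_measurable M"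
    using J unfolding has_ito_integral_def by blast
  \<comment> \<open>Chosen so that 2 \<delta>1 + 2 \<delta>2^2 t = \<delta>, while the tail estimate
    at level \<epsilon> / 2 yields the probability \<epsilon> / 8. Three further events of
    probability below \<epsilon> / 4 keep the total under \<epsilon>.\<close>
  define \<delta>1 where "\<delta>1 = \<epsilon> ^ 3 / 128"
  define \<delta>2 where "\<delta>2 = sqrt (\<epsilon> ^ 3 / (128 * t))"
  define \<delta> where "\<delta> = \<epsilon> ^ 3 / 32"
  have \<delta>1: "0 < \<delta>1" and \<delta>2: "0 < \<delta>2" and \<delta>_nn: "0 \<le> \<delta>" using \<epsilon> t by (auto simp: \<delta>1_def \<delta>2_def \<delta>_def)
  have \<delta>_sum: "2 * \<delta>1 + 2 * \<delta>2\<^sup>2 * t = \<delta>" using \<epsilon> t by (simp add: \<delta>1_def \<delta>2_def \<delta>_def)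
  have \<epsilon>4: "0 < \<epsilon> / 4" "0 < \<epsilon> / 2" using \<epsilon> by auto
  let ?G = "\<lambda>k s \<omega>. elementary_process (nn k) (p k) (\<xi> k) s \<omega>"
  let ?I = "\<lambda>k \<omega>. \<integral>\<^sup>+s\<in>{0..t}. ennreal ((?G k s \<omega> - H s \<omega>)\<^sup>2) \<partial>lborel"
  have "\<forall>\<^sub>F k in sequentially. prob {\<omega> \<in> space M. ?I k \<omega> > ennreal \<delta>1} < \<epsilon> / 4 \<and>
     prob {\<omega> \<in> space M. \<bar>elementary_integral W (nn k) (p k) (\<xi> k) t \<omega> - J \<omega>\<bar> > \<epsilon> / 2} < \<epsilon> / 4"
    by (intro eventually_conj order_tendstoD(2)[OF L1[OF \<delta>1]] order_tendstoD(2)[OF L2[OF \<epsilon>4(2)]] \<epsilon>4)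
  from eventually_happens'[OF sequentially_bot this] obtain k where k: "prob {\<omega> \<in> space M. ?I k \<omega> > ennreal \<delta>1} < \<epsilon> / 4"
     "prob {\<omega> \<in> space M. \<bar>elementary_integral W (nn k) (p k) (\<xi> k) t \<omega> - J \<omega>\<bar> > \<epsilon> / 2} < \<epsilon> / 4"
    by blast
  obtain m where m: "prob {\<omega>\<in>space M. osc t \<delta>2 m \<omega>} < \<epsilon> / 4"
    using eventually_happens'[OF sequentially_bot order_tendstoD(2)[OF osc_prob[OF t \<delta>2] \<epsilon>4(1)]] by blast
  \<comment> \<open>One more than in the scale of \<open>osc\<close>: the mesh bound is weak, the
    distance in \<open>osc\<close> is strict.\<close>
  have mesh_pos: "0 < 1 / real (Suc (Suc m))" by simp
  obtain n q \<eta> where \<eta>: "adapted_step M F n q \<eta>" and q0: "q 0 = 0" and qn: "q n = t"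
    and mesh: "\<And>j. j < n \<Longrightarrow> q (Suc j) - q j \<le> 1 / real (Suc (Suc m))"
    and int: "\<And>\<omega>. elementary_integral W (nn k) (p k) (\<xi> k) t \<omega> = increment_sum W q \<eta> n \<omega>"
    and proc: "\<And>j s \<omega>. j < n \<Longrightarrow> q j < s \<Longrightarrow> s \<le> q (Suc j) \<Longrightarrow> ?G k s \<omega> = \<eta> j \<omega>"
    using elementary_integrand_refine[OF wiener_axioms el[of k] t mesh_pos] by metis
  let ?h = "\<lambda>j. hN N (q j)"
  have q_nn: "0 \<le> q j" "q j \<le> t" if "j \<le> n" for j
    using adapted_step_mono[OF \<eta>, of 0 j] adapted_step_mono[OF \<eta>, of j n] q0 qn that by auto
  have q_less: "q j < q (Suc j)" if "j < n" for j using \<eta> that by (simp add: adapted_step_def)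
  have h: "adapted_step M F n q ?h"
    unfolding adapted_step_def
  proof (intro conjI allI impI)
    fix j assume j: "j < n"
    show "hN N (q j) \<in> borel_measurable (F (q j))" using q_nn[of j] j by (intro hN_adapted) auto
    have "\<forall>\<omega>\<in>space M. \<bar>hN N (q j) \<omega>\<bar> \<le> \<bar>\<sigma>0\<bar> + (\<bar>\<sigma>1\<bar> + \<bar>\<sigma>2\<bar>) * \<bar>max N (BC_norm \<phi>)\<bar>"
      using q_nn[of j] j by (intro ballI hN_bound) auto
    then show "\<exists>B. \<forall>\<omega>\<in>space M. \<bar>hN N (q j) \<omega>\<bar> \<le> B" ..
  qed (use q_less q0 in auto)
  define d where "d j \<omega> = \<eta> j \<omega> - hN N (q j) \<omega>" for j \<omega>
  have d: "adapted_step M F n q d"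
    unfolding adapted_step_def
  proof (intro conjI allI impI)
    fix j assume j: "j < n"
    note \<eta>j = adapted_stepD[OF \<eta> j] and hj = adapted_stepD[OF h j]
    have m: "\<eta> j \<in> borel_measurable (F (q j))" "?h j \<in> borel_measurable (F (q j))"
      by (rule \<eta>j(1), rule hj(1))
    then show "d j \<in> borel_measurable (F (q j))" unfolding d_def[abs_def] by measurable
    obtain B B' where "\<forall>\<omega>\<in>space M. \<bar>\<eta> j \<omega>\<bar> \<le> B" "\<forall>\<omega>\<in>space M. \<bar>?h j \<omega>\<bar> \<le> B'"
      using \<eta>j(2) hj(2) by blast
    then have "\<bar>d j \<omega>\<bar> \<le> B + B'" if "\<omega> \<in> space M" for \<omega>
      using that abs_triangle_ineq4[of "\<eta> j \<omega>" "?h j \<omega>"] unfolding d_def by fastforce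
    then show "\<exists>B. \<forall>\<omega>\<in>space M. \<bar>d j \<omega>\<bar> \<le> B" by blast
  qed (use q_less q0 in auto)
  have small: "(\<Sum>j<n. (d j \<omega>)\<^sup>2 * (q (Suc j) - q j)) \<le> \<delta>"
    if \<omega>: "\<omega> \<in> space M" and bel: "below N t \<omega>" and no: "\<not> osc t \<delta>2 m \<omega>" and I: "?I k \<omega> \<le> ennreal \<delta>1" for \<omega>
  proof -
    let ?f = "\<lambda>s. 2 * ennreal ((?G k s \<omega> - H s \<omega>)\<^sup>2) + ennreal (2 * \<delta>2\<^sup>2)"
    have [measurable]: "?f \<in> borel_measurable lborel"
    proof -
      have [measurable]: "(\<lambda>s. H s \<omega>) \<in> borel_measurable borel"
        by (rule borel_measurable_continuous_onI[OF H_cont[OF \<omega>]])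
      have [measurable]: "(\<lambda>s. ?G k s \<omega>) \<in> borel_measurable borel"
        unfolding elementary_process_def by measurable
      show ?thesis by measurable
    qed
    have "ennreal (\<Sum>j<n. (d j \<omega>)\<^sup>2 * (q (Suc j) - q j)) = (\<Sum>j<n. ennreal ((d j \<omega>)\<^sup>2) * ennreal (q (Suc j) - q j))"
      using q_less by (subst sum_ennreal[symmetric]) (auto simp: ennreal_mult less_imp_le)
    also have "\<dots> = (\<Sum>j<n. \<integral>\<^sup>+s. ennreal ((d j \<omega>)\<^sup>2) * indicator {q j<..q (Suc j)} s \<partial>lborel)"
      using q_less by (intro sum.cong refl) (simp add: nn_integral_cmult_indicator less_imp_le)
    also have "\<dots> \<le> (\<Sum>j<n. \<integral>\<^sup>+s. ?f s * indicator {q j<..q (Suc j)} s \<partial>lborel)"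
    proof (intro sum_mono nn_integral_mono)
      fix j s assume "j \<in> {..<n}"
      then have j: "j < n" by simp
      show "ennreal ((d j \<omega>)\<^sup>2) * indicator {q j<..q (Suc j)} s \<le> ?f s * indicator {q j<..q (Suc j)} s"
      proof (cases "s \<in> {q j<..q (Suc j)}")
        case True
        have st: "s \<in> {0..t}" "q j \<in> {0..t}" using True q_nn[of j] q_nn[of "Suc j"] j by auto
        have "\<bar>s - q j\<bar> \<le> 1 / real (Suc (Suc m))" using True mesh[OF j] by simp
        also have "\<dots> < 1 / real (Suc m)" by (simp add: frac_less2)
        finally have Hd: "\<bar>H s \<omega> - H (q j) \<omega>\<bar> \<le> \<delta>2" by (intro not_osc[OF \<omega> t no st])
        have "hN N (q j) \<omega> = H (q j) \<omega>"
          using below_mono[OF \<omega>, of "q j" t N] bel st by (simp add: hN_def)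
        then have "d j \<omega> = (?G k s \<omega> - H s \<omega>) + (H s \<omega> - H (q j) \<omega>)"
          using proc[OF j, of s \<omega>] True by (simp add: d_def)
        then have "(d j \<omega>)\<^sup>2 \<le> 2 * (?G k s \<omega> - H s \<omega>)\<^sup>2 + 2 * (H s \<omega> - H (q j) \<omega>)\<^sup>2"
          by (simp only: power2_sum_le)
        also have "(H s \<omega> - H (q j) \<omega>)\<^sup>2 \<le> \<delta>2\<^sup>2"
          using power_mono[OF Hd, of 2] by simp
        finally have "ennreal ((d j \<omega>)\<^sup>2) \<le> ennreal (2 * (?G k s \<omega> - H s \<omega>)\<^sup>2 + 2 * \<delta>2\<^sup>2)"
          by (intro ennreal_leI) auto
        also have "\<dots> = ?f s" by (simp add: ennreal_plus ennreal_mult)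
        finally show ?thesis using True by simp
      qed simp
    qed
    also have "\<dots> = (\<integral>\<^sup>+s. (\<Sum>j<n. ?f s * indicator {q j<..q (Suc j)} s) \<partial>lborel)"
      by (subst nn_integral_sum) auto
    also have "\<dots> = (\<integral>\<^sup>+s. ?f s * indicator {0<..t} s \<partial>lborel)"
    proof (intro nn_integral_cong)
      fix s
      have "(\<Sum>j<n. indicator {q j<..q (Suc j)} s :: ennreal) = indicator {0<..t} s"
        using sum_indicator_steps[of n q s] q_less q0 qn by simp
      then show "(\<Sum>j<n. ?f s * indicator {q j<..q (Suc j)} s) = ?f s * indicator {0<..t} s"
        by (simp only: sum_distrib_left[symmetric])
    qed
    also have "\<dots> \<le> (\<integral>\<^sup>+s. ?f s * indicator {0..t} s \<partial>lborel)"
      by (intro nn_integral_mono) (auto simp: indicator_def)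
    also have "\<dots> = (\<integral>\<^sup>+s. 2 * (ennreal ((?G k s \<omega> - H s \<omega>)\<^sup>2) * indicator {0..t} s) + ennreal (2 * \<delta>2\<^sup>2) * indicator {0..t} s \<partial>lborel)"
      by (simp add: distrib_right mult.assoc)
    also have "\<dots> = 2 * ?I k \<omega> + ennreal (2 * \<delta>2\<^sup>2) * ennreal t"
    proof -
      have [measurable]: "(\<lambda>s. H s \<omega>) \<in> borel_measurable borel"
        by (rule borel_measurable_continuous_onI[OF H_cont[OF \<omega>]])
      have [measurable]: "(\<lambda>s. ?G k s \<omega>) \<in> borel_measurable borel"
        unfolding elementary_process_def by measurable
      show ?thesis using t
        by (subst nn_integral_add) (auto simp: nn_integral_cmult nn_integral_cmult_indicator)
    qed
    also have "\<dots> \<le> 2 * ennreal \<delta>1 + ennreal (2 * \<delta>2\<^sup>2) * ennreal t"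
      using I by (intro add_right_mono mult_left_mono) auto
    also have "\<dots> = ennreal \<delta>"
      using \<delta>1 t unfolding \<delta>_sum[symmetric] by (simp add: ennreal_plus ennreal_mult)
    finally show ?thesis using \<delta>_nn by (simp add: ennreal_le_iff)
  qed
  have [measurable]: "\<xi> k i \<in> borel_measurable M" if "i < nn k" for i
  proof -
    have "\<xi> k i \<in> borel_measurable (F (p k i))" using el[of k] that by (simp add: elementary_integrand_def)
    then show ?thesis by (rule measurable_F)
  qed
  have [measurable]: "increment_sum W q \<eta> n \<in> borel_measurable M" "increment_sum W q d n \<in> borel_measurable M" "increment_sum W q ?h n \<in> borel_measurable M"
    by (rule measurable_F[OF increment_sum_isometry(1)[OF \<eta>]], rule measurable_F[OF increment_sum_isometry(1)[OF d]],
        rule measurable_F[OF increment_sum_isometry(1)[OF h]])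
  have [measurable]: "?I k \<in> borel_measurable M"
  proof -
    have "(\<lambda>(\<omega>, s). ?G k s \<omega>) \<in> borel_measurable (M \<Otimes>\<^sub>M lborel)"
      unfolding elementary_process_def case_prod_beta by (intro borel_measurable_sum) measurable
    then have [measurable]: "(\<lambda>p. ?G k (snd p) (fst p)) \<in> borel_measurable (M \<Otimes>\<^sub>M lborel)" by (simp add: case_prod_beta)
    have "(\<lambda>p. ennreal ((?G k (snd p) (fst p) - H (snd p) (fst p))\<^sup>2) * indicator {0..t} (snd p)) \<in> borel_measurable (M \<Otimes>\<^sub>M lborel)"
      by measurable
    then show ?thesis by (intro lborel.borel_measurable_nn_integral) (simp add: case_prod_beta)
  qed
  have [measurable]: "d j \<in> borel_measurable M" if "j < n" for j
    by (rule measurable_F[OF adapted_stepD(1)[OF d that]])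
  \<comment> \<open>The exceptional events: poor approximation of \<open>H\<close>, poor
    approximation of \<open>J\<close>, a rough path, and a large sum despite a small quadratic sum.
    Off all four, on \<open>below N t\<close>, the triangle inequality gives a distance of at most
    \<epsilon>.\<close>
  define S1 where "S1 = {\<omega> \<in> space M. ?I k \<omega> > ennreal \<delta>1}"
  define S2 where "S2 = {\<omega> \<in> space M. \<bar>increment_sum W q \<eta> n \<omega> - J \<omega>\<bar> > \<epsilon> / 2}"
  define S3 where "S3 = {\<omega> \<in> space M. osc t \<delta>2 m \<omega>}"
  define S4 where "S4 = {\<omega> \<in> space M. (\<Sum>j<n. (d j \<omega>)\<^sup>2 * (q (Suc j) - q j)) \<le> \<delta> \<and> \<epsilon> / 2 \<le> \<bar>increment_sum W q d n \<omega>\<bar>}"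
  let ?S = "{\<omega>\<in>space M. below N t \<omega> \<and> \<epsilon> < \<bar>increment_sum W q ?h n \<omega> - J \<omega>\<bar>}"
  have ev: "S1 \<in> events" "S2 \<in> events" "S3 \<in> events" "S4 \<in> events"
    unfolding S1_def S2_def S3_def S4_def by measurable
  have sub: "?S \<subseteq> S1 \<union> (S2 \<union> (S3 \<union> S4))"
  proof (rule ccontr)
    assume "\<not> ?thesis"
    then obtain \<omega> where \<omega>: "\<omega> \<in> space M" "below N t \<omega>" "\<epsilon> < \<bar>increment_sum W q ?h n \<omega> - J \<omega>\<bar>"
      "\<omega> \<notin> S1" "\<omega> \<notin> S2" "\<omega> \<notin> S3" "\<omega> \<notin> S4" by auto
    have "(\<Sum>j<n. (d j \<omega>)\<^sup>2 * (q (Suc j) - q j)) \<le> \<delta>"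
      using \<omega> by (intro small) (auto simp: S1_def S3_def)
    moreover have "increment_sum W q d n \<omega> = increment_sum W q \<eta> n \<omega> - increment_sum W q ?h n \<omega>"
      by (simp add: increment_sum_def d_def left_diff_distrib sum_subtractf)
    moreover have "\<bar>increment_sum W q \<eta> n \<omega> - J \<omega>\<bar> \<le> \<epsilon> / 2" using \<omega> by (auto simp: S2_def)
    ultimately have "(\<Sum>j<n. (d j \<omega>)\<^sup>2 * (q (Suc j) - q j)) \<le> \<delta>" "\<epsilon> / 2 \<le> \<bar>increment_sum W q d n \<omega>\<bar>"
      using \<omega>(3) by linarith+
    then have "\<omega> \<in> S4" using \<omega>(1) unfolding S4_def by simp
    then show False using \<omega> by simp
  qed
  have "prob ?S \<le> prob (S1 \<union> (S2 \<union> (S3 \<union> S4)))"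
    using ev by (intro finite_measure_mono[OF sub]) auto
  also have "\<dots> \<le> prob S1 + (prob S2 + (prob S3 + prob S4))"
    by (intro order_trans[OF measure_Un_le] add_left_mono sets.Un ev order_refl)
  finally have tot: "prob ?S \<le> prob S1 + (prob S2 + (prob S3 + prob S4))" .
  have "prob S4 \<le> \<delta> / (\<epsilon> / 2)\<^sup>2"
    by (rule increment_sum_tail[OF d \<epsilon>4(2) _ \<delta>_nn]) (auto simp: S4_def)
  also have "\<delta> / (\<epsilon> / 2)\<^sup>2 = \<epsilon> / 8" using \<epsilon> by (simp add: \<delta>_def power2_eq_square power3_eq_cube)
  finally have S4: "prob S4 \<le> \<epsilon> / 8" .
  have "prob S1 < \<epsilon> / 4" "prob S2 < \<epsilon> / 4" "prob S3 < \<epsilon> / 4"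
    using k m by (simp_all only: S1_def S2_def S3_def int)
  then have "prob ?S \<le> \<epsilon>" using tot S4 \<epsilon> by linarith
  then show thesis using that[OF h q0 qn] by blast
qed

end

section \<open>Second moments of the solution\<close>

lemma nn_integral_limit_le:
  assumes [measurable]: "\<And>n. u n \<in> borel_measurable M"
    and lim: "\<And>x. x \<in> space M \<Longrightarrow> (\<lambda>n. u n x) \<longlonglongrightarrow> f x" and le: "\<And>n::nat. (\<integral>\<^sup>+x. u n x \<partial>M) \<le> C"
  shows "(\<integral>\<^sup>+x. f x \<partial>M) \<le> (C::ennreal)"
proof -
  have "(\<integral>\<^sup>+x. f x \<partial>M) = (\<integral>\<^sup>+x. liminf (\<lambda>n. u n x) \<partial>M)"
    by (intro nn_integral_cong) (simp add: lim_imp_Liminf[OF _ lim])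
  also have "\<dots> \<le> liminf (\<lambda>n. \<integral>\<^sup>+x. u n x \<partial>M)"
    by (rule nn_integral_liminf) simp
  also have "\<dots> \<le> liminf (\<lambda>n::nat. C)"
    by (rule Liminf_mono) (simp add: le)
  also have "\<dots> = C" by (simp add: Liminf_const)
  finally show ?thesis .
qed

text \<open>Cauchy-Schwarz for the weight \<open>w\<close>: the weighted variance of
  \<open>f\<close> about its mean \<open>?m / c\<close> is nonnegative.\<close>

lemma weighted_square_le:
  fixes w f :: "'a \<Rightarrow> real"
  assumes w: "integrable M w" "\<And>x. x \<in> space M \<Longrightarrow> 0 \<le> w x" and W: "(LINT x|M. w x) = c" "0 < c"
    and wf: "integrable M (\<lambda>x. w x * f x)" "integrable M (\<lambda>x. w x * (f x)\<^sup>2)"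
  shows "(LINT x|M. w x * f x)\<^sup>2 \<le> c * (LINT x|M. w x * (f x)\<^sup>2)"
proof -
  let ?m = "LINT x|M. w x * f x"
  have "0 \<le> (LINT x|M. w x * (f x - ?m / c)\<^sup>2)"
    using w by (intro Bochner_Integration.integral_nonneg) auto
  also have "\<dots> = (LINT x|M. w x * (f x)\<^sup>2 - (2 * ?m / c) * (w x * f x) + (?m / c)\<^sup>2 * w x)"
    by (intro Bochner_Integration.integral_cong refl) (simp add: power2_eq_square algebra_simps)
  also have "\<dots> = (LINT x|M. w x * (f x)\<^sup>2) - (2 * ?m / c) * ?m + (?m / c)\<^sup>2 * c"
    using w wf W(1) by simp
  also have "\<dots> = (LINT x|M. w x * (f x)\<^sup>2) - ?m\<^sup>2 / c"
    using W(2) by (simp add: power2_eq_square field_simps)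
  finally show ?thesis using W(2) by (simp add: field_simps)
qed

text \<open>A left-endpoint sum of an increasing function stays below its integral; termwise this is
  1 + r <= exp r.\<close>

lemma sum_exp_steps_le:
  fixes \<beta> :: real
  assumes \<beta>: "0 < \<beta>"
  shows "(\<Sum>j<n. exp (\<beta> * q j) * (q (Suc j) - q j)) \<le> exp (\<beta> * q n) / \<beta>"
proof -
  have "exp (\<beta> * q j) * (q (Suc j) - q j) \<le> exp (\<beta> * q (Suc j)) / \<beta> - exp (\<beta> * q j) / \<beta>" for j
  proof -
    have "1 + \<beta> * (q (Suc j) - q j) \<le> exp (\<beta> * (q (Suc j) - q j))" by (rule exp_ge_add_one_self)
    then have "exp (\<beta> * q j) * (\<beta> * (q (Suc j) - q j)) \<le> exp (\<beta> * q j) * (exp (\<beta> * (q (Suc j) - q j)) - 1)"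
      by (intro mult_left_mono) (linarith, simp)
    also have "\<dots> = exp (\<beta> * q (Suc j)) - exp (\<beta> * q j)"
      by (simp add: right_diff_distrib flip: exp_add)
    finally show ?thesis using \<beta> by (simp add: field_simps)
  qed
  then have "(\<Sum>j<n. exp (\<beta> * q j) * (q (Suc j) - q j)) \<le> (\<Sum>j<n. exp (\<beta> * q (Suc j)) / \<beta> - exp (\<beta> * q j) / \<beta>)"
    by (intro sum_mono)
  also have "\<dots> = exp (\<beta> * q n) / \<beta> - exp (\<beta> * q 0) / \<beta>" by (rule sum_lessThan_telescope)
  also have "\<dots> \<le> exp (\<beta> * q n) / \<beta>" using \<beta> by simp
  finally show ?thesis .
qed

lemma power2_sum3_le: "(u + v + w)\<^sup>2 \<le> 3 * u\<^sup>2 + 3 * v\<^sup>2 + 3 * w\<^sup>2" for u v w :: real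
  using sum_squares_bound[of u v] sum_squares_bound[of u w] sum_squares_bound[of v w]
  by (simp add: power2_eq_square algebra_simps)

section \<open>Moments of the truncated solution\<close>

context sde_solution
begin

abbreviation "B0 \<equiv> BC_norm \<phi>"

lemma B0: "0 \<le> B0" by (rule BC_norm_nonneg[OF \<phi>])

text \<open>Zero at negative times, where the initial function is accounted for separately by
  \<open>B0\<close>.\<close>

definition xN where "xN N s \<omega> = (if 0 \<le> s \<and> below N s \<omega> then x s \<omega> else 0)"

lemma xN_joint2[measurable]:
  assumes [measurable]: "f \<in> measurable L borel" "g \<in> measurable L M"
  shows "(\<lambda>z. xN N (f z) (g z)) \<in> borel_measurable L"
proof -
  have [measurable]: "(\<lambda>z. x (f z) (g z)) \<in> borel_measurable L" by (rule x_joint2) fact+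
  have [measurable]: "Measurable.pred L (\<lambda>z. below N (f z) (g z))" by (rule below_joint2) fact+
  show ?thesis unfolding xN_def by measurable
qed

lemma xN_bound: "\<omega> \<in> space M \<Longrightarrow> 0 \<le> N \<Longrightarrow> \<bar>xN N s \<omega>\<bar> \<le> N"
  using below_iff[of \<omega> s N] by (auto simp: xN_def)

text \<open>Jensen's inequality for the density \<open>k\<close>. The past splits at time 0: before
  it |x| <= B0; after it \<open>below N s\<close> entails \<open>below\<close> at every earlier
  time, so \<open>x\<close> equals \<open>xN\<close>.\<close>

lemma y_square_le:
  assumes \<omega>: "\<omega> \<in> space M" and s: "0 \<le> s" and bel: "below N s \<omega>"
  shows "ennreal ((y s \<omega>)\<^sup>2) \<le> (\<integral>\<^sup>+u. ennreal (k u) * (ennreal (B0\<^sup>2) + ennreal ((xN N (s - u) \<omega>)\<^sup>2)) \<partial>lborel)"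
proof -
  have [measurable]: "(\<lambda>t. x t \<omega>) \<in> borel_measurable borel"
    by (rule borel_measurable_continuous_onI[OF x_cont[OF \<omega>]])
  have bd: "\<bar>x r \<omega>\<bar> \<le> max N B0" if "r \<le> s" for r by (rule below_bound[OF \<omega> s bel that])
  have ku: "k u * (x (s - u) \<omega>)\<^sup>2 \<le> k u * (max N B0)\<^sup>2" for u
  proof (cases "u < 0")
    case False
    then show ?thesis using power_mono[OF bd[of "s - u"], of 2] k(3)[of u] by (intro mult_left_mono) auto
  qed (simp add: k(4))
  have I2: "integrable lborel (\<lambda>u. k u * (x (s - u) \<omega>)\<^sup>2)"
  proof (rule Bochner_Integration.integrable_bound)
    show "integrable lborel (\<lambda>u. k u * (max N B0)\<^sup>2)" using k(1) by simp
    show "AE u in lborel. norm (k u * (x (s - u) \<omega>)\<^sup>2) \<le> norm (k u * (max N B0)\<^sup>2)"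
    proof (rule AE_I2)
      fix u show "norm (k u * (x (s - u) \<omega>)\<^sup>2) \<le> norm (k u * (max N B0)\<^sup>2)"
        using ku[of u] k(3)[of u] by simp
    qed
  qed measurable
  have "(y s \<omega>)\<^sup>2 \<le> 1 * (LINT u|lborel. k u * (x (s - u) \<omega>)\<^sup>2)"
    unfolding y_eq using k y_bound(2)[OF \<omega> bd] I2 by (intro weighted_square_le) auto
  then have "ennreal ((y s \<omega>)\<^sup>2) \<le> ennreal (LINT u|lborel. k u * (x (s - u) \<omega>)\<^sup>2)" by (simp add: ennreal_leI)
  also have "\<dots> = (\<integral>\<^sup>+u. ennreal (k u * (x (s - u) \<omega>)\<^sup>2) \<partial>lborel)"
    using k(3) by (intro nn_integral_eq_integral[symmetric] I2) auto
  also have "\<dots> \<le> (\<integral>\<^sup>+u. ennreal (k u) * (ennreal (B0\<^sup>2) + ennreal ((xN N (s - u) \<omega>)\<^sup>2)) \<partial>lborel)"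
  proof (rule nn_integral_mono)
    fix u :: real
    have "k u * (x (s - u) \<omega>)\<^sup>2 \<le> k u * (B0\<^sup>2 + (xN N (s - u) \<omega>)\<^sup>2)"
    proof (cases "u < 0")
      case False
      show ?thesis
      proof (intro mult_left_mono k(3))
        show "(x (s - u) \<omega>)\<^sup>2 \<le> B0\<^sup>2 + (xN N (s - u) \<omega>)\<^sup>2"
        proof (cases "0 \<le> s - u")
          case True
          then have "below N (s - u) \<omega>" using below_mono[OF \<omega> True _ bel] False by simp
          then show ?thesis using True by (simp add: xN_def)
        next
          case False
          then have "\<bar>x (s - u) \<omega>\<bar> \<le> B0" using BC_norm_upper[OF \<phi>, of "s - u"] x_neg[OF \<omega>, of "s - u"] by simp
          from power_mono[OF this, of 2] show ?thesis by (simp add: add_increasing2)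
        qed
      qed
    qed (simp add: k(4))
    then show "ennreal (k u * (x (s - u) \<omega>)\<^sup>2) \<le> ennreal (k u) * (ennreal (B0\<^sup>2) + ennreal ((xN N (s - u) \<omega>)\<^sup>2))"
      using k(3) by (simp add: ennreal_leI flip: ennreal_mult ennreal_plus)
  qed
  finally show ?thesis .
qed

text \<open>Tonelli exchanges the average over the delays with the expectation. As \<beta> >= 0,
  each delayed moment is at most the bound V exp (\<beta> s) of the present time.\<close>

lemma y_moment_le:
  assumes s: "s \<in> {0..T}" and V: "0 \<le> V" "0 \<le> \<beta>"
    and v: "\<And>r. r \<in> {0..T} \<Longrightarrow> (\<integral>\<^sup>+\<omega>. ennreal ((xN N r \<omega>)\<^sup>2) \<partial>M) \<le> ennreal (V * exp (\<beta> * r))"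
  shows "(\<integral>\<^sup>+\<omega>. (if below N s \<omega> then ennreal ((y s \<omega>)\<^sup>2) else 0) \<partial>M) \<le> ennreal (B0\<^sup>2 + V * exp (\<beta> * s))"
proof -
  have [measurable]: "(\<lambda>(\<omega>, u). xN N (s - u) \<omega>) \<in> borel_measurable (M \<Otimes>\<^sub>M lborel)"
    unfolding case_prod_beta by (rule xN_joint2) measurable
  interpret p: pair_sigma_finite M lborel ..
  have "(\<integral>\<^sup>+\<omega>. (if below N s \<omega> then ennreal ((y s \<omega>)\<^sup>2) else 0) \<partial>M)
    \<le> (\<integral>\<^sup>+\<omega>. \<integral>\<^sup>+u. ennreal (k u) * (ennreal (B0\<^sup>2) + ennreal ((xN N (s - u) \<omega>)\<^sup>2)) \<partial>lborel \<partial>M)"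
    using s by (intro nn_integral_mono) (auto intro: y_square_le)
  also have "\<dots> = (\<integral>\<^sup>+u. \<integral>\<^sup>+\<omega>. ennreal (k u) * (ennreal (B0\<^sup>2) + ennreal ((xN N (s - u) \<omega>)\<^sup>2)) \<partial>M \<partial>lborel)"
    by (rule p.Fubini'[symmetric]) measurable
  also have "\<dots> = (\<integral>\<^sup>+u. ennreal (k u) * (ennreal (B0\<^sup>2) + (\<integral>\<^sup>+\<omega>. ennreal ((xN N (s - u) \<omega>)\<^sup>2) \<partial>M)) \<partial>lborel)"
  proof (intro nn_integral_cong)
    fix u
    have [measurable]: "(\<lambda>\<omega>. xN N (s - u) \<omega>) \<in> borel_measurable M" by (rule xN_joint2) measurable
    show "(\<integral>\<^sup>+\<omega>. ennreal (k u) * (ennreal (B0\<^sup>2) + ennreal ((xN N (s - u) \<omega>)\<^sup>2)) \<partial>M) = ennreal (k u) * (ennreal (B0\<^sup>2) + (\<integral>\<^sup>+\<omega>. ennreal ((xN N (s - u) \<omega>)\<^sup>2) \<partial>M))"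
      by (subst nn_integral_cmult, measurable, subst nn_integral_add) (auto simp: emeasure_space_1)
  qed
  also have "\<dots> \<le> (\<integral>\<^sup>+u. ennreal (k u) * ennreal (B0\<^sup>2 + V * exp (\<beta> * s)) \<partial>lborel)"
  proof (rule nn_integral_mono)
    fix u :: real
    show "ennreal (k u) * (ennreal (B0\<^sup>2) + (\<integral>\<^sup>+\<omega>. ennreal ((xN N (s - u) \<omega>)\<^sup>2) \<partial>M)) \<le> ennreal (k u) * ennreal (B0\<^sup>2 + V * exp (\<beta> * s))"
    proof (cases "u < 0")
      case False
      have "(\<integral>\<^sup>+\<omega>. ennreal ((xN N (s - u) \<omega>)\<^sup>2) \<partial>M) \<le> ennreal (V * exp (\<beta> * s))"
      proof (cases "0 \<le> s - u")
        case True
        then have "(\<integral>\<^sup>+\<omega>. ennreal ((xN N (s - u) \<omega>)\<^sup>2) \<partial>M) \<le> ennreal (V * exp (\<beta> * (s - u)))"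
          using s False by (intro v) auto
        also have "\<dots> \<le> ennreal (V * exp (\<beta> * s))"
          using V False by (intro ennreal_leI mult_left_mono) (auto intro!: mult_left_mono)
        finally show ?thesis .
      qed (simp add: xN_def)
      then show ?thesis using V by (subst ennreal_plus) (auto intro!: mult_left_mono add_left_mono)
    qed (simp add: k(4))
  qed
  also have "\<dots> = ennreal (B0\<^sup>2 + V * exp (\<beta> * s))"
  proof -
    have "(\<integral>\<^sup>+u. ennreal (k u) \<partial>lborel) = 1"
      using nn_integral_eq_integral[OF k(1)] k(2,3) by simp
    then show ?thesis by (simp add: nn_integral_multc)
  qed
  finally show ?thesis .
qed

text \<open>The coefficients are free so that one estimate covers the diffusion (\<sigma>0,
  \<sigma>1, \<sigma>2) and the drift (0, a, b).\<close>

lemma linear_moment_le: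
  assumes s: "s \<in> {0..T}" and V: "0 \<le> V" "0 \<le> \<beta>"
    and v: "\<And>r. r \<in> {0..T} \<Longrightarrow> (\<integral>\<^sup>+\<omega>. ennreal ((xN N r \<omega>)\<^sup>2) \<partial>M) \<le> ennreal (V * exp (\<beta> * r))"
  shows "(\<integral>\<^sup>+\<omega>. (if below N s \<omega> then ennreal ((c0 + c1 * x s \<omega> + c2 * y s \<omega>)\<^sup>2) else 0) \<partial>M)
    \<le> ennreal (3 * c0\<^sup>2 + 3 * c2\<^sup>2 * B0\<^sup>2 + 3 * (c1\<^sup>2 + c2\<^sup>2) * (V * exp (\<beta> * s)))"
proof -
  have [measurable]: "(\<lambda>\<omega>. xN N s \<omega>) \<in> borel_measurable M" by (rule xN_joint2) measurable
  have [measurable]: "(\<lambda>\<omega>. y s \<omega>) \<in> borel_measurable M" by (rule y_joint2) measurable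
  have [measurable]: "Measurable.pred M (\<lambda>\<omega>. below N s \<omega>)" by (rule below_joint2) measurable
  have "(\<integral>\<^sup>+\<omega>. (if below N s \<omega> then ennreal ((c0 + c1 * x s \<omega> + c2 * y s \<omega>)\<^sup>2) else 0) \<partial>M)
    \<le> (\<integral>\<^sup>+\<omega>. ennreal (3 * c0\<^sup>2) + (ennreal (3 * c1\<^sup>2) * ennreal ((xN N s \<omega>)\<^sup>2)
       + ennreal (3 * c2\<^sup>2) * (if below N s \<omega> then ennreal ((y s \<omega>)\<^sup>2) else 0)) \<partial>M)"
  proof (rule nn_integral_mono)
    fix \<omega>
    show "(if below N s \<omega> then ennreal ((c0 + c1 * x s \<omega> + c2 * y s \<omega>)\<^sup>2) else 0)
      \<le> ennreal (3 * c0\<^sup>2) + (ennreal (3 * c1\<^sup>2) * ennreal ((xN N s \<omega>)\<^sup>2)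
       + ennreal (3 * c2\<^sup>2) * (if below N s \<omega> then ennreal ((y s \<omega>)\<^sup>2) else 0))"
    proof (cases "below N s \<omega>")
      case True
      then have xs: "xN N s \<omega> = x s \<omega>" using s by (simp add: xN_def)
      have "(c0 + c1 * x s \<omega> + c2 * y s \<omega>)\<^sup>2 \<le> 3 * c0\<^sup>2 + (3 * c1\<^sup>2 * (x s \<omega>)\<^sup>2 + 3 * c2\<^sup>2 * (y s \<omega>)\<^sup>2)"
        using power2_sum3_le[of c0 "c1 * x s \<omega>" "c2 * y s \<omega>"] by (simp add: power_mult_distrib)
      then have "ennreal ((c0 + c1 * x s \<omega> + c2 * y s \<omega>)\<^sup>2) \<le> ennreal (3 * c0\<^sup>2 + (3 * c1\<^sup>2 * (x s \<omega>)\<^sup>2 + 3 * c2\<^sup>2 * (y s \<omega>)\<^sup>2))"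
        by (rule ennreal_leI)
      also have "\<dots> = ennreal (3 * c0\<^sup>2) + (ennreal (3 * c1\<^sup>2) * ennreal ((x s \<omega>)\<^sup>2) + ennreal (3 * c2\<^sup>2) * ennreal ((y s \<omega>)\<^sup>2))"
        by (simp add: ennreal_plus ennreal_mult)
      finally show ?thesis using True xs by simp
    qed simp
  qed
  also have "\<dots> = ennreal (3 * c0\<^sup>2) + (ennreal (3 * c1\<^sup>2) * (\<integral>\<^sup>+\<omega>. ennreal ((xN N s \<omega>)\<^sup>2) \<partial>M)
       + ennreal (3 * c2\<^sup>2) * (\<integral>\<^sup>+\<omega>. (if below N s \<omega> then ennreal ((y s \<omega>)\<^sup>2) else 0) \<partial>M))"
    by (subst nn_integral_add, measurable, subst nn_integral_add, measurable, subst nn_integral_cmult, measurable, subst nn_integral_cmult)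
      (auto simp: emeasure_space_1)
  also have "\<dots> \<le> ennreal (3 * c0\<^sup>2) + (ennreal (3 * c1\<^sup>2) * ennreal (V * exp (\<beta> * s)) + ennreal (3 * c2\<^sup>2) * ennreal (B0\<^sup>2 + V * exp (\<beta> * s)))"
    using v[OF s] y_moment_le[OF s V v] by (intro add_left_mono add_mono mult_left_mono) auto
  also have "\<dots> = ennreal (3 * c0\<^sup>2 + (3 * c1\<^sup>2 * (V * exp (\<beta> * s)) + 3 * c2\<^sup>2 * (B0\<^sup>2 + V * exp (\<beta> * s))))"
    using V by (simp add: ennreal_plus ennreal_mult)
  also have "3 * c0\<^sup>2 + (3 * c1\<^sup>2 * (V * exp (\<beta> * s)) + 3 * c2\<^sup>2 * (B0\<^sup>2 + V * exp (\<beta> * s)))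
     = 3 * c0\<^sup>2 + 3 * c2\<^sup>2 * B0\<^sup>2 + 3 * (c1\<^sup>2 + c2\<^sup>2) * (V * exp (\<beta> * s))" by (simp add: algebra_simps)
  finally show ?thesis .
qed

text \<open>The integral over [0,t] of the bound in \<open>linear_moment_le\<close> for the
  diffusion, with exp (\<beta> t) / \<beta> in place of the integral of the exponential.\<close>

definition Bd where "Bd V \<beta> t = (3 * \<sigma>0\<^sup>2 + 3 * \<sigma>2\<^sup>2 * B0\<^sup>2) * t + 3 * (\<sigma>1\<^sup>2 + \<sigma>2\<^sup>2) * V * (exp (\<beta> * t) / \<beta>)"

text \<open>By the isometry the second moment is a left-endpoint sum of moments of
  \<open>hN\<close>. Such sums of the exponential stay below exp (\<beta> t) / \<beta>, so the bound
  is the same for all partitions.\<close>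

lemma increment_sum_moment_le:
  assumes q: "adapted_step M F n q (\<lambda>j. hN N (q j))" "q 0 = 0" "q n = t" and t: "t \<le> T" and V: "0 \<le> V" "0 < \<beta>"
    and v: "\<And>r. r \<in> {0..T} \<Longrightarrow> (\<integral>\<^sup>+\<omega>. ennreal ((xN N r \<omega>)\<^sup>2) \<partial>M) \<le> ennreal (V * exp (\<beta> * r))"
  shows "expectation (\<lambda>\<omega>. (increment_sum W q (\<lambda>j. hN N (q j)) n \<omega>)\<^sup>2) \<le> Bd V \<beta> t"
proof -
  let ?A = "3 * \<sigma>0\<^sup>2 + 3 * \<sigma>2\<^sup>2 * B0\<^sup>2"
  let ?B = "3 * (\<sigma>1\<^sup>2 + \<sigma>2\<^sup>2) * V"
  have qj: "0 \<le> q j" "q j \<le> t" if "j < n" for j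
    using adapted_step_mono[OF q(1), of 0 j] adapted_step_mono[OF q(1), of j n] q that by auto
  have ql: "q j < q (Suc j)" if "j < n" for j using q(1) that by (simp add: adapted_step_def)
  have "expectation (\<lambda>\<omega>. (hN N (q j) \<omega>)\<^sup>2) \<le> ?A + ?B * exp (\<beta> * q j)" if j: "j < n" for j
  proof -
    have qT: "q j \<in> {0..T}" using qj[OF j] t by simp
    have [measurable]: "hN N (q j) \<in> borel_measurable M" by (rule measurable_F[OF hN_adapted[OF qj(1)[OF j]]])
    have nn: "0 \<le> ?A + ?B * exp (\<beta> * q j)" using V by (intro add_nonneg_nonneg mult_nonneg_nonneg) auto
    have "(\<integral>\<^sup>+\<omega>. ennreal ((hN N (q j) \<omega>)\<^sup>2) \<partial>M) = (\<integral>\<^sup>+\<omega>. (if below N (q j) \<omega> then ennreal ((\<sigma>0 + \<sigma>1 * x (q j) \<omega> + \<sigma>2 * y (q j) \<omega>)\<^sup>2) else 0) \<partial>M)"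
      by (intro nn_integral_cong) (simp add: hN_def H_def)
    also have "\<dots> \<le> ennreal (?A + ?B * exp (\<beta> * q j))"
      using linear_moment_le[OF qT V(1) less_imp_le[OF V(2)] v, where ?c0.0=\<sigma>0 and ?c1.0=\<sigma>1 and ?c2.0=\<sigma>2] by (simp add: mult.assoc)
    finally have "(\<integral>\<^sup>+\<omega>. ennreal ((hN N (q j) \<omega>)\<^sup>2) \<partial>M) \<le> ennreal (?A + ?B * exp (\<beta> * q j))" .
    then show ?thesis
      using nn by (subst integral_eq_nn_integral) (auto intro: enn2real_leI)
  qed
  then have "expectation (\<lambda>\<omega>. (increment_sum W q (\<lambda>j. hN N (q j)) n \<omega>)\<^sup>2) \<le> (\<Sum>j<n. (?A + ?B * exp (\<beta> * q j)) * (q (Suc j) - q j))"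
    unfolding increment_sum_isometry(4)[OF q(1)] using ql by (intro sum_mono mult_right_mono) (auto simp: less_imp_le)
  also have "\<dots> = ?A * (\<Sum>j<n. q (Suc j) - q j) + ?B * (\<Sum>j<n. exp (\<beta> * q j) * (q (Suc j) - q j))"
    by (simp add: sum.distrib distrib_right sum_distrib_left mult.assoc)
  also have "(\<Sum>j<n. q (Suc j) - q j) = t" using q by (simp add: sum_lessThan_telescope)
  also have "?A * t + ?B * (\<Sum>j<n. exp (\<beta> * q j) * (q (Suc j) - q j)) \<le> ?A * t + ?B * (exp (\<beta> * t) / \<beta>)"
    using V sum_exp_steps_le[OF V(2), of q n] q(3) by (intro add_left_mono mult_left_mono) auto
  finally show ?thesis by (simp add: Bd_def)
qed

end

lemma real_le_of_add_mult_le: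
  fixes C :: real
  assumes "\<And>\<epsilon>. \<epsilon> > 0 \<Longrightarrow> X \<le> C + \<epsilon> * D"  and "0 \<le> D"
  shows "X \<le> (C::real)"
proof (rule field_le_epsilon)
  fix e :: real assume "0 < e"
  then have "X \<le> C + e / (D + 1) * D" using assms by (intro assms(1)) auto
  also have "e / (D + 1) * D \<le> e" using \<open>0 < e\<close> assms(2) by (simp add: field_simps)
  finally show "X \<le> C + e" by simp
qed

text \<open>Letting \<open>c\<close> tend to 0 after \<open>N\<close> to infinity takes the place of uniform integrability.\<close>

lemma abs_le_square_div: "0 < c \<Longrightarrow> \<bar>u\<bar> \<le> c * u\<^sup>2 + 1 / (4 * c)" for u c :: real
proof -
  assume c: "0 < c"
  have "0 \<le> (2 * c * \<bar>u\<bar> - 1)\<^sup>2" by simp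
  also have "\<dots> = 4 * c * (c * u\<^sup>2 + 1 / (4 * c) - \<bar>u\<bar>)"
    using c by (simp add: power2_eq_square algebra_simps abs_mult_self_eq)
  finally show ?thesis using c by (simp add: zero_le_mult_iff)
qed

lemma (in prob_space) integrable_indicator_event: "A \<in> events \<Longrightarrow> integrable M (indicator A :: 'a \<Rightarrow> real)"
  by (intro integrable_real_indicator) (auto simp: emeasure_eq_measure)

section \<open>Second moment and mean of the localised Ito integral\<close>

context sde_solution
begin

lemma below_meas[measurable]: "Measurable.pred M (below N t)"
  using below_joint2[of "\<lambda>_. t" M "\<lambda>\<omega>. \<omega>" N] by simp

lemma Bd_nonneg: "0 \<le> V \<Longrightarrow> 0 < \<beta> \<Longrightarrow> 0 \<le> t \<Longrightarrow> 0 \<le> Bd V \<beta> t"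
  unfolding Bd_def by (intro add_nonneg_nonneg mult_nonneg_nonneg) auto

context
  fixes t T V \<beta> N :: real and J :: "'a \<Rightarrow> real"
  assumes t: "0 < t" "t \<le> T" and J: "has_ito_integral M F W H t J" and V: "0 \<le> V" "0 < \<beta>"
    and v: "\<And>r. r \<in> {0..T} \<Longrightarrow> (\<integral>\<^sup>+\<omega>. ennreal ((xN N r \<omega>)\<^sup>2) \<partial>M) \<le> ennreal (V * exp (\<beta> * r))"
begin

lemma J_meas[measurable]: "J \<in> borel_measurable M"
  using J by (simp add: has_ito_integral_def)

text \<open>The sums \<open>Z\<close> have mean zero and second moments bounded independently of
  \<epsilon>, which convergence in probability alone would not give. The pair \<open>V\<close>,
  \<beta> is a provisional moment bound: the Gronwall step inserts the bound to be improved, the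
  computation of the mean the final one.\<close>

lemma ito_approximation_moments:
  assumes "0 < \<epsilon>"
  obtains Z A where "Z \<in> borel_measurable M" "A \<in> events" "integrable M (\<lambda>\<omega>. (Z \<omega>)\<^sup>2)" "expectation Z = 0"
    "expectation (\<lambda>\<omega>. (Z \<omega>)\<^sup>2) \<le> Bd V \<beta> t" "prob A \<le> \<epsilon>"
    "\<And>\<omega>. \<omega> \<in> space M \<Longrightarrow> \<omega> \<notin> A \<Longrightarrow> below N t \<omega> \<Longrightarrow> \<bar>Z \<omega> - J \<omega>\<bar> \<le> \<epsilon>"
proof -
  obtain n q where q: "adapted_step M F n q (\<lambda>j. hN N (q j))" "q 0 = 0" "q n = t"
    and p: "prob {\<omega>\<in>space M. below N t \<omega> \<and> \<epsilon> < \<bar>increment_sum W q (\<lambda>j. hN N (q j)) n \<omega> - J \<omega>\<bar>} \<le> \<epsilon>"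
    using ito_approximation[OF t(1) J assms] by blast
  note iso = increment_sum_isometry[OF q(1)]
  have Zm[measurable]: "increment_sum W q (\<lambda>j. hN N (q j)) n \<in> borel_measurable M"
    by (rule measurable_F[OF iso(1)])
  show thesis
  proof (rule that[OF Zm _ iso(2,3) increment_sum_moment_le[OF q t(2) V v] p])
    show "{\<omega>\<in>space M. below N t \<omega> \<and> \<epsilon> < \<bar>increment_sum W q (\<lambda>j. hN N (q j)) n \<omega> - J \<omega>\<bar>} \<in> events"
      by measurable
  qed auto
qed

text \<open>\<open>J\<close> is not yet known to be integrable, so |J| is cut at \<open>n\<close>:
  the exceptional event then contributes at most n^2 \<epsilon>, which vanishes with \<epsilon> for
  fixed \<open>n\<close>, and Fatou removes the cut. The factor 2 stems from (u + v)^2 <= 2 u^2 + 2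
  v^2.\<close>

lemma ito_second_moment:
  "(\<integral>\<^sup>+\<omega>. (if below N t \<omega> then ennreal ((J \<omega>)\<^sup>2) else 0) \<partial>M) \<le> ennreal (2 * Bd V \<beta> t)"
proof (rule nn_integral_limit_le)
  let ?m = "\<lambda>n \<omega>. if below N t \<omega> then (min \<bar>J \<omega>\<bar> (real n))\<^sup>2 else 0"
  have Bd: "0 \<le> Bd V \<beta> t" using Bd_nonneg V t by simp
  show "(\<lambda>\<omega>. ennreal (?m n \<omega>)) \<in> borel_measurable M" for n by measurable
  show "(\<lambda>n. ennreal (?m n \<omega>)) \<longlonglongrightarrow> (if below N t \<omega> then ennreal ((J \<omega>)\<^sup>2) else 0)" for \<omega>
  proof (rule tendsto_eventually)
    show "\<forall>\<^sub>F n in sequentially. ennreal (?m n \<omega>) = (if below N t \<omega> then ennreal ((J \<omega>)\<^sup>2) else 0)"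
      using eventually_ge_at_top[of "nat \<lceil>\<bar>J \<omega>\<bar>\<rceil>"]
    proof eventually_elim
      case (elim n)
      then have "\<bar>J \<omega>\<bar> \<le> real n" by linarith
      then show ?case by (simp add: min_absorb1)
    qed
  qed
  fix n
  have m_le: "?m n \<omega> \<le> (real n)\<^sup>2" "0 \<le> ?m n \<omega>" for \<omega> by (auto intro!: power_mono)
  have I: "integrable M (?m n)"
    by (rule integrable_const_bound[where B="(real n)\<^sup>2"]) (use m_le in auto)
  have "expectation (?m n) \<le> 2 * Bd V \<beta> t"
  proof (rule real_le_of_add_mult_le)
    show "0 \<le> 2 + (real n)\<^sup>2" by simp
    fix e :: real assume e: "0 < e"
    \<comment> \<open>At most 1, so that \<epsilon>^2 <= \<epsilon> <= e.\<close>
    define \<epsilon> where "\<epsilon> = min e 1"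
    have \<epsilon>: "0 < \<epsilon>" "\<epsilon> \<le> e" "\<epsilon> \<le> 1" using e by (auto simp: \<epsilon>_def)
    obtain Z A where ZA: "Z \<in> borel_measurable M" "A \<in> events" "integrable M (\<lambda>\<omega>. (Z \<omega>)\<^sup>2)" "expectation Z = 0"
      "expectation (\<lambda>\<omega>. (Z \<omega>)\<^sup>2) \<le> Bd V \<beta> t" "prob A \<le> \<epsilon>"
      and cl: "\<And>\<omega>. \<omega> \<in> space M \<Longrightarrow> \<omega> \<notin> A \<Longrightarrow> below N t \<omega> \<Longrightarrow> \<bar>Z \<omega> - J \<omega>\<bar> \<le> \<epsilon>"
      using ito_approximation_moments[OF \<epsilon>(1)] by blast
    have IR: "integrable M (\<lambda>\<omega>. 2 * (Z \<omega>)\<^sup>2 + 2 * \<epsilon>\<^sup>2 + (real n)\<^sup>2 * indicator A \<omega>)"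
      by (intro Bochner_Integration.integrable_add integrable_mult_right integrable_const integrable_indicator_event ZA)
    have "expectation (?m n) \<le> expectation (\<lambda>\<omega>. 2 * (Z \<omega>)\<^sup>2 + 2 * \<epsilon>\<^sup>2 + (real n)\<^sup>2 * indicator A \<omega>)"
    proof (rule integral_mono[OF I IR])
      fix \<omega> assume \<omega>: "\<omega> \<in> space M"
      show "?m n \<omega> \<le> 2 * (Z \<omega>)\<^sup>2 + 2 * \<epsilon>\<^sup>2 + (real n)\<^sup>2 * indicator A \<omega>"
      proof (cases "\<omega> \<in> A \<or> \<not> below N t \<omega>")
        case True
        then show ?thesis using m_le(1)[of \<omega>] by (auto intro: order_trans add_increasing)
      next
        case False
        then have *: "\<bar>Z \<omega> - J \<omega>\<bar> \<le> \<epsilon>" using cl \<omega> by blast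
        have "?m n \<omega> \<le> (J \<omega>)\<^sup>2" using power_mono[of "min \<bar>J \<omega>\<bar> (real n)" "\<bar>J \<omega>\<bar>" 2] by auto
        also have "\<dots> = (Z \<omega> + (J \<omega> - Z \<omega>))\<^sup>2" by simp
        also have "\<dots> \<le> 2 * (Z \<omega>)\<^sup>2 + 2 * (J \<omega> - Z \<omega>)\<^sup>2" by (rule power2_sum_le)
        also have "(J \<omega> - Z \<omega>)\<^sup>2 \<le> \<epsilon>\<^sup>2" using power_mono[OF *, of 2] by (simp add: power2_commute)
        finally show ?thesis using False by simp
      qed
    qed
    also have "\<dots> = 2 * expectation (\<lambda>\<omega>. (Z \<omega>)\<^sup>2) + 2 * \<epsilon>\<^sup>2 + (real n)\<^sup>2 * prob A"
      using ZA by (simp add: prob_space integrable_indicator_event)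
    also have "\<dots> \<le> 2 * Bd V \<beta> t + 2 * e + (real n)\<^sup>2 * e"
    proof (intro add_mono mult_left_mono)
      have "\<epsilon> * \<epsilon> \<le> 1 * e" using \<epsilon> by (intro mult_mono) auto
      then show "\<epsilon>\<^sup>2 \<le> e" by (simp add: power2_eq_square)
    qed (use ZA \<epsilon> in auto)
    finally show "expectation (?m n) \<le> 2 * Bd V \<beta> t + e * (2 + (real n)\<^sup>2)" by (simp add: algebra_simps)
  qed
  then show "(\<integral>\<^sup>+\<omega>. ennreal (?m n \<omega>) \<partial>M) \<le> ennreal (2 * Bd V \<beta> t)"
    using nn_integral_eq_integral[OF I] m_le(2) by (simp add: ennreal_leI)
qed

definition JN where "JN \<omega> = (if below N t \<omega> then J \<omega> else 0)"

lemma JN_meas[measurable]: "JN \<in> borel_measurable M"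
  unfolding JN_def[abs_def] by measurable

lemma JN_square: "integrable M (\<lambda>\<omega>. (JN \<omega>)\<^sup>2)" "expectation (\<lambda>\<omega>. (JN \<omega>)\<^sup>2) \<le> 2 * Bd V \<beta> t"
proof -
  have Bd: "0 \<le> Bd V \<beta> t" using Bd_nonneg V t by simp
  have le: "(\<integral>\<^sup>+\<omega>. ennreal ((JN \<omega>)\<^sup>2) \<partial>M) \<le> ennreal (2 * Bd V \<beta> t)"
    using ito_second_moment by (simp add: JN_def if_distrib[of "\<lambda>u. ennreal (u\<^sup>2)"] cong: if_cong)
  show "integrable M (\<lambda>\<omega>. (JN \<omega>)\<^sup>2)"
    by (rule integrableI_nonneg) (auto intro: le_less_trans[OF le])
  show "expectation (\<lambda>\<omega>. (JN \<omega>)\<^sup>2) \<le> 2 * Bd V \<beta> t"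
    using Bd le by (subst integral_eq_nn_integral) (auto intro: enn2real_leI)
qed

text \<open>\<open>Z\<close> has mean zero on the whole space but is close to \<open>J\<close> on
  \<open>below N t\<close> only, so the mean of \<open>JN\<close> is that of JN - Z, with three
  contributions: \<epsilon> where they are close, the small event \<open>A\<close>, and the exit
  event. On the last two |u| <= c u^2 + 1 / (4 c) trades size for probability. The 7 is 3 for the
  square of \<open>Z\<close> plus 2 times 2 for that of \<open>JN\<close>, whose mean is at most 2
  Bd.\<close>

lemma ito_mean:
  assumes c: "0 < c"
  shows "\<bar>expectation (\<lambda>\<omega>. if below N t \<omega> then J \<omega> else 0)\<bar> \<le> 7 * c * Bd V \<beta> t + prob {\<omega>\<in>space M. \<not> below N t \<omega>} / (4 * c)"
proof -
  have "\<bar>expectation JN\<bar> \<le> 7 * c * Bd V \<beta> t + prob {\<omega>\<in>space M. \<not> below N t \<omega>} / (4 * c)"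
  proof (rule real_le_of_add_mult_le)
    show "0 \<le> 1 + 1 / (4 * c)" using c by simp
    fix \<epsilon> :: real assume \<epsilon>: "0 < \<epsilon>"
    obtain Z A where ZA: "Z \<in> borel_measurable M" "A \<in> events" "integrable M (\<lambda>\<omega>. (Z \<omega>)\<^sup>2)" "expectation Z = 0"
      "expectation (\<lambda>\<omega>. (Z \<omega>)\<^sup>2) \<le> Bd V \<beta> t" "prob A \<le> \<epsilon>"
      and cl: "\<And>\<omega>. \<omega> \<in> space M \<Longrightarrow> \<omega> \<notin> A \<Longrightarrow> below N t \<omega> \<Longrightarrow> \<bar>Z \<omega> - J \<omega>\<bar> \<le> \<epsilon>"
      using ito_approximation_moments[OF \<epsilon>] by blast
    note [measurable] = ZA(1,2)
    have IZ: "integrable M Z" by (rule square_integrable_imp_integrable[OF ZA(1,3)])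
    have IJ: "integrable M JN" by (rule square_integrable_imp_integrable[OF JN_meas JN_square(1)])
    let ?nb = "{\<omega>\<in>space M. \<not> below N t \<omega>}"
    let ?R = "\<lambda>\<omega>. \<epsilon> + 3 * c * (Z \<omega>)\<^sup>2 + 2 * c * (JN \<omega>)\<^sup>2 + indicator A \<omega> / (4 * c) + indicator ?nb \<omega> / (4 * c)"
    have IR: "integrable M ?R"
      by (intro Bochner_Integration.integrable_add integrable_mult_right integrable_divide integrable_const
        integrable_indicator_event ZA JN_square) measurable
    have "expectation JN = expectation (\<lambda>\<omega>. JN \<omega> - Z \<omega>)" using IZ IJ ZA by simp
    then have "\<bar>expectation JN\<bar> = \<bar>expectation (\<lambda>\<omega>. JN \<omega> - Z \<omega>)\<bar>" by simp
    also have "\<dots> \<le> expectation ?R"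
    proof (rule integral_abs_le[OF IR])
      fix \<omega> assume \<omega>: "\<omega> \<in> space M"
      have pos: "0 \<le> c * (Z \<omega>)\<^sup>2" "0 \<le> c * (JN \<omega>)\<^sup>2" "0 \<le> indicator A \<omega> / (4 * c)" "0 \<le> indicator ?nb \<omega> / (4 * c)"
        using c by auto
      show "\<bar>JN \<omega> - Z \<omega>\<bar> \<le> ?R \<omega>"
      proof (cases "below N t \<omega>")
        case False
        then have "\<bar>JN \<omega> - Z \<omega>\<bar> \<le> c * (Z \<omega>)\<^sup>2 + 1 / (4 * c)" using abs_le_square_div[OF c, of "Z \<omega>"] by (simp add: JN_def)
        moreover have "indicator ?nb \<omega> / (4 * c) = 1 / (4 * c)" using False \<omega> by simp
        ultimately show ?thesis using pos \<epsilon> by linarith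
      next
        case True
        show ?thesis
        proof (cases "\<omega> \<in> A")
          case False
          then have "\<bar>JN \<omega> - Z \<omega>\<bar> \<le> \<epsilon>" using cl[OF \<omega> False True] True by (simp add: JN_def abs_minus_commute)
          then show ?thesis using pos by linarith
        next
          case inA: True
          have "\<bar>JN \<omega> - Z \<omega>\<bar> \<le> c * (JN \<omega> - Z \<omega>)\<^sup>2 + 1 / (4 * c)" by (rule abs_le_square_div[OF c])
          also have "c * (JN \<omega> - Z \<omega>)\<^sup>2 \<le> c * (2 * (JN \<omega>)\<^sup>2 + 2 * (Z \<omega>)\<^sup>2)"
            using power2_sum_le[of "JN \<omega>" "- Z \<omega>"] c by (intro mult_left_mono) auto
          finally have "\<bar>JN \<omega> - Z \<omega>\<bar> \<le> 2 * (c * (JN \<omega>)\<^sup>2) + 2 * (c * (Z \<omega>)\<^sup>2) + 1 / (4 * c)" by (simp add: algebra_simps)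
          moreover have "indicator A \<omega> / (4 * c) = 1 / (4 * c)" using inA by simp
          ultimately show ?thesis using pos \<epsilon> by linarith
        qed
      qed
    qed
    also have "\<dots> = \<epsilon> + 3 * c * expectation (\<lambda>\<omega>. (Z \<omega>)\<^sup>2) + 2 * c * expectation (\<lambda>\<omega>. (JN \<omega>)\<^sup>2) + prob A / (4 * c) + prob ?nb / (4 * c)"
      using ZA JN_square by (simp add: prob_space integrable_indicator_event)
    also have "\<dots> \<le> \<epsilon> + 3 * c * Bd V \<beta> t + 2 * c * (2 * Bd V \<beta> t) + \<epsilon> / (4 * c) + prob ?nb / (4 * c)"
      using ZA JN_square c by (intro add_mono mult_left_mono divide_right_mono order_refl) auto
    finally show "\<bar>expectation JN\<bar> \<le> 7 * c * Bd V \<beta> t + prob ?nb / (4 * c) + \<epsilon> * (1 + 1 / (4 * c))"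
      by (simp add: algebra_simps)
  qed
  then show ?thesis by (simp add: JN_def[abs_def])
qed

end

end

section \<open>Gronwall estimate for the second moments, uniform in the truncation\<close>

context sde_solution
begin

definition dr where "dr s \<omega> = a * x s \<omega> + b * y s \<omega>"

lemma dr_cont: "\<omega> \<in> space M \<Longrightarrow> continuous_on UNIV (\<lambda>s. dr s \<omega>)"
  unfolding dr_def by (intro continuous_on_add continuous_on_mult_left x_cont y_cont)

lemma dr_joint2[measurable]:
  "f \<in> measurable L borel \<Longrightarrow> g \<in> measurable L M \<Longrightarrow> (\<lambda>z. dr (f z) (g z)) \<in> borel_measurable L"
  unfolding dr_def by (intro borel_measurable_add borel_measurable_times borel_measurable_const x_joint2 y_joint2)

text \<open>Cauchy-Schwarz on [0,t]. Since \<open>below N t\<close> passes to all earlier times, the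
  integrand can be localised time by time before expectations are taken.\<close>

lemma dr_square_le:
  assumes \<omega>: "\<omega> \<in> space M" and t: "0 < t" and bel: "below N t \<omega>"
  shows "ennreal ((LINT s:{0..t}|lborel. dr s \<omega>)\<^sup>2)
     \<le> ennreal t * (\<integral>\<^sup>+s\<in>{0..t}. (if below N s \<omega> then ennreal ((dr s \<omega>)\<^sup>2) else 0) \<partial>lborel)"
proof -
  have c: "continuous_on {0..t} (\<lambda>s. dr s \<omega>)" by (rule continuous_on_subset[OF dr_cont[OF \<omega>]]) simp
  have I: "set_integrable lborel {0..t} (\<lambda>s. dr s \<omega>)" by (rule borel_integrable_atLeastAtMost'[OF c])
  have I2: "set_integrable lborel {0..t} (\<lambda>s. (dr s \<omega>)\<^sup>2)"
    by (intro borel_integrable_atLeastAtMost' continuous_intros c)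
  have "(LINT s|lborel. indicator {0..t} s * dr s \<omega>)\<^sup>2 \<le> t * (LINT s|lborel. indicator {0..t} s * (dr s \<omega>)\<^sup>2)"
    using I I2 t by (intro weighted_square_le) (auto simp: set_integrable_def)
  then have "ennreal ((LINT s:{0..t}|lborel. dr s \<omega>)\<^sup>2) \<le> ennreal (t * (LINT s|lborel. indicator {0..t} s * (dr s \<omega>)\<^sup>2))"
    by (simp add: set_lebesgue_integral_def ennreal_leI)
  also have "\<dots> = ennreal t * (\<integral>\<^sup>+s. ennreal (indicator {0..t} s * (dr s \<omega>)\<^sup>2) \<partial>lborel)"
    using I2 t by (subst nn_integral_eq_integral) (auto simp: set_integrable_def ennreal_mult)
  also have "(\<integral>\<^sup>+s. ennreal (indicator {0..t} s * (dr s \<omega>)\<^sup>2) \<partial>lborel)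
      \<le> (\<integral>\<^sup>+s\<in>{0..t}. (if below N s \<omega> then ennreal ((dr s \<omega>)\<^sup>2) else 0) \<partial>lborel)"
    using below_mono[OF \<omega> _ _ bel] by (intro nn_integral_mono) (auto simp: indicator_def)
  finally show ?thesis by (simp add: mult_left_mono)
qed

text \<open>The terms free of \<open>V\<close> when the square of initial value plus drift plus Ito
  integral is split with factor 3: the 9 is 3 times 3 from the drift, the 18 is 3 times 2 times 3
  from the Ito integral. \<open>A1\<close> collects the factors of V exp (\<beta> t) / \<beta> in
  the same way.\<close>

definition A0 where "A0 T = 3 * B0\<^sup>2 + 9 * T\<^sup>2 * b\<^sup>2 * B0\<^sup>2 + 18 * (\<sigma>0\<^sup>2 + \<sigma>2\<^sup>2 * B0\<^sup>2) * T"

definition A1 where "A1 T = 9 * T * (a\<^sup>2 + b\<^sup>2) + 18 * (\<sigma>1\<^sup>2 + \<sigma>2\<^sup>2)"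

lemma drift_moment_le:
  assumes t: "0 < t" "t \<le> T" and V: "0 \<le> V" "0 < \<beta>"
    and v: "\<And>r. r \<in> {0..T} \<Longrightarrow> (\<integral>\<^sup>+\<omega>. ennreal ((xN N r \<omega>)\<^sup>2) \<partial>M) \<le> ennreal (V * exp (\<beta> * r))"
  shows "(\<integral>\<^sup>+\<omega>. (if below N t \<omega> then ennreal ((LINT s:{0..t}|lborel. dr s \<omega>)\<^sup>2) else 0) \<partial>M)
    \<le> ennreal (T * (3 * b\<^sup>2 * B0\<^sup>2 * T + 3 * (a\<^sup>2 + b\<^sup>2) * V * (exp (\<beta> * t) / \<beta>)))"
proof -
  let ?g = "\<lambda>s \<omega>. if below N s \<omega> then ennreal ((dr s \<omega>)\<^sup>2) else 0"
  let ?c = "\<lambda>s. 3 * b\<^sup>2 * B0\<^sup>2 + 3 * (a\<^sup>2 + b\<^sup>2) * V * exp (\<beta> * s)"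
  have c_nn: "0 \<le> ?c s" for s using V by (intro add_nonneg_nonneg mult_nonneg_nonneg) auto
  have [measurable]: "(\<lambda>p. ?g (snd p) (fst p)) \<in> borel_measurable (M \<Otimes>\<^sub>M lborel)"
  proof -
    have "(\<lambda>p. dr (snd p) (fst p)) \<in> borel_measurable (M \<Otimes>\<^sub>M lborel)" by (rule dr_joint2) measurable
    moreover have "Measurable.pred (M \<Otimes>\<^sub>M lborel) (\<lambda>p. below N (snd p) (fst p))" by (rule below_joint2) measurable
    ultimately show ?thesis by measurable
  qed
  interpret p: pair_sigma_finite M lborel ..
  have "(\<integral>\<^sup>+\<omega>. (if below N t \<omega> then ennreal ((LINT s:{0..t}|lborel. dr s \<omega>)\<^sup>2) else 0) \<partial>M)
    \<le> (\<integral>\<^sup>+\<omega>. ennreal t * (\<integral>\<^sup>+s\<in>{0..t}. ?g s \<omega> \<partial>lborel) \<partial>M)"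
    using t by (intro nn_integral_mono) (auto intro!: dr_square_le)
  also have "\<dots> = ennreal t * (\<integral>\<^sup>+\<omega>. (\<integral>\<^sup>+s\<in>{0..t}. ?g s \<omega> \<partial>lborel) \<partial>M)"
  proof (rule nn_integral_cmult)
    have "(\<lambda>p. ?g (snd p) (fst p) * indicator {0..t} (snd p)) \<in> borel_measurable (M \<Otimes>\<^sub>M lborel)" by measurable
    then show "(\<lambda>\<omega>. \<integral>\<^sup>+s\<in>{0..t}. ?g s \<omega> \<partial>lborel) \<in> borel_measurable M"
      by (intro lborel.borel_measurable_nn_integral) (simp add: case_prod_beta)
  qed
  also have "(\<integral>\<^sup>+\<omega>. (\<integral>\<^sup>+s\<in>{0..t}. ?g s \<omega> \<partial>lborel) \<partial>M) = (\<integral>\<^sup>+s. (\<integral>\<^sup>+\<omega>. ?g s \<omega> * indicator {0..t} s \<partial>M) \<partial>lborel)"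
  proof (rule p.Fubini'[symmetric])
    have "(\<lambda>p. ?g (snd p) (fst p) * indicator {0..t} (snd p)) \<in> borel_measurable (M \<Otimes>\<^sub>M lborel)" by measurable
    then show "(\<lambda>(\<omega>, s). ?g s \<omega> * indicator {0..t} s) \<in> borel_measurable (M \<Otimes>\<^sub>M lborel)" by (simp add: case_prod_beta)
  qed
  also have "\<dots> \<le> (\<integral>\<^sup>+s. ennreal (indicator {0..t} s * ?c s) \<partial>lborel)"
  proof (rule nn_integral_mono)
    fix s :: real
    show "(\<integral>\<^sup>+\<omega>. ?g s \<omega> * indicator {0..t} s \<partial>M) \<le> ennreal (indicator {0..t} s * ?c s)"
    proof (cases "s \<in> {0..t}")
      case True
      then have s: "s \<in> {0..T}" using t by auto
      have dr0: "dr s \<omega> = 0 + a * x s \<omega> + b * y s \<omega>" for \<omega> by (simp add: dr_def)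
      have c0: "3 * 0\<^sup>2 + 3 * b\<^sup>2 * B0\<^sup>2 + 3 * (a\<^sup>2 + b\<^sup>2) * (V * exp (\<beta> * s)) = ?c s" by simp
      have "(\<integral>\<^sup>+\<omega>. ?g s \<omega> \<partial>M) \<le> ennreal (?c s)"
        using linear_moment_le[OF s V(1) less_imp_le[OF V(2)] v, where ?c0.0=0 and ?c1.0=a and ?c2.0=b]
        unfolding c0 dr0 .
      then show ?thesis using True by simp
    qed simp
  qed
  also have "\<dots> = ennreal (LINT s:{0..t}|lborel. ?c s)"
  proof -
    have "set_integrable lborel {0..t} ?c" by (intro borel_integrable_atLeastAtMost' continuous_intros)
    then show ?thesis unfolding set_lebesgue_integral_def set_integrable_def real_scaleR_def
      using c_nn by (intro nn_integral_eq_integral) auto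
  qed
  also have "(LINT s:{0..t}|lborel. ?c s) \<le> 3 * b\<^sup>2 * B0\<^sup>2 * t + 3 * (a\<^sup>2 + b\<^sup>2) * V * (exp (\<beta> * t) / \<beta>)"
  proof -
    have i1: "set_integrable lborel {0..t} (\<lambda>s. 3 * b\<^sup>2 * B0\<^sup>2)" and i2: "set_integrable lborel {0..t} (\<lambda>s. 3 * (a\<^sup>2 + b\<^sup>2) * V * exp (\<beta> * s))"
      by (intro borel_integrable_atLeastAtMost' continuous_intros)+
    have "(LINT s:{0..t}|lborel. ?c s) = (LINT s:{0..t}|lborel. 3 * b\<^sup>2 * B0\<^sup>2) + (LINT s:{0..t}|lborel. 3 * (a\<^sup>2 + b\<^sup>2) * V * exp (\<beta> * s))"
      by (rule set_integral_add(2)[OF i1 i2])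
    also have "(LINT s:{0..t}|lborel. 3 * b\<^sup>2 * B0\<^sup>2) = 3 * b\<^sup>2 * B0\<^sup>2 * t"
      using t by (simp add: set_lebesgue_integral_def)
    also have "(LINT s:{0..t}|lborel. 3 * (a\<^sup>2 + b\<^sup>2) * V * exp (\<beta> * s)) = 3 * (a\<^sup>2 + b\<^sup>2) * V * (LINT s:{0..t}|lborel. exp (\<beta> * s))"
      by (rule set_integral_mult_right)
    also have "\<dots> \<le> 3 * (a\<^sup>2 + b\<^sup>2) * V * (exp (\<beta> * t) / \<beta>)"
      using V t by (intro mult_left_mono set_integral_exp_le) auto
    finally show ?thesis by simp
  qed
  also have "\<dots> \<le> 3 * b\<^sup>2 * B0\<^sup>2 * T + 3 * (a\<^sup>2 + b\<^sup>2) * V * (exp (\<beta> * t) / \<beta>)"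
    using t by (intro add_right_mono mult_left_mono) auto
  finally have "(\<integral>\<^sup>+\<omega>. (if below N t \<omega> then ennreal ((LINT s:{0..t}|lborel. dr s \<omega>)\<^sup>2) else 0) \<partial>M)
    \<le> ennreal t * ennreal (3 * b\<^sup>2 * B0\<^sup>2 * T + 3 * (a\<^sup>2 + b\<^sup>2) * V * (exp (\<beta> * t) / \<beta>))"
    by (simp add: ennreal_leI mult_left_mono)
  also have "\<dots> \<le> ennreal T * ennreal (3 * b\<^sup>2 * B0\<^sup>2 * T + 3 * (a\<^sup>2 + b\<^sup>2) * V * (exp (\<beta> * t) / \<beta>))"
    using t by (intro mult_right_mono ennreal_leI) auto
  also have "\<dots> = ennreal (T * (3 * b\<^sup>2 * B0\<^sup>2 * T + 3 * (a\<^sup>2 + b\<^sup>2) * V * (exp (\<beta> * t) / \<beta>)))"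
    using t V by (intro ennreal_mult[symmetric] add_nonneg_nonneg mult_nonneg_nonneg) auto
  finally show ?thesis .
qed

text \<open>Each summand of the equation has a second moment known under the provisional bound. The
  gain is the division by \<beta>: for large \<beta> only a small multiple of \<open>V\<close>
  returns.\<close>

lemma xN_moment_step:
  assumes t: "t \<in> {0..T}" and V: "0 \<le> V" "0 < \<beta>"
    and v: "\<And>r. r \<in> {0..T} \<Longrightarrow> (\<integral>\<^sup>+\<omega>. ennreal ((xN N r \<omega>)\<^sup>2) \<partial>M) \<le> ennreal (V * exp (\<beta> * r))"
  shows "(\<integral>\<^sup>+\<omega>. ennreal ((xN N t \<omega>)\<^sup>2) \<partial>M) \<le> ennreal (A0 T + A1 T * V * (exp (\<beta> * t) / \<beta>))"
proof (cases "t = 0")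
  \<comment> \<open>The approximation of the Ito integral requires t > 0; at 0 the initial value
    suffices.\<close>
  case True
  have T: "0 \<le> T" using t by simp
  have "(\<integral>\<^sup>+\<omega>. ennreal ((xN N t \<omega>)\<^sup>2) \<partial>M) \<le> (\<integral>\<^sup>+\<omega>. ennreal (B0\<^sup>2) \<partial>M)"
  proof (rule nn_integral_mono)
    fix \<omega> assume "\<omega> \<in> space M"
    then have "\<bar>xN N t \<omega>\<bar> \<le> B0" using True x_neg[of \<omega> 0] BC_norm_upper[OF \<phi>, of 0] B0 by (simp add: xN_def)
    from power_mono[OF this, of 2] show "ennreal ((xN N t \<omega>)\<^sup>2) \<le> ennreal (B0\<^sup>2)" by (simp add: ennreal_leI)
  qed
  also have "\<dots> = ennreal (B0\<^sup>2)" by (simp add: emeasure_space_1)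
  also have "\<dots> \<le> ennreal (A0 T + A1 T * V * (exp (\<beta> * t) / \<beta>))"
  proof (rule ennreal_leI)
    have "B0\<^sup>2 \<le> 3 * B0\<^sup>2" by simp
    moreover have "0 \<le> 9 * T\<^sup>2 * b\<^sup>2 * B0\<^sup>2" "0 \<le> 18 * (\<sigma>0\<^sup>2 + \<sigma>2\<^sup>2 * B0\<^sup>2) * T" "0 \<le> A1 T * V * (exp (\<beta> * t) / \<beta>)"
      using T V by (auto simp: A1_def intro!: mult_nonneg_nonneg add_nonneg_nonneg divide_nonneg_nonneg)
    ultimately show "B0\<^sup>2 \<le> A0 T + A1 T * V * (exp (\<beta> * t) / \<beta>)" unfolding A0_def by linarith
  qed
  finally show ?thesis .
next
  case False
  then have t': "0 < t" "t \<le> T" using t by auto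
  obtain J where J: "has_ito_integral M F W H t J"
    and eq: "AE \<omega> in M. x t \<omega> = \<phi> 0 + (LINT s:{0..t}|lborel. dr s \<omega>) + J \<omega>"
    using ito[of t] t' unfolding dr_def by auto
  have [measurable]: "J \<in> borel_measurable M" using J by (simp add: has_ito_integral_def)
  let ?D = "\<lambda>\<omega>. if below N t \<omega> then ennreal ((LINT s:{0..t}|lborel. dr s \<omega>)\<^sup>2) else 0"
  let ?J = "\<lambda>\<omega>. if below N t \<omega> then ennreal ((J \<omega>)\<^sup>2) else 0"
  have [measurable]: "(\<lambda>\<omega>. LINT s:{0..t}|lborel. dr s \<omega>) \<in> borel_measurable M"
  proof -
    have "(\<lambda>p. dr (snd p) (fst p)) \<in> borel_measurable (M \<Otimes>\<^sub>M lborel)" by (rule dr_joint2) measurable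
    then have "(\<lambda>p. indicator {0..t} (snd p) *\<^sub>R dr (snd p) (fst p)) \<in> borel_measurable (M \<Otimes>\<^sub>M lborel)" by measurable
    then show ?thesis unfolding set_lebesgue_integral_def
      by (intro lborel.borel_measurable_lebesgue_integral) (simp add: case_prod_beta)
  qed
  have \<phi>0: "(\<phi> 0)\<^sup>2 \<le> B0\<^sup>2" using power_mono[OF BC_norm_upper[OF \<phi>, of 0], of 2] by simp
  have "(\<integral>\<^sup>+\<omega>. ennreal ((xN N t \<omega>)\<^sup>2) \<partial>M) \<le> (\<integral>\<^sup>+\<omega>. ennreal (3 * B0\<^sup>2) + (3 * ?D \<omega> + 3 * ?J \<omega>) \<partial>M)"
  proof (rule nn_integral_mono_AE)
    show "AE \<omega> in M. ennreal ((xN N t \<omega>)\<^sup>2) \<le> ennreal (3 * B0\<^sup>2) + (3 * ?D \<omega> + 3 * ?J \<omega>)"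
      using eq
    proof eventually_elim
      case (elim \<omega>)
      show ?case
      proof (cases "below N t \<omega>")
        case True
        let ?d = "LINT s:{0..t}|lborel. dr s \<omega>"
        have "(xN N t \<omega>)\<^sup>2 = (\<phi> 0 + ?d + J \<omega>)\<^sup>2" using True t' elim by (simp add: xN_def)
        also have "\<dots> \<le> 3 * (\<phi> 0)\<^sup>2 + 3 * ?d\<^sup>2 + 3 * (J \<omega>)\<^sup>2" by (rule power2_sum3_le)
        also have "\<dots> \<le> 3 * B0\<^sup>2 + (3 * ?d\<^sup>2 + 3 * (J \<omega>)\<^sup>2)" using \<phi>0 by simp
        finally have "ennreal ((xN N t \<omega>)\<^sup>2) \<le> ennreal (3 * B0\<^sup>2 + (3 * ?d\<^sup>2 + 3 * (J \<omega>)\<^sup>2))" by (rule ennreal_leI)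
        also have "\<dots> = ennreal (3 * B0\<^sup>2) + (3 * ennreal (?d\<^sup>2) + 3 * ennreal ((J \<omega>)\<^sup>2))"
          by (simp add: ennreal_plus ennreal_mult)
        finally show ?thesis using True by simp
      qed (simp add: xN_def)
    qed
  qed
  also have "\<dots> = ennreal (3 * B0\<^sup>2) + (3 * (\<integral>\<^sup>+\<omega>. ?D \<omega> \<partial>M) + 3 * (\<integral>\<^sup>+\<omega>. ?J \<omega> \<partial>M))"
    by (subst nn_integral_add, measurable, subst nn_integral_add, measurable, subst nn_integral_cmult, measurable, subst nn_integral_cmult)
      (auto simp: emeasure_space_1)
  also have "\<dots> \<le> ennreal (3 * B0\<^sup>2) + (3 * ennreal (T * (3 * b\<^sup>2 * B0\<^sup>2 * T + 3 * (a\<^sup>2 + b\<^sup>2) * V * (exp (\<beta> * t) / \<beta>))) + 3 * ennreal (2 * Bd V \<beta> t))"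
    using drift_moment_le[OF t' V v] ito_second_moment[OF t' J V v] by (intro add_left_mono add_mono mult_left_mono) auto
  also have "\<dots> = ennreal (3 * B0\<^sup>2 + (3 * (T * (3 * b\<^sup>2 * B0\<^sup>2 * T + 3 * (a\<^sup>2 + b\<^sup>2) * V * (exp (\<beta> * t) / \<beta>))) + 3 * (2 * Bd V \<beta> t)))"
  proof -
    have "0 \<le> T * (3 * b\<^sup>2 * B0\<^sup>2 * T + 3 * (a\<^sup>2 + b\<^sup>2) * V * (exp (\<beta> * t) / \<beta>))"
      using t' V by (intro add_nonneg_nonneg mult_nonneg_nonneg) auto
    moreover have "0 \<le> Bd V \<beta> t" using Bd_nonneg V t' by simp
    ultimately show ?thesis by (simp add: ennreal_plus ennreal_mult)
  qed
  also have "\<dots> \<le> ennreal (A0 T + A1 T * V * (exp (\<beta> * t) / \<beta>))"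
  proof (rule ennreal_leI)
    have "(3 * \<sigma>0\<^sup>2 + 3 * \<sigma>2\<^sup>2 * B0\<^sup>2) * t \<le> (3 * \<sigma>0\<^sup>2 + 3 * \<sigma>2\<^sup>2 * B0\<^sup>2) * T"
      using t' by (intro mult_left_mono) auto
    then show "3 * B0\<^sup>2 + (3 * (T * (3 * b\<^sup>2 * B0\<^sup>2 * T + 3 * (a\<^sup>2 + b\<^sup>2) * V * (exp (\<beta> * t) / \<beta>))) + 3 * (2 * Bd V \<beta> t))
      \<le> A0 T + A1 T * V * (exp (\<beta> * t) / \<beta>)"
      unfolding Bd_def A0_def A1_def by (simp add: algebra_simps power2_eq_square)
  qed
  finally show ?thesis .
qed

text \<open>Keeps A1 T / \<beta>T T below 1/2, the halving that \<open>weighted_gronwall\<close>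
  asks for.\<close>

definition \<beta>T where "\<beta>T T = 2 * A1 T + 1"

text \<open>\<open>N\<close> enters only through the a priori bound N^2 that makes a supremum
  finite; it is absent from the result, so the truncation can be removed.\<close>

lemma xN_moment:
  assumes t: "t \<in> {0..T}" and N: "0 \<le> N"
  shows "(\<integral>\<^sup>+\<omega>. ennreal ((xN N t \<omega>)\<^sup>2) \<partial>M) \<le> ennreal (2 * A0 T * exp (\<beta>T T * t))"
proof -
  let ?v = "\<lambda>t. expectation (\<lambda>\<omega>. (xN N t \<omega>)\<^sup>2)"
  have T: "0 \<le> T" using t by simp
  have A1: "0 \<le> A1 T" and A0: "0 \<le> A0 T" using T by (auto simp: A1_def A0_def intro!: add_nonneg_nonneg mult_nonneg_nonneg)
  have \<beta>: "1 \<le> \<beta>T T" using A1 by (simp add: \<beta>T_def)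
  have sq: "(xN N r \<omega>)\<^sup>2 \<le> N\<^sup>2" if "\<omega> \<in> space M" for r \<omega> using power_mono[OF xN_bound[OF that N, of r], of 2] by simp
  have [measurable]: "(\<lambda>\<omega>. xN N r \<omega>) \<in> borel_measurable M" for r by (rule xN_joint2) measurable
  have I: "integrable M (\<lambda>\<omega>. (xN N r \<omega>)\<^sup>2)" for r
    by (rule integrable_const_bound[where B="N\<^sup>2"]) (use sq in auto)
  have nn: "(\<integral>\<^sup>+\<omega>. ennreal ((xN N r \<omega>)\<^sup>2) \<partial>M) = ennreal (?v r)" for r
    by (rule nn_integral_eq_integral[OF I]) simp
  have "?v t * exp (- \<beta>T T * t) \<le> 2 * A0 T"
  proof (rule weighted_gronwall[where f="\<lambda>t. ?v t * exp (- \<beta>T T * t)" and T=T and B="N\<^sup>2"])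
    show "?v r * exp (- \<beta>T T * r) \<le> N\<^sup>2" if "r \<in> {0..T}" for r
    proof -
      have "?v r \<le> expectation (\<lambda>_. N\<^sup>2)" using I sq by (intro integral_mono) auto
      then have "?v r \<le> N\<^sup>2" by (simp add: prob_space)
      moreover have "exp (- \<beta>T T * r) \<le> 1" using \<beta> that by auto
      ultimately have "?v r * exp (- \<beta>T T * r) \<le> N\<^sup>2 * 1" by (intro mult_mono) auto
      then show ?thesis by simp
    qed
    fix V r assume V: "0 \<le> V" "\<And>s. s \<in> {0..T} \<Longrightarrow> ?v s * exp (- \<beta>T T * s) \<le> V" and r: "r \<in> {0..T}"
    have "(\<integral>\<^sup>+\<omega>. ennreal ((xN N s \<omega>)\<^sup>2) \<partial>M) \<le> ennreal (V * exp (\<beta>T T * s))" if "s \<in> {0..T}" for s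
      unfolding nn using V(2)[OF that] by (intro ennreal_leI) (simp add: exp_minus field_simps)
    from xN_moment_step[OF r V(1) _ this] \<beta>
    have "ennreal (?v r) \<le> ennreal (A0 T + A1 T * V * (exp (\<beta>T T * r) / \<beta>T T))" unfolding nn by simp
    moreover have "0 \<le> A0 T + A1 T * V * (exp (\<beta>T T * r) / \<beta>T T)"
      using A0 A1 V \<beta> by (intro add_nonneg_nonneg mult_nonneg_nonneg divide_nonneg_nonneg) auto
    ultimately have "?v r \<le> A0 T + A1 T * V * (exp (\<beta>T T * r) / \<beta>T T)" by (simp add: ennreal_le_iff)
    then have "?v r * exp (- \<beta>T T * r) \<le> (A0 T + A1 T * V * (exp (\<beta>T T * r) / \<beta>T T)) * exp (- \<beta>T T * r)"
      by (intro mult_right_mono) auto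
    also have "\<dots> = A0 T * exp (- \<beta>T T * r) + A1 T * V / \<beta>T T" by (simp add: exp_minus field_simps)
    also have "\<dots> \<le> A0 T + V / 2"
    proof (intro add_mono)
      show "A0 T * exp (- \<beta>T T * r) \<le> A0 T" using A0 \<beta> r by (intro mult_left_le) auto
      have "A1 T * V \<le> \<beta>T T / 2 * V" using V by (intro mult_right_mono) (auto simp: \<beta>T_def)
      then show "A1 T * V / \<beta>T T \<le> V / 2" using \<beta> by (simp add: field_simps)
    qed
    finally show "?v r * exp (- \<beta>T T * r) \<le> A0 T + V / 2" .
  qed (use A0 t in auto)
  then show ?thesis unfolding nn by (intro ennreal_leI) (simp add: exp_minus field_simps)
qed

end

section \<open>The mean of the solution\<close>

context sde_solution
begin

lemma eventually_below: "\<omega> \<in> space M \<Longrightarrow> 0 \<le> t \<Longrightarrow> eventually (\<lambda>n. below (real n) t \<omega>) sequentially"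
proof -
  assume \<omega>: "\<omega> \<in> space M" and t: "0 \<le> t"
  obtain B where B: "\<And>r. r \<le> t \<Longrightarrow> \<bar>x r \<omega>\<bar> \<le> B" using path_bound[OF \<omega>] by metis
  show ?thesis
    using eventually_ge_at_top[of "nat \<lceil>B\<rceil>"]
  proof eventually_elim
    case (elim n)
    then have "B \<le> real n" by linarith
    then show ?case unfolding below_iff[OF \<omega> t] using B by force
  qed
qed

definition Q where "Q T = 2 * A0 T * exp (\<beta>T T * T)"

lemma second_moment:
  assumes t: "t \<in> {0..T}"
  shows "(\<integral>\<^sup>+\<omega>. ennreal ((x t \<omega>)\<^sup>2) \<partial>M) \<le> ennreal (Q T)"
proof (rule nn_integral_limit_le)
  show "(\<lambda>\<omega>. ennreal ((xN (real n) t \<omega>)\<^sup>2)) \<in> borel_measurable M" for n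
  proof -
    have [measurable]: "(\<lambda>\<omega>. xN (real n) t \<omega>) \<in> borel_measurable M" by (rule xN_joint2) measurable
    show ?thesis by measurable
  qed
  show "(\<lambda>n. ennreal ((xN (real n) t \<omega>)\<^sup>2)) \<longlonglongrightarrow> ennreal ((x t \<omega>)\<^sup>2)" if "\<omega> \<in> space M" for \<omega>
  proof (rule tendsto_eventually)
    show "\<forall>\<^sub>F n in sequentially. ennreal ((xN (real n) t \<omega>)\<^sup>2) = ennreal ((x t \<omega>)\<^sup>2)"
    proof -
      have "0 \<le> t" using t by simp
      from eventually_below[OF that this] show ?thesis by eventually_elim (use t in \<open>auto simp: xN_def\<close>)
    qed
  qed
  have A1: "0 \<le> A1 T" and A0: "0 \<le> A0 T" using t by (auto simp: A1_def A0_def intro!: add_nonneg_nonneg mult_nonneg_nonneg)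
  show "(\<integral>\<^sup>+\<omega>. ennreal ((xN (real n) t \<omega>)\<^sup>2) \<partial>M) \<le> ennreal (Q T)" for n
  proof -
    have "(\<integral>\<^sup>+\<omega>. ennreal ((xN (real n) t \<omega>)\<^sup>2) \<partial>M) \<le> ennreal (2 * A0 T * exp (\<beta>T T * t))"
      by (rule xN_moment[OF t]) simp
    also have "\<dots> \<le> ennreal (Q T)" unfolding Q_def
      using A0 A1 t by (intro ennreal_leI mult_left_mono) (auto simp: \<beta>T_def intro!: mult_left_mono)
    finally show ?thesis .
  qed
qed

lemma x_integrable: "integrable M (x t)"
proof (cases "0 \<le> t")
  case True
  have "integrable M (\<lambda>\<omega>. (x t \<omega>)\<^sup>2)"
    by (rule integrableI_nonneg) (use second_moment[of t t] True in \<open>auto intro: le_less_trans\<close>)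
  then show ?thesis by (rule square_integrable_imp_integrable[OF x_meas])
next
  case False
  then have "integrable M (x t) \<longleftrightarrow> integrable M (\<lambda>_. \<phi> t)"
    by (intro Bochner_Integration.integrable_cong) (auto simp: x_neg)
  then show ?thesis by simp
qed

definition m where "m t = expectation (x t)"

lemma m_neg: "t \<le> 0 \<Longrightarrow> m t = \<phi> t"
proof -
  assume "t \<le> 0"
  then have "m t = expectation (\<lambda>_. \<phi> t)"
    unfolding m_def by (intro Bochner_Integration.integral_cong) (auto simp: x_neg)
  then show ?thesis by (simp add: prob_space)
qed

lemma m_meas[measurable]: "m \<in> borel_measurable borel"
proof -
  have "(\<lambda>(t, \<omega>). x t \<omega>) \<in> borel_measurable (lborel \<Otimes>\<^sub>M M)" using x_joint by simp
  then have "(\<lambda>t. expectation (\<lambda>\<omega>. x t \<omega>)) \<in> borel_measurable lborel"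
    by (rule borel_measurable_lebesgue_integral)
  then show ?thesis by (simp add: m_def[abs_def])
qed

lemma Q_nonneg: "0 \<le> T \<Longrightarrow> 0 \<le> Q T"
  by (auto simp: Q_def A0_def intro!: add_nonneg_nonneg mult_nonneg_nonneg)

text \<open>1 + Q T covers [0,T] by |x| <= 1 + x^2, and \<open>B0\<close> covers the history. One
  bound for all times up to \<open>T\<close> is wanted because the delay integral reaches back
  without limit.\<close>

lemma abs_moment: "t \<le> T \<Longrightarrow> 0 \<le> T \<Longrightarrow> expectation (\<lambda>\<omega>. \<bar>x t \<omega>\<bar>) \<le> 1 + Q T + B0"
proof -
  assume t: "t \<le> T" and T: "0 \<le> T"
  have Q: "0 \<le> Q T" by (rule Q_nonneg[OF T])
  show ?thesis
  proof (cases "0 \<le> t")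
    case True
    then have tT: "t \<in> {0..T}" using t by simp
    have I: "integrable M (\<lambda>\<omega>. (x t \<omega>)\<^sup>2)"
      by (rule integrableI_nonneg) (use second_moment[OF tT] in \<open>auto intro: le_less_trans\<close>)
    have "expectation (\<lambda>\<omega>. (x t \<omega>)\<^sup>2) \<le> Q T"
      using second_moment[OF tT] Q by (subst integral_eq_nn_integral) (auto intro: enn2real_leI)
    moreover have "expectation (\<lambda>\<omega>. \<bar>x t \<omega>\<bar>) \<le> expectation (\<lambda>\<omega>. 1 + (x t \<omega>)\<^sup>2)"
    proof (rule integral_mono)
      fix \<omega>
      have "0 \<le> (\<bar>x t \<omega>\<bar> - 1 / 2)\<^sup>2" by simp
      then show "\<bar>x t \<omega>\<bar> \<le> 1 + (x t \<omega>)\<^sup>2" by (simp add: power2_diff power_divide)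
    qed (use I x_integrable in auto)
    moreover have "expectation (\<lambda>\<omega>. 1 + (x t \<omega>)\<^sup>2) = 1 + expectation (\<lambda>\<omega>. (x t \<omega>)\<^sup>2)" using I by (simp add: prob_space)
    ultimately show ?thesis using B0 by linarith
  next
    case False
    then have "expectation (\<lambda>\<omega>. \<bar>x t \<omega>\<bar>) = expectation (\<lambda>\<omega>. \<bar>\<phi> t\<bar>)"
      by (intro Bochner_Integration.integral_cong) (auto simp: x_neg)
    then have eq: "expectation (\<lambda>\<omega>. \<bar>x t \<omega>\<bar>) = \<bar>\<phi> t\<bar>" by (simp add: prob_space)
    have le: "\<bar>\<phi> t\<bar> \<le> B0" using BC_norm_upper[OF \<phi>, of t] False by simp
    show ?thesis using eq le Q by linarith
  qed
qed

text \<open>Fubini is justified by the bound on the mean of |x| over the entire past, integrated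
  against the density \<open>k\<close>.\<close>

lemma y_mean:
  assumes s: "s \<le> T" and T: "0 \<le> T"
  shows "integrable M (\<lambda>\<omega>. y s \<omega>)" "expectation (\<lambda>\<omega>. y s \<omega>) = (LINT u|lborel. k u * m (s - u))"
    "expectation (\<lambda>\<omega>. \<bar>y s \<omega>\<bar>) \<le> 1 + Q T + B0" "integrable lborel (\<lambda>u. k u * m (s - u))"
proof -
  let ?C = "1 + Q T + B0"
  interpret p: pair_sigma_finite lborel M ..
  have xm: "(\<lambda>p. x (s - fst p) (snd p)) \<in> borel_measurable (lborel \<Otimes>\<^sub>M M)" by (rule x_joint2) measurable
  have fm: "(\<lambda>p. k (fst p) * x (s - fst p) (snd p)) \<in> borel_measurable (lborel \<Otimes>\<^sub>M M)"
    using xm by measurable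
  have am: "(\<lambda>u. k u * expectation (\<lambda>\<omega>. \<bar>x (s - u) \<omega>\<bar>)) \<in> borel_measurable lborel"
  proof -
    have "(\<lambda>p. \<bar>x (s - fst p) (snd p)\<bar>) \<in> borel_measurable (lborel \<Otimes>\<^sub>M M)" using xm by measurable
    then have "(\<lambda>u. expectation (\<lambda>\<omega>. \<bar>x (s - u) \<omega>\<bar>)) \<in> borel_measurable lborel"
      by (intro borel_measurable_lebesgue_integral) (simp add: case_prod_beta)
    then show ?thesis by measurable
  qed
  have IC: "integrable lborel (\<lambda>u. k u * ?C)" using k(1) by simp
  have le: "k u * expectation (\<lambda>\<omega>. \<bar>x (s - u) \<omega>\<bar>) \<le> k u * ?C" for u
    using abs_moment[of "s - u" T] s T k(3)[of u] k(4)[of u] by (cases "u < 0") (auto intro: mult_left_mono)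
  have nn: "0 \<le> k u * expectation (\<lambda>\<omega>. \<bar>x (s - u) \<omega>\<bar>)" for u using k(3)[of u] by simp
  have Ia: "integrable lborel (\<lambda>u. k u * expectation (\<lambda>\<omega>. \<bar>x (s - u) \<omega>\<bar>))"
    by (rule Bochner_Integration.integrable_bound[OF IC am]) (use le nn in \<open>auto intro!: AE_I2 order_trans[OF le abs_ge_self]\<close>)
  have ne: "expectation (\<lambda>\<omega>. norm (k u * x (s - u) \<omega>)) = k u * expectation (\<lambda>\<omega>. \<bar>x (s - u) \<omega>\<bar>)" for u
    using k(3)[of u] by (simp add: abs_mult)
  have I: "integrable (lborel \<Otimes>\<^sub>M M) (\<lambda>(u, \<omega>). k u * x (s - u) \<omega>)"
  proof (rule p.Fubini_integrable)
    show "(\<lambda>(u, \<omega>). k u * x (s - u) \<omega>) \<in> borel_measurable (lborel \<Otimes>\<^sub>M M)" using fm by (simp add: case_prod_beta)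
    show "integrable lborel (\<lambda>u. \<integral>\<omega>. norm (case (u, \<omega>) of (u, \<omega>) \<Rightarrow> k u * x (s - u) \<omega>) \<partial>M)"
      unfolding prod.case ne by (rule Ia)
    show "AE u in lborel. integrable M (\<lambda>\<omega>. case (u, \<omega>) of (u, \<omega>) \<Rightarrow> k u * x (s - u) \<omega>)"
      using x_integrable by simp
  qed
  show "integrable M (\<lambda>\<omega>. y s \<omega>)" unfolding y_eq using p.integrable_snd[OF I] by simp
  show eq: "expectation (\<lambda>\<omega>. y s \<omega>) = (LINT u|lborel. k u * m (s - u))"
    unfolding y_eq using p.Fubini_integral[OF I] by (simp add: m_def)
  show "integrable lborel (\<lambda>u. k u * m (s - u))"
    using p.integrable_fst[OF I] by (simp add: m_def)
  have Iabs: "integrable (lborel \<Otimes>\<^sub>M M) (\<lambda>(u, \<omega>). norm (k u * x (s - u) \<omega>))"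
    using integrable_norm[OF I] by (simp only: split_def)
  have "expectation (\<lambda>\<omega>. \<bar>y s \<omega>\<bar>) \<le> expectation (\<lambda>\<omega>. LINT u|lborel. norm (k u * x (s - u) \<omega>))"
  proof (rule integral_mono)
    show "integrable M (\<lambda>\<omega>. \<bar>y s \<omega>\<bar>)" unfolding y_eq using p.integrable_snd[OF I] by simp
    show "integrable M (\<lambda>\<omega>. LINT u|lborel. norm (k u * x (s - u) \<omega>))" using p.integrable_snd[OF Iabs] by simp
    show "\<bar>y s \<omega>\<bar> \<le> (LINT u|lborel. norm (k u * x (s - u) \<omega>))" for \<omega>
      unfolding y_eq real_norm_def[symmetric] by (rule integral_norm_bound)
  qed
  also have "\<dots> = (LINT u|lborel. k u * expectation (\<lambda>\<omega>. \<bar>x (s - u) \<omega>\<bar>))"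
    unfolding ne[symmetric] by (rule p.Fubini_integral[OF Iabs])
  also have "\<dots> \<le> (LINT u|lborel. k u * ?C)" by (rule integral_mono[OF Ia IC le])
  also have "\<dots> = ?C" using k(2) by simp
  finally show "expectation (\<lambda>\<omega>. \<bar>y s \<omega>\<bar>) \<le> ?C" .
qed

lemma drift_mean:
  assumes t: "0 \<le> t"
  shows "integrable M (\<lambda>\<omega>. LINT s:{0..t}|lborel. dr s \<omega>)"
    "expectation (\<lambda>\<omega>. LINT s:{0..t}|lborel. dr s \<omega>) = (LINT s:{0..t}|lborel. a * m s + b * (LINT u|lborel. k u * m (s - u)))"
proof -
  let ?C = "(\<bar>a\<bar> + \<bar>b\<bar>) * (1 + Q t + B0)"
  interpret p: pair_sigma_finite lborel M ..
  have dm: "(\<lambda>p. dr (fst p) (snd p)) \<in> borel_measurable (lborel \<Otimes>\<^sub>M M)" by (rule dr_joint2) measurable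
  have fm: "(\<lambda>(s, \<omega>). indicator {0..t} s * dr s \<omega>) \<in> borel_measurable (lborel \<Otimes>\<^sub>M M)"
    unfolding case_prod_beta using dm by measurable
  have Idr: "integrable M (\<lambda>\<omega>. dr s \<omega>)" if "s \<le> t" for s
    unfolding dr_def using x_integrable[of s] y_mean(1)[OF that t] by simp
  have dr_le: "expectation (\<lambda>\<omega>. \<bar>dr s \<omega>\<bar>) \<le> ?C" if s: "s \<le> t" for s
  proof -
    have "expectation (\<lambda>\<omega>. \<bar>dr s \<omega>\<bar>) \<le> expectation (\<lambda>\<omega>. \<bar>a\<bar> * \<bar>x s \<omega>\<bar> + \<bar>b\<bar> * \<bar>y s \<omega>\<bar>)"
      using Idr[OF s] x_integrable[of s] y_mean(1)[OF s t]
      by (intro integral_mono) (auto simp: dr_def abs_mult[symmetric])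
    also have "\<dots> = \<bar>a\<bar> * expectation (\<lambda>\<omega>. \<bar>x s \<omega>\<bar>) + \<bar>b\<bar> * expectation (\<lambda>\<omega>. \<bar>y s \<omega>\<bar>)"
      using x_integrable[of s] y_mean(1)[OF s t] by simp
    also have "\<dots> \<le> \<bar>a\<bar> * (1 + Q t + B0) + \<bar>b\<bar> * (1 + Q t + B0)"
      using abs_moment[OF s t] y_mean(3)[OF s t] by (intro add_mono mult_left_mono) auto
    finally show ?thesis by (simp add: distrib_right)
  qed
  have I: "integrable (lborel \<Otimes>\<^sub>M M) (\<lambda>(s, \<omega>). indicator {0..t} s * dr s \<omega>)"
  proof (rule p.Fubini_integrable[OF fm])
    have "integrable lborel (\<lambda>s. indicator {0..t} s *\<^sub>R ?C)"
      using borel_integrable_atLeastAtMost'[of 0 t "\<lambda>_. ?C"] unfolding set_integrable_def by simp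
    then show "integrable lborel (\<lambda>s. \<integral>\<omega>. norm (case (s, \<omega>) of (s, \<omega>) \<Rightarrow> indicator {0..t} s * dr s \<omega>) \<partial>M)"
    proof (rule Bochner_Integration.integrable_bound)
      show "(\<lambda>s. \<integral>\<omega>. norm (case (s, \<omega>) of (s, \<omega>) \<Rightarrow> indicator {0..t} s * dr s \<omega>) \<partial>M) \<in> borel_measurable lborel"
        using measurable_compose[OF fm borel_measurable_norm] by (intro borel_measurable_lebesgue_integral) (simp add: split_def)
      show "AE s in lborel. norm (\<integral>\<omega>. norm (case (s, \<omega>) of (s, \<omega>) \<Rightarrow> indicator {0..t} s * dr s \<omega>) \<partial>M) \<le> norm (indicator {0..t} s *\<^sub>R ?C)"
      proof (rule AE_I2)
        fix s show "norm (\<integral>\<omega>. norm (case (s, \<omega>) of (s, \<omega>) \<Rightarrow> indicator {0..t} s * dr s \<omega>) \<partial>M) \<le> norm (indicator {0..t} s *\<^sub>R ?C)"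
          using dr_le[of s] by (cases "s \<in> {0..t}") auto
      qed
    qed
    show "AE s in lborel. integrable M (\<lambda>\<omega>. case (s, \<omega>) of (s, \<omega>) \<Rightarrow> indicator {0..t} s * dr s \<omega>)"
    proof (rule AE_I2)
      fix s show "integrable M (\<lambda>\<omega>. case (s, \<omega>) of (s, \<omega>) \<Rightarrow> indicator {0..t} s * dr s \<omega>)"
        using Idr[of s] by (cases "s \<in> {0..t}") auto
    qed
  qed
  show "integrable M (\<lambda>\<omega>. LINT s:{0..t}|lborel. dr s \<omega>)"
    using p.integrable_snd[OF I] by (simp add: set_lebesgue_integral_def)
  have "expectation (\<lambda>\<omega>. LINT s|lborel. indicator {0..t} s * dr s \<omega>) = (LINT s|lborel. expectation (\<lambda>\<omega>. indicator {0..t} s * dr s \<omega>))"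
    by (rule p.Fubini_integral[OF I])
  also have "\<dots> = (LINT s|lborel. indicator {0..t} s * (a * m s + b * (LINT u|lborel. k u * m (s - u))))"
  proof (intro Bochner_Integration.integral_cong refl)
    fix s
    show "expectation (\<lambda>\<omega>. indicator {0..t} s * dr s \<omega>) = indicator {0..t} s * (a * m s + b * (LINT u|lborel. k u * m (s - u)))"
      using x_integrable[of s] y_mean(1,2)[of s t] t by (cases "s \<in> {0..t}") (auto simp: dr_def m_def)
  qed
  finally show "expectation (\<lambda>\<omega>. LINT s:{0..t}|lborel. dr s \<omega>) = (LINT s:{0..t}|lborel. a * m s + b * (LINT u|lborel. k u * m (s - u)))"
    by (simp add: set_lebesgue_integral_def)
qed

text \<open>Integrability of \<open>J\<close> makes its truncations converge in mean. The bound
  \<open>Bt\<close> must be free of \<open>N\<close> for the limit, which is what the uniform moment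
  bound was proved for; the probability of exit vanishes by boundedness of each path on
  [0,t].\<close>

lemma ito_integral_mean:
  assumes t: "0 < t" and J: "has_ito_integral M F W H t J" and JI: "integrable M J"
  shows "expectation J = 0"
proof -
  have [measurable]: "J \<in> borel_measurable M" using JI by simp
  define Bt where "Bt = Bd (2 * A0 t) (\<beta>T t) t"
  have A: "0 \<le> A1 t" "0 \<le> A0 t" using t by (auto simp: A1_def A0_def intro!: add_nonneg_nonneg mult_nonneg_nonneg)
  have V: "0 \<le> 2 * A0 t" "0 < \<beta>T t" using A by (auto simp: \<beta>T_def)
  have Bt: "0 \<le> Bt" unfolding Bt_def using V t by (intro Bd_nonneg) auto
  let ?JN = "\<lambda>n \<omega>. if below (real n) t \<omega> then J \<omega> else 0"
  let ?P = "\<lambda>n. {\<omega>\<in>space M. \<not> below (real n) t \<omega>}"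
  have lim_J: "(\<lambda>n. expectation (?JN n)) \<longlonglongrightarrow> expectation J"
  proof (rule integral_dominated_convergence[where w="\<lambda>\<omega>. \<bar>J \<omega>\<bar>"])
    show "AE \<omega> in M. (\<lambda>n. ?JN n \<omega>) \<longlonglongrightarrow> J \<omega>"
    proof (rule AE_I2, rule tendsto_eventually)
      fix \<omega> assume "\<omega> \<in> space M"
      from eventually_below[OF this less_imp_le[OF t]] show "\<forall>\<^sub>F n in sequentially. ?JN n \<omega> = J \<omega>" by eventually_elim simp
    qed
  qed (use JI in auto)
  have lim_P: "(\<lambda>n. prob (?P n)) \<longlonglongrightarrow> 0"
  proof -
    have "(\<lambda>n. expectation (indicator (?P n) :: 'a \<Rightarrow> real)) \<longlonglongrightarrow> expectation (\<lambda>_. 0)"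
    proof (rule integral_dominated_convergence[where w="\<lambda>_. 1"])
      show "AE \<omega> in M. (\<lambda>n. indicator (?P n) \<omega> :: real) \<longlonglongrightarrow> 0"
      proof (rule AE_I2, rule tendsto_eventually)
        fix \<omega> assume "\<omega> \<in> space M"
        from eventually_below[OF this less_imp_le[OF t]] show "\<forall>\<^sub>F n in sequentially. (indicator (?P n) \<omega> :: real) = 0" by eventually_elim simp
      qed
    qed (auto simp: indicator_def)
    then show ?thesis by simp
  qed
  have "\<bar>expectation J\<bar> \<le> 0"
  proof (rule real_le_of_add_mult_le)
    show "0 \<le> 7 * Bt" using Bt by simp
    fix c :: real assume c: "0 < c"
    have "(\<lambda>n. 7 * c * Bt + prob (?P n) / (4 * c)) \<longlonglongrightarrow> 7 * c * Bt + 0 / (4 * c)"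
      by (intro tendsto_intros lim_P) (use c in auto)
    moreover have "(\<lambda>n. \<bar>expectation (?JN n)\<bar>) \<longlonglongrightarrow> \<bar>expectation J\<bar>" by (intro tendsto_rabs lim_J)
    moreover have "\<bar>expectation (?JN n)\<bar> \<le> 7 * c * Bt + prob (?P n) / (4 * c)" for n
      unfolding Bt_def by (rule ito_mean[OF t order_refl J V xN_moment c]) auto
    ultimately have "\<bar>expectation J\<bar> \<le> 7 * c * Bt + 0 / (4 * c)"
      by (intro LIMSEQ_le[of "\<lambda>n. \<bar>expectation (?JN n)\<bar>" _ "\<lambda>n. 7 * c * Bt + prob (?P n) / (4 * c)"]) auto
    then show "\<bar>expectation J\<bar> \<le> 0 + c * (7 * Bt)" by (simp add: mult_ac)
  qed
  then show ?thesis by simp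
qed

text \<open>Integrability of \<open>J\<close> is read off the equation: almost everywhere it is a
  difference of integrable variables. Its mean is then 0, and expectations can be taken term by
  term.\<close>

lemma m_equation:
  assumes t: "0 \<le> t"
  shows "m t = \<phi> 0 + (LINT s:{0..t}|lborel. a * m s + b * (LINT u|lborel. k u * m (s - u)))"
proof (cases "t = 0")
  case True
  have "(LINT s:{0..0::real}|lborel. f s) = 0" for f :: "real \<Rightarrow> real"
    unfolding set_lebesgue_integral_def
    by (rule integral_eq_zero_AE) (use AE_lborel_singleton[of 0] in eventually_elim, auto simp: indicator_def)
  then show ?thesis using True m_neg[of 0] by simp
next
  case False
  then have t': "0 < t" using t by simp
  obtain J where J: "has_ito_integral M F W H t J"
    and eq: "AE \<omega> in M. x t \<omega> = \<phi> 0 + (LINT s:{0..t}|lborel. dr s \<omega>) + J \<omega>"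
    using ito[OF t] unfolding dr_def by auto
  have Jm[measurable]: "J \<in> borel_measurable M" using J by (simp add: has_ito_integral_def)
  note ID = drift_mean[OF t]
  have Id: "integrable M (\<lambda>\<omega>. x t \<omega> - \<phi> 0 - (LINT s:{0..t}|lborel. dr s \<omega>))"
    using x_integrable[of t] ID(1) by simp
  have ae: "AE \<omega> in M. J \<omega> = x t \<omega> - \<phi> 0 - (LINT s:{0..t}|lborel. dr s \<omega>)"
    using eq by eventually_elim simp
  have JI: "integrable M J"
    using integrable_cong_AE[OF Jm borel_measurable_integrable[OF Id] ae] Id by simp
  have "0 = expectation J" using ito_integral_mean[OF t' J JI] by simp
  also have "\<dots> = expectation (\<lambda>\<omega>. x t \<omega> - \<phi> 0 - (LINT s:{0..t}|lborel. dr s \<omega>))"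
    by (rule integral_cong_AE[OF Jm borel_measurable_integrable[OF Id] ae])
  also have "\<dots> = m t - \<phi> 0 - (LINT s:{0..t}|lborel. a * m s + b * (LINT u|lborel. k u * m (s - u)))"
    using x_integrable[of t] ID by (simp add: m_def prob_space)
  finally show ?thesis by simp
qed

lemma m_bound: "t \<le> T \<Longrightarrow> 0 \<le> T \<Longrightarrow> \<bar>m t\<bar> \<le> 1 + Q T + B0"
  unfolding m_def using abs_moment[of t T] integral_abs_bound[of M "x t"] by linarith

end

section \<open>The moment bound\<close>

lemma ereal_less_dense2:
  fixes X :: ereal
  assumes "X < ereal \<alpha>"
  obtains c where "X < ereal c" "c < \<alpha>"
  using assms ereal_dense2[of X "ereal \<alpha>"] by auto

text \<open>Every \<open>z\<close> with Re z >= c lies in the domain of the transform because c > -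
  \<nu>; a zero there would count in \<open>alpha0\<close> and force Re z < c.\<close>

lemma volterra_kernel_of_alpha0:
  assumes K: "delay_kernel K" and \<nu>: "0 < \<nu>" "finite_exp_moment K \<nu>"
    and c: "alpha0 a b K < ereal c" "- \<nu> < c" "c < \<alpha>"
  shows "volterra_kernel (\<lambda>u. indicator {0..} u * K u) a b \<nu> c \<alpha>"
proof
  let ?k = "\<lambda>u. indicator {0..} u * K u"
  have I: "integrable lborel (\<lambda>t. exp (\<nu> * t) * ?k t)"
    using \<nu>(2) by (simp add: finite_exp_moment_def set_integrable_def mult.left_commute)
  show "integrable lborel (\<lambda>t. exp (\<nu> * t) * ?k t)" by (rule I)
  show neg: "\<And>t. t < 0 \<Longrightarrow> ?k t = 0" by simp
  show "0 \<le> \<nu>" "- \<nu> < c" "c < \<alpha>" using \<nu> c by auto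
  fix z :: complex assume z: "c \<le> Re z"
  have I': "integrable lborel (\<lambda>t. exp (- (- \<nu>) * t) *\<^sub>R complex_of_real (?k t))"
    using integrable_of_real[OF I, where 'a=complex] by (simp add: scaleR_conv_of_real)
  have eq: "indicator {0..} t *\<^sub>R (exp (- z * of_real t) * of_real (K t)) = exp (- z * of_real t) * complex_of_real (?k t)" for t
    by (simp add: scaleR_conv_of_real mult_ac)
  have dom: "z \<in> laplace_domain K"
    unfolding laplace_domain_def set_integrable_def mem_Collect_eq eq
    by (rule bilaplace_integrable(1)[OF I']) (use z c in auto)
  have "laplace_real ?k z = laplace K z"
    unfolding laplace_def set_lebesgue_integral_def eq bilaplace_def ..
  moreover have "char_fun a b K z \<noteq> 0"
  proof
    assume "char_fun a b K z = 0"
    then have "ereal (Re z) \<le> alpha0 a b K"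
      unfolding alpha0_def using dom by (intro SUP_upper) auto
    then have "ereal (Re z) < ereal c" using c(1) by (rule le_less_trans)
    then show False using z by simp
  qed
  ultimately show "z - of_real a - of_real b * laplace_real ?k z \<noteq> 0"
    by (simp only: char_fun_def not_False_eq_True)
qed

text \<open>As \<open>g = 0\<close>, the last parameter only has to satisfy \<open>- \<mu> < \<alpha>\<close>.\<close>

lemma fundamental_solution_volterra:
  assumes K: "delay_kernel K" and X: "fundamental_solution a b K X" and V: "volterra_kernel (\<lambda>u. indicator {0..} u * K u) a b \<nu> c \<alpha>"
  shows "volterra_solution (\<lambda>u. indicator {0..} u * K u) a b \<nu> c \<alpha> X (\<lambda>_. 0) 1 0 (1 - \<alpha>)"
proof -
  let ?k = "\<lambda>u. indicator {0..} u * K u"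
  interpret volterra_kernel ?k a b \<nu> c \<alpha> by (rule V)
  have X0: "X 0 = 1" and Xneg: "\<And>t. t < 0 \<Longrightarrow> X t = 0"
    and Xd: "\<And>t. 0 \<le> t \<Longrightarrow> (X has_real_derivative (a * X t + b * delay_term K X t)) (at t within {0..})"
    using X by (auto simp: fundamental_solution_def)
  have cont: "continuous_on {0..} X"
    using Xd by (intro DERIV_continuous_on) auto
  have [measurable]: "X \<in> borel_measurable borel"
  proof -
    have "(\<lambda>t. if t \<in> {0..} then X t else 0) \<in> borel_measurable borel"
      by (intro borel_measurable_continuous_on_if cont continuous_intros) auto
    moreover have "(\<lambda>t. if t \<in> {0..} then X t else 0) = X" using Xneg by auto
    ultimately show ?thesis by simp
  qed
  have bd: "\<exists>B. \<forall>t\<in>{0..T}. \<bar>X t\<bar> \<le> B" for T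
  proof -
    have "bounded (X ` {0..T})"
      by (intro compact_imp_bounded compact_continuous_image continuous_on_subset[OF cont]) auto
    then show ?thesis by (auto simp: bounded_iff)
  qed
  have conv: "delay_term K X t = convolution ?k X t" for t
    by (simp add: delay_term_def set_lebesgue_integral_def convolution_def mult.assoc)
  have "X t = 1 + (LINT s:{0..t}|lborel. a * X s + b * convolution ?k X s + b * 0)" if t: "0 \<le> t" for t
  proof -
    let ?n = "\<lambda>s. a * X s + b * convolution ?k X s"
    obtain B where B: "\<And>s. s \<in> {0..t} \<Longrightarrow> \<bar>X s\<bar> \<le> B" using bd by blast
    have B0: "0 \<le> B" using B[of 0] t by force
    have "\<bar>?n s\<bar> \<le> \<bar>a\<bar> * B + \<bar>b\<bar> * (\<rho> * B)" if s: "s \<in> {0..t}" for s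
    proof -
      \<comment> \<open>The rate 0 turns the exponential bound into plain boundedness.\<close>
      have "\<bar>convolution ?k X s\<bar> \<le> \<rho> * (B * exp (0 * s))"
        by (rule convolution_exp_bound[of X t]) (use B B0 s Xneg in auto)
      then have "\<bar>a\<bar> * \<bar>X s\<bar> + \<bar>b\<bar> * \<bar>convolution ?k X s\<bar> \<le> \<bar>a\<bar> * B + \<bar>b\<bar> * (\<rho> * B)"
        using B[OF s] by (intro add_mono mult_left_mono) auto
      then show ?thesis by (simp add: abs_mult[symmetric])
    qed
    then have I: "set_integrable lborel {0..t} ?n"
      by (intro set_integral_upper_limit(1)) auto
    have "(?n has_integral X t - X 0) {0..t}"
    proof (rule fundamental_theorem_of_calculus[OF t])
      fix s assume s: "s \<in> {0..t}"
      then have "(X has_real_derivative ?n s) (at s within {0..})" using Xd[of s] by (simp add: conv)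
      then have "(X has_real_derivative ?n s) (at s within {0..t})" by (rule DERIV_subset) auto
      then show "(X has_vector_derivative ?n s) (at s within {0..t})"
        by (simp add: has_real_derivative_iff_has_vector_derivative)
    qed
    then have "(LINT s:{0..t}|lborel. ?n s) = X t - X 0"
      using set_borel_integral_eq_integral(2)[OF I] by (simp add: integral_unique)
    then show ?thesis using X0 by simp
  qed
  then show ?thesis
    by unfold_locales (use Xneg bd in auto)
qed

context sde_solution
begin

text \<open>The mean is cut off at time 0; the initial function enters through the forcing \<open>g\<close>.\<close>

lemma mean_volterra:
  assumes V: "volterra_kernel k a b \<nu> c \<alpha>" and \<mu>: "0 < \<mu>" "finite_exp_moment K \<mu>" "- \<mu> < \<alpha>"
  shows "\<exists>g. volterra_solution k a b \<nu> c \<alpha> (\<lambda>t. if 0 \<le> t then m t else 0) g (\<phi> 0) (B0 * exp_moment K \<mu>) \<mu>"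
proof -
  interpret volterra_kernel k a b \<nu> c \<alpha> by (rule V)
  define mp where "mp t = (if 0 \<le> t then m t else 0)" for t
  \<comment> \<open>The difference of \<open>m\<close> and \<open>mp\<close> is \<phi> at negative
    times and 0 elsewhere, so this is the part of the delay integral that reaches back before time
    0.\<close>
  define g where "g s = (if 0 \<le> s then LINT u|lborel. k u * (m (s - u) - mp (s - u)) else 0)" for s
  have [measurable]: "mp \<in> borel_measurable borel" unfolding mp_def[abs_def] by measurable
  have Ik: "integrable lborel (\<lambda>u. exp (\<mu> * u) * k u)" and rho: "(LINT u|lborel. exp (\<mu> * u) * k u) = exp_moment K \<mu>"
    using \<mu>(2) by (simp_all add: finite_exp_moment_def exp_moment_def set_integrable_def set_lebesgue_integral_def k_def[abs_def] mult.left_commute)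
  have g_meas: "g \<in> borel_measurable borel" unfolding g_def[abs_def] by measurable
  have mp_le: "\<bar>mp r\<bar> \<le> \<bar>m r\<bar>" for r by (simp add: mp_def)
  have split: "convolution k mp s + g s = (LINT u|lborel. k u * m (s - u))" if s: "0 \<le> s" for s
  proof -
    have I: "integrable lborel (\<lambda>u. k u * m (s - u))" by (rule y_mean(4)[OF order_refl s])
    have I': "integrable lborel (\<lambda>u. k u * mp (s - u))"
      by (rule Bochner_Integration.integrable_bound[OF I])
        (use mp_le in \<open>auto simp: abs_mult intro!: AE_I2 mult_left_mono\<close>)
    have "g s = (LINT u|lborel. k u * m (s - u) - k u * mp (s - u))" using s by (simp add: g_def right_diff_distrib)
    also have "\<dots> = (LINT u|lborel. k u * m (s - u)) - convolution k mp s"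
      unfolding convolution_def by (rule Bochner_Integration.integral_diff[OF I I'])
    finally show ?thesis by simp
  qed
  have g_le: "\<bar>g s\<bar> \<le> B0 * exp_moment K \<mu> * exp (- \<mu> * s)" if s: "0 \<le> s" for s
  proof -
    have "\<bar>LINT u|lborel. k u * (m (s - u) - mp (s - u))\<bar> \<le> (LINT u|lborel. (B0 * exp (- \<mu> * s)) * (exp (\<mu> * u) * k u))"
    proof (rule integral_abs_le)
      show "integrable lborel (\<lambda>u. (B0 * exp (- \<mu> * s)) * (exp (\<mu> * u) * k u))" using Ik by simp
      fix u
      show "\<bar>k u * (m (s - u) - mp (s - u))\<bar> \<le> (B0 * exp (- \<mu> * s)) * (exp (\<mu> * u) * k u)"
      proof (cases "0 \<le> s - u")
        case True
        then show ?thesis using B0 k(3)[of u] by (simp add: mp_def)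
      next
        case False
        then have "\<bar>m (s - u) - mp (s - u)\<bar> \<le> B0 * 1"
          using m_neg[of "s - u"] BC_norm_upper[OF \<phi>, of "s - u"] by (simp add: mp_def)
        \<comment> \<open>Here u > s, so a factor exp (\<mu> (u - s)) >= 1 can be inserted; it
          separates into the decay exp (- \<mu> s) and the weight of the exponential moment.\<close>
        also have "\<dots> \<le> B0 * exp (\<mu> * (u - s))" using False \<mu> B0 by (intro mult_left_mono) auto
        finally have "k u * \<bar>m (s - u) - mp (s - u)\<bar> \<le> k u * (B0 * exp (\<mu> * (u - s)))"
          using k(3)[of u] by (intro mult_left_mono) auto
        also have "\<dots> = (B0 * exp (- \<mu> * s)) * (exp (\<mu> * u) * k u)"
          by (simp add: right_diff_distrib exp_diff exp_minus field_simps)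
        finally show ?thesis using k(3)[of u] by (simp add: abs_mult)
      qed
    qed
    also have "\<dots> = B0 * exp (- \<mu> * s) * exp_moment K \<mu>" using rho by simp
    finally show ?thesis using s by (simp add: g_def mult_ac)
  qed
  have eq: "mp t = \<phi> 0 + (LINT s:{0..t}|lborel. a * mp s + b * convolution k mp s + b * g s)" if t: "0 \<le> t" for t
  proof -
    have "(LINT s:{0..t}|lborel. a * m s + b * (LINT u|lborel. k u * m (s - u))) = (LINT s:{0..t}|lborel. a * mp s + b * convolution k mp s + b * g s)"
    proof (rule set_lebesgue_integral_cong)
      show "\<forall>s. s \<in> {0..t} \<longrightarrow> a * m s + b * (LINT u|lborel. k u * m (s - u)) = a * mp s + b * convolution k mp s + b * g s"
      proof (intro allI impI)
        fix s assume "s \<in> {0..t}"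
        then have s: "0 \<le> s" by simp
        show "a * m s + b * (LINT u|lborel. k u * m (s - u)) = a * mp s + b * convolution k mp s + b * g s"
          unfolding split[OF s, symmetric] using s by (simp add: mp_def[of s] distrib_left)
      qed
    qed simp
    then show ?thesis using m_equation[OF t] t by (simp add: mp_def[of t])
  qed
  have bd: "\<exists>B. \<forall>t\<in>{0..T}. \<bar>mp t\<bar> \<le> B" for T
  proof (cases "0 \<le> T")
    case True
    then show ?thesis using m_bound[of _ T] by (intro exI[of _ "1 + Q T + B0"]) (auto simp: mp_def)
  qed auto
  have "volterra_solution k a b \<nu> c \<alpha> mp g (\<phi> 0) (B0 * exp_moment K \<mu>) \<mu>"
    using g_meas g_le \<mu> bd eq by unfold_locales (auto simp: mp_def[of "t" for t] g_def[of "t" for t])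
  then show ?thesis unfolding mp_def[abs_def] by blast
qed

end

text \<open>A single \<nu> produces \<open>C\<close>; any other \<mu> enters through the forcing
  only. Hence \<open>C\<close> can precede the quantifier over \<mu>, as it must if
  \<open>C\<^sub>1\<close> is to depend on \<alpha> alone.\<close>

lemma uniform_moment_bound:
  fixes \<alpha> :: real and M :: "'w measure"
  assumes K: "delay_kernel K" and X: "fundamental_solution a b K X" and W: "wiener_process M F W"
    and \<nu>: "0 < \<nu>" "finite_exp_moment K \<nu>" "max (alpha0 a b K) (ereal (- \<nu>)) < ereal \<alpha>"
  shows "\<exists>C>0. (\<forall>t\<ge>0. \<bar>X t\<bar> \<le> C * exp (\<alpha> * t)) \<and>
    (\<forall>\<mu>. 0 < \<mu> \<longrightarrow> finite_exp_moment K \<mu> \<longrightarrow> - \<mu> < \<alpha> \<longrightarrow>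
      (\<forall>\<phi>\<in>BC_neg. \<forall>x. stochastic_solution M F W a b \<sigma>0 \<sigma>1 \<sigma>2 K \<phi> x \<longrightarrow>
        (\<forall>t\<ge>0. integrable M (x t) \<and> \<bar>prob_space.expectation M (x t)\<bar>
          \<le> C * (1 + 2 * exp_moment K \<mu> / \<bar>\<alpha> + \<mu>\<bar>) * BC_norm \<phi> * exp (\<alpha> * t))))"
proof -
  \<comment> \<open>A real number strictly below \<alpha> leaves room to the left of the line Re z =
    \<alpha>, both for holomorphy and for the auxiliary pole.\<close>
  obtain c where "max (alpha0 a b K) (ereal (- \<nu>)) < ereal c" and c: "c < \<alpha>"
    using ereal_less_dense2[OF \<nu>(3)] by blast
  then have c': "alpha0 a b K < ereal c" "- \<nu> < c" by auto
  let ?k = "\<lambda>u. indicator {0..} u * K u"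
  have V: "volterra_kernel ?k a b \<nu> c \<alpha>"
    by (rule volterra_kernel_of_alpha0[OF K \<nu>(1,2) c' c])
  then interpret V: volterra_kernel ?k a b \<nu> c \<alpha> .
  obtain C where C: "C > 0"
    "\<And>m g m0 D \<mu> t. volterra_solution ?k a b \<nu> c \<alpha> m g m0 D \<mu> \<Longrightarrow> 0 \<le> t \<Longrightarrow>
        \<bar>m t\<bar> \<le> C * exp (\<alpha> * t) * (\<bar>m0\<bar> + \<bar>b\<bar> * (D / (\<alpha> + \<mu>)))"
    using V.volterra_bound by blast
  \<comment> \<open>the delay term yields the factor $|b|\,\rho/(\alpha+\mu)$, the claim has $2\rho/(\alpha+\mu)$\<close>
  define C1 where "C1 = C * max 1 \<bar>b\<bar>"
  have C1: "0 < C1" "C \<le> C1" "C * \<bar>b\<bar> \<le> C1" using C(1) by (auto simp: C1_def)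
  show ?thesis
  proof (intro exI[of _ C1] conjI allI ballI impI)
    show "0 < C1" by (rule C1)
    fix t :: real assume t: "0 \<le> t"
    have "\<bar>X t\<bar> \<le> C * exp (\<alpha> * t)"
      using C(2)[OF fundamental_solution_volterra[OF K X V] t] by simp
    also have "\<dots> \<le> C1 * exp (\<alpha> * t)" using C1 by simp
    finally show "\<bar>X t\<bar> \<le> C1 * exp (\<alpha> * t)" .
  next
    fix \<mu> \<phi> x and t :: real
    assume \<mu>: "0 < \<mu>" "finite_exp_moment K \<mu>" "- \<mu> < \<alpha>" and \<phi>: "\<phi> \<in> BC_neg"
      and sol: "stochastic_solution M F W a b \<sigma>0 \<sigma>1 \<sigma>2 K \<phi> x" and t: "0 \<le> t"
    interpret S: sde_solution M F W a b \<sigma>0 \<sigma>1 \<sigma>2 K \<phi> x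
      using W K \<phi> sol by unfold_locales auto
    show "integrable M (x t)" by (rule S.x_integrable)
    have kk: "S.k = ?k" by (intro ext) (simp add: S.k_def)
    obtain g where g: "volterra_solution ?k a b \<nu> c \<alpha> (\<lambda>t. if 0 \<le> t then S.m t else 0) g (\<phi> 0) (BC_norm \<phi> * exp_moment K \<mu>) \<mu>"
      using S.mean_volterra[unfolded kk, OF V \<mu>] by blast
    let ?\<rho> = "exp_moment K \<mu>" and ?B = "BC_norm \<phi>"
    have am: "0 < \<alpha> + \<mu>" using \<mu> by simp
    have \<rho>: "0 \<le> ?\<rho>"
      unfolding exp_moment_def set_lebesgue_integral_def using K
      by (intro Bochner_Integration.integral_nonneg) (auto simp: delay_kernel_def indicator_def)
    have B: "0 \<le> ?B" by (rule BC_norm_nonneg[OF \<phi>])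
    have "\<bar>prob_space.expectation M (x t)\<bar> = \<bar>S.m t\<bar>" by (simp add: S.m_def)
    also have "\<dots> \<le> C * exp (\<alpha> * t) * (\<bar>\<phi> 0\<bar> + \<bar>b\<bar> * (?B * ?\<rho> / (\<alpha> + \<mu>)))"
      using C(2)[OF g t] t by simp
    also have "\<dots> \<le> C * exp (\<alpha> * t) * (?B + \<bar>b\<bar> * (?B * ?\<rho> / (\<alpha> + \<mu>)))"
      using C(1) BC_norm_upper[OF \<phi>, of 0] by (intro mult_left_mono add_right_mono) auto
    also have "\<dots> = (C + C * \<bar>b\<bar> * (?\<rho> / (\<alpha> + \<mu>))) * (?B * exp (\<alpha> * t))"
      by (simp add: algebra_simps)
    also have "\<dots> \<le> (C1 + C1 * (2 * ?\<rho> / (\<alpha> + \<mu>))) * (?B * exp (\<alpha> * t))"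
    proof (intro mult_right_mono add_mono C1 mult_mono)
      show "?\<rho> / (\<alpha> + \<mu>) \<le> 2 * ?\<rho> / (\<alpha> + \<mu>)" using am \<rho> by (intro divide_right_mono) auto
    qed (use C1 am \<rho> B C(1) in auto)
    also have "\<dots> = C1 * (1 + 2 * ?\<rho> / \<bar>\<alpha> + \<mu>\<bar>) * ?B * exp (\<alpha> * t)"
      using am by (simp add: algebra_simps)
    finally show "\<bar>prob_space.expectation M (x t)\<bar> \<le> C1 * (1 + 2 * ?\<rho> / \<bar>\<alpha> + \<mu>\<bar>) * ?B * exp (\<alpha> * t)" .
  qed
qed

theorem theorem3p3:
  fixes a b \<sigma>0 \<sigma>1 \<sigma>2 :: real and K X :: "real \<Rightarrow> real"
    and M :: "'w measure" and F :: "real \<Rightarrow> 'w measure" and W :: "real \<Rightarrow> 'w \<Rightarrow> real"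
  assumes "delay_kernel K" and "\<exists>\<mu>>0. finite_exp_moment K \<mu>"
    and "fundamental_solution a b K X"
    and "wiener_process M F W"
  shows "(\<exists>(C\<^sub>1 :: real \<Rightarrow> real) (K\<^sub>1 :: real \<Rightarrow> real \<Rightarrow> real). \<forall>\<mu> \<alpha>.
            0 < \<mu> \<and> finite_exp_moment K \<mu> \<and> max (alpha0 a b K) (ereal (- \<mu>)) < ereal \<alpha> \<longrightarrow>
              0 < C\<^sub>1 \<alpha> \<and>
              (\<forall>t\<ge>0. \<bar>X t\<bar> \<le> C\<^sub>1 \<alpha> * exp (\<alpha> * t)) \<and>
              K\<^sub>1 \<alpha> \<mu> = C\<^sub>1 \<alpha> * (1 + 2 * exp_moment K \<mu> / \<bar>\<alpha> + \<mu>\<bar>) \<and>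
              (\<forall>\<phi>\<in>BC_neg. \<forall>x. stochastic_solution M F W a b \<sigma>0 \<sigma>1 \<sigma>2 K \<phi> x \<longrightarrow>
                (\<forall>t\<ge>0. integrable M (x t) \<and>
                  \<bar>prob_space.expectation M (x t)\<bar> \<le> K\<^sub>1 \<alpha> \<mu> * BC_norm \<phi> * exp (\<alpha> * t))))
       \<and> (alpha0 a b K < 0 \<longrightarrow> first_moment_exponentially_stable M F W a b \<sigma>0 \<sigma>1 \<sigma>2 K)"
proof -
  define good where "good \<alpha> C \<longleftrightarrow> 0 < C \<and> (\<forall>t\<ge>0. \<bar>X t\<bar> \<le> C * exp (\<alpha> * t)) \<and>
    (\<forall>\<mu>. 0 < \<mu> \<longrightarrow> finite_exp_moment K \<mu> \<longrightarrow> - \<mu> < \<alpha> \<longrightarrow>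
      (\<forall>\<phi>\<in>BC_neg. \<forall>x. stochastic_solution M F W a b \<sigma>0 \<sigma>1 \<sigma>2 K \<phi> x \<longrightarrow>
        (\<forall>t\<ge>0. integrable M (x t) \<and> \<bar>prob_space.expectation M (x t)\<bar>
          \<le> C * (1 + 2 * exp_moment K \<mu> / \<bar>\<alpha> + \<mu>\<bar>) * BC_norm \<phi> * exp (\<alpha> * t))))" for \<alpha> C
  \<comment> \<open>The choice sees \<alpha> only, so the witness has to be good for all admissible
    \<mu> at once; this is why \<open>good\<close> quantifies over \<mu>.\<close>
  define C\<^sub>1 where "C\<^sub>1 \<alpha> = (SOME C. good \<alpha> C)" for \<alpha>
  define K\<^sub>1 where "K\<^sub>1 \<alpha> \<mu> = C\<^sub>1 \<alpha> * (1 + 2 * exp_moment K \<mu> / \<bar>\<alpha> + \<mu>\<bar>)" for \<alpha> \<mu>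
  have good: "good \<alpha> (C\<^sub>1 \<alpha>)"
    if "0 < \<mu>" "finite_exp_moment K \<mu>" "max (alpha0 a b K) (ereal (- \<mu>)) < ereal \<alpha>" for \<mu> \<alpha>
  proof -
    have "\<exists>C. good \<alpha> C"
      using uniform_moment_bound[OF assms(1,3,4) that] unfolding good_def by blast
    then show ?thesis unfolding C\<^sub>1_def by (rule someI_ex)
  qed
  have main: "0 < C\<^sub>1 \<alpha> \<and> (\<forall>t\<ge>0. \<bar>X t\<bar> \<le> C\<^sub>1 \<alpha> * exp (\<alpha> * t)) \<and>
      K\<^sub>1 \<alpha> \<mu> = C\<^sub>1 \<alpha> * (1 + 2 * exp_moment K \<mu> / \<bar>\<alpha> + \<mu>\<bar>) \<and>
      (\<forall>\<phi>\<in>BC_neg. \<forall>x. stochastic_solution M F W a b \<sigma>0 \<sigma>1 \<sigma>2 K \<phi> x \<longrightarrow>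
        (\<forall>t\<ge>0. integrable M (x t) \<and>
          \<bar>prob_space.expectation M (x t)\<bar> \<le> K\<^sub>1 \<alpha> \<mu> * BC_norm \<phi> * exp (\<alpha> * t)))"
    if "0 < \<mu> \<and> finite_exp_moment K \<mu> \<and> max (alpha0 a b K) (ereal (- \<mu>)) < ereal \<alpha>" for \<mu> \<alpha>
  proof -
    have \<mu>: "0 < \<mu>" "finite_exp_moment K \<mu>" "- \<mu> < \<alpha>" using that by auto
    have "good \<alpha> (C\<^sub>1 \<alpha>)" using good that by blast
    then show ?thesis using \<mu> unfolding good_def K\<^sub>1_def by blast
  qed
  have stable: "first_moment_exponentially_stable M F W a b \<sigma>0 \<sigma>1 \<sigma>2 K" if neg: "alpha0 a b K < 0"
  proof -
    obtain \<mu> where \<mu>: "0 < \<mu>" "finite_exp_moment K \<mu>" using assms(2) by blast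
    \<comment> \<open>\<open>alpha0\<close> may be minus infinity, but the maximum with - \<mu> is a
      negative real in that case too. A real \<alpha> between it and 0 provides the decay rate -
      \<alpha>.\<close>
    have "max (alpha0 a b K) (ereal (- \<mu>)) < ereal 0" using neg \<mu> by (simp add: zero_ereal_def)
    then obtain \<alpha> where \<alpha>: "max (alpha0 a b K) (ereal (- \<mu>)) < ereal \<alpha>" "\<alpha> < 0"
      using ereal_less_dense2 by blast
    note * = main[of \<mu> \<alpha>]
    have \<rho>: "0 \<le> exp_moment K \<mu>"
      unfolding exp_moment_def set_lebesgue_integral_def using assms(1)
      by (intro Bochner_Integration.integral_nonneg) (auto simp: delay_kernel_def indicator_def)
    have C: "0 < C\<^sub>1 \<alpha>" using * \<mu> \<alpha> by blast
    have "0 \<le> 2 * exp_moment K \<mu> / \<bar>\<alpha> + \<mu>\<bar>" using \<rho> by (intro divide_nonneg_nonneg) auto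
    then have "0 < 1 + 2 * exp_moment K \<mu> / \<bar>\<alpha> + \<mu>\<bar>" by linarith
    then have "0 < K\<^sub>1 \<alpha> \<mu>" unfolding K\<^sub>1_def by (rule mult_pos_pos[OF C])
    moreover have "0 < - \<alpha>" using \<alpha> by simp
    moreover have "\<forall>\<phi>\<in>BC_neg. \<forall>x. stochastic_solution M F W a b \<sigma>0 \<sigma>1 \<sigma>2 K \<phi> x \<longrightarrow>
        (\<forall>t\<ge>0. integrable M (x t) \<and>
          \<bar>prob_space.expectation M (x t)\<bar> \<le> K\<^sub>1 \<alpha> \<mu> * BC_norm \<phi> * exp (- (- \<alpha>) * t))"
      using * \<mu> \<alpha> unfolding minus_minus by blast
    ultimately show ?thesis unfolding first_moment_exponentially_stable_def by blast
  qed
  show ?thesis using main stable by blast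
qed

end
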